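(* Let $\mathbb{J}=D_4^*$, $D_4$ and $\mathbb{Z}^4$ be the four-dimensional hypercubic lattices described in the context. For $\Lambda\in\{\mathbb{J},D_4,\mathbb{Z}^4\}$ let $n_\Lambda(m)$ be the number of similarity sublattices (SSLs) of $\Lambda$ of index $m$ in $\Lambda$, and let $F_\Lambda(s)=\sum_{m\ge 1} n_\Lambda(m)\,m^{-s}$ be the corresponding Dirichlet series generating function. Then: (1) The possible indices of similarity sublattices of hypercubic lattices in four dimensions (i.e. of each $\Lambda\in\{\mathbb{J},D_4,\mathbb{Z}^4\}$) are precisely the squares of nonzero rational integers. (2) The number $n_\Lambda(m)$ of SSLs of given index is a multiplicative arithmetic function of $m$. (3) For $\mathbb{J}=D_4^*$, $$F_{\mathbb{J}}(s)=\frac{(\zeta_{\mathbb{J}}(s))^2}{(1+4^{-s})\,\zeta(4s)}=\frac{(1-2^{1-2s})^2}{1+4^{-s}}\cdot\frac{(\zeta(2s)\,\zeta(2s-1))^2}{\zeta(4s)}.$$ (4) The same series also applies to the lattice $D_4$, i.e. $F_{D_4}(s)=F_{\mathbb{J}}(s)$. (5) For the primitive hypercubic lattice, $$F_{\mathbb{Z}^4}(s)=\Bigl(1+\frac{2}{4^{s}}\Bigr)\cdot F_{\mathbb{J}}(s).$$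
   Context: $\mathbb{R}^4$ is identified with the real quaternions $\mathbb{H}(\mathbb{R})$ via the standard basis $1,i,j,k$ ($i^2=j^2=k^2=ijk=-1$). $\mathbb{Z}^4=\mathbb{Z}1+\mathbb{Z}i+\mathbb{Z}j+\mathbb{Z}k$. $\mathbb{J}=D_4^*$ is Hurwitz' ring of integral quaternions: the set of $(x_0,x_1,x_2,x_3)$ whose coordinates either all lie in $\mathbb{Z}$ or all lie in $\mathbb{Z}+\tfrac12$. $D_4=\{x\in\mathbb{Z}^4 : x_0+x_1+x_2+x_3 \text{ even}\}$ is the root lattice, and it is similar to $D_4^*$. Up to similarity there are two hypercubic lattices in 4-space, represented by $\mathbb{Z}^4$ and $D_4$ (or equivalently $D_4^*=\mathbb{J}$). Similarity sublattice: for a lattice $\Lambda$ spanning $\mathbb{R}^4$, a subset $M\subset\Lambda$ is a similarity sublattice (SSL) of $\Lambda$ if there are $\alpha\in\mathbb{R}\setminus\{0\}$ and $R\in\mathrm{O}(4)$ with $M=\alpha R(\Lambda)\subset\Lambda$. Its index is the group index $[\Lambda:M]$. SSLs are counted as subsets. $\zeta(s)$ is the Riemann zeta function. $\zeta_{\mathbb{J}}(s)=\sum_{\mathfrak{a}}[\mathbb{J}:\mathfrak{a}]^{-s}$, where $\mathfrak{a}$ runs over the non-zero left ideals of $\mathbb{J}$. A function $f$ on positive integers is multiplicative if $f(1)=1$ and $f(mn)=f(m)f(n)$ for coprime $m,n$. *)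

theory Defs
  imports "HOL-Analysis.Analysis"
begin

section \<open>Quaternions and the hypercubic lattices\<close>

text \<open>
  The quaternion $x_0 + x_1 i + x_2 j + x_3 k$ is the vector with components
  \<open>x $ 1\<close>, \<open>x $ 2\<close>, \<open>x $ 3\<close>, \<open>x $ 4\<close>, in this order; the lemma below records
  $i^2 = j^2 = k^2 = ijk = -1$.
\<close>

definition qmult :: "real ^ 4 \<Rightarrow> real ^ 4 \<Rightarrow> real ^ 4" where
  "qmult x y = vector
     [x $ 1 * y $ 1 - x $ 2 * y $ 2 - x $ 3 * y $ 3 - x $ 4 * y $ 4,
      x $ 1 * y $ 2 + x $ 2 * y $ 1 + x $ 3 * y $ 4 - x $ 4 * y $ 3,
      x $ 1 * y $ 3 - x $ 2 * y $ 4 + x $ 3 * y $ 1 + x $ 4 * y $ 2,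
      x $ 1 * y $ 4 + x $ 2 * y $ 3 - x $ 3 * y $ 2 + x $ 4 * y $ 1]"

lemma vector_4_nth:
  "(vector [a, b, c, d] :: 'a::zero ^ 4) $ 1 = a"
  "(vector [a, b, c, d] :: 'a::zero ^ 4) $ 2 = b"
  "(vector [a, b, c, d] :: 'a::zero ^ 4) $ 3 = c"
  "(vector [a, b, c, d] :: 'a::zero ^ 4) $ 4 = d"
  by (simp_all add: vector_def)

lemma qmult_basis:
  "qmult (axis 1 1) x = x" "qmult x (axis 1 1) = x"
  "qmult (axis 2 1) (axis 2 1) = - axis 1 1"
  "qmult (axis 3 1) (axis 3 1) = - axis 1 1"
  "qmult (axis 4 1) (axis 4 1) = - axis 1 1"
  "qmult (qmult (axis 2 1) (axis 3 1)) (axis 4 1) = - axis 1 1"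
  by (simp_all add: qmult_def vec_eq_iff forall_4 vector_4_nth axis_def)

definition lattice_Z4 :: "(real ^ 4) set" where
  "lattice_Z4 = {x. \<forall>i. x $ i \<in> \<int>}"

definition lattice_D4 :: "(real ^ 4) set" where
  "lattice_D4 = {x \<in> lattice_Z4. \<exists>k::int. (\<Sum>i\<in>UNIV. x $ i) = 2 * of_int k}"

definition hurwitz :: "(real ^ 4) set" where
  "hurwitz = {x. (\<forall>i. x $ i \<in> \<int>) \<or> (\<forall>i. x $ i - 1 / 2 \<in> \<int>)}"


section \<open>Similarity sublattices and their number\<close>

text \<open>The number of cosets of \<open>M\<close> in \<open>L\<close>; infinite index yields 0.\<close>

definition lattice_index :: "(real ^ 4) set \<Rightarrow> (real ^ 4) set \<Rightarrow> nat" where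
  "lattice_index L M = card ((\<lambda>x. (\<lambda>y. x + y) ` M) ` L)"

definition SSL :: "(real ^ 4) set \<Rightarrow> (real ^ 4) set \<Rightarrow> bool" where
  "SSL L M \<longleftrightarrow>
     (\<exists>(\<alpha>::real) R. \<alpha> \<noteq> 0 \<and> orthogonal_transformation R \<and> M = (\<lambda>x. \<alpha> *\<^sub>R R x) ` L) \<and> M \<subseteq> L"

definition SSL_count :: "(real ^ 4) set \<Rightarrow> nat \<Rightarrow> nat" where
  "SSL_count L m = card {M. SSL L M \<and> lattice_index L M = m}"

definition multiplicative_fun :: "(nat \<Rightarrow> nat) \<Rightarrow> bool" where
  "multiplicative_fun f \<longleftrightarrow>
     f 1 = 1 \<and> (\<forall>m n. m > 0 \<longrightarrow> n > 0 \<longrightarrow> coprime m n \<longrightarrow> f (m * n) = f m * f n)"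


section \<open>Dirichlet series\<close>

definition SSL_series :: "(real ^ 4) set \<Rightarrow> complex \<Rightarrow> complex" where
  "SSL_series L s = (\<Sum>\<^sub>\<infinity>m\<in>{1..}. of_nat (SSL_count L m) * of_nat m powr (- s))"

text \<open>Riemann's zeta function on the half-plane \<open>Re s > 1\<close> (no analytic continuation).\<close>

definition zeta :: "complex \<Rightarrow> complex" where
  "zeta s = (\<Sum>\<^sub>\<infinity>n\<in>{1::nat..}. of_nat n powr (- s))"

definition hurwitz_left_ideal :: "(real ^ 4) set \<Rightarrow> bool" where
  "hurwitz_left_ideal I \<longleftrightarrow>
     I \<subseteq> hurwitz \<and> 0 \<in> I \<and> (\<forall>x\<in>I. \<forall>y\<in>I. x - y \<in> I) \<and> (\<forall>a\<in>hurwitz. \<forall>x\<in>I. qmult a x \<in> I)"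

definition zeta_J :: "complex \<Rightarrow> complex" where
  "zeta_J s =
     (\<Sum>\<^sub>\<infinity>I\<in>{I. hurwitz_left_ideal I \<and> I \<noteq> {0}}. of_nat (lattice_index hurwitz I) powr (- s))"

end

theory Submission
  imports Defs "HOL-Computational_Algebra.Primes" "HOL-Computational_Algebra.Nth_Powers"
begin

text \<open>
  Let \<open>J\<close> be the Hurwitz ring and \<open>M = y S(L)\<close> a similarity sublattice of \<open>L = J\<close> or \<open>L = Z\<^sup>4\<close>,
  where the isometry \<open>S\<close> fixes \<open>1\<close> and is therefore an automorphism or antiautomorphism of the
  quaternions. The left ideal of \<open>J\<close> generated by \<open>M\<close> is principal, say \<open>J b\<close>, and it is stable
  under the order \<open>S(Z\<^sup>4)\<close>; hence \<open>b S(Z\<^sup>4) b\<^sup>-\<^sup>1 \<subseteq> J\<close>, and counting elements of norm one shows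
  \<open>M = a L b\<close> with \<open>a, b \<in> J\<close>.

  If \<open>b\<close> is primitive of odd norm, then \<open>J b J = J\<close>, so \<open>a J\<close> and \<open>J b\<close> can be recovered from
  \<open>a J b\<close>. Every left ideal is uniquely the product of a two-sided ideal and a primitive one, and
  two-sided factors can be moved across \<open>J\<close>. Hence \<open>F\<^sub>J = \<zeta>\<^sub>J A\<close> and \<open>\<zeta>\<^sub>J = T A\<close>, where \<open>A\<close> and \<open>T\<close>
  are the sums over the primitive left ideals and over the two-sided ideals. The number of left
  ideals of index \<open>n\<^sup>2\<close> is the sum of the odd divisors of \<open>n\<close>: for odd primes \<open>p\<close> the left ideals of
  index \<open>p\<^sup>2\<close> correspond to the points of the projective line modulo \<open>p\<close>, and a Hecke relation does
  the rest.

  The lattice \<open>D\<^sub>4 = (1 + i) J\<close> is similar to \<open>J\<close>. Each \<open>a J b\<close> contains exactly three lattices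
  \<open>a e Z\<^sup>4 b\<close> with a unit \<open>e\<close>; since \<open>J / (1 + i) J\<close> is the field with four elements and \<open>Z\<^sup>4\<close> is the
  preimage of its prime field, all three are contained in \<open>Z\<^sup>4\<close> if \<open>a b\<close> has even norm, and
  exactly one is otherwise.
\<close>
section \<open>Quaternions\<close>

text \<open>The prime 2 shapes the count. It is ramified: \<open>\<theta>\<close> = 1 + i generates
  a two-sided ideal and its square is 2i. Hence primitivity includes odd norm, and the two-sided
  part of a left ideal is generated by some \<open>\<theta> ^ k\<close> times an odd m, of norm 2^k
  m^2. As an index is the square of a norm, T is the sum of 4^(-ks) m^(-4s), that is (1 - 16^(-s))
  zeta(4s) / (1 - 4^(-s)) = (1 + 4^(-s)) zeta(4s). Eliminating A from F_J = zeta_J A and zeta_J = T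
  A produces this as a denominator, so zeta(4s) must be shown to be nonzero. The factor 1 + 2/4^s of
  Z^4 also comes from 2: the number of sublattices of J is unchanged when the norm doubles, so
  tripling the term at an even norm n amounts to adding twice the term at n/2. Z^4 is not a
  principal ideal ring. Similarities are therefore studied through the image of Z^4 inside J, which
  treats both lattices at once. Ideals are counted through their generators, whose number per ideal
  is constant, so that factorisations of elements yield the convolution and Hecke identities. The
  Dirichlet series are sums over sets of lattices and factor along bijections.\<close>

datatype quat = Quat (qa: real) (qb: real) (qc: real) (qd: real)

lemmas quat_eqI = quat.expand

instantiation quat :: real_algebra_1
begin

definition "0 = Quat 0 0 0 0"
definition "1 = Quat 1 0 0 0"
definition "x + y = Quat (qa x + qa y) (qb x + qb y) (qc x + qc y) (qd x + qd y)"
definition "- x = Quat (- qa x) (- qb x) (- qc x) (- qd x)"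
definition "x - y = Quat (qa x - qa y) (qb x - qb y) (qc x - qc y) (qd x - qd y)"
definition "x * y = Quat
  (qa x * qa y - qb x * qb y - qc x * qc y - qd x * qd y)
  (qa x * qb y + qb x * qa y + qc x * qd y - qd x * qc y)
  (qa x * qc y - qb x * qd y + qc x * qa y + qd x * qb y)
  (qa x * qd y + qb x * qc y - qc x * qb y + qd x * qa y)"
definition "r *\<^sub>R x = Quat (r * qa x) (r * qb x) (r * qc x) (r * qd x)"

instance
  by standard
    (simp_all add: zero_quat_def one_quat_def plus_quat_def uminus_quat_def minus_quat_def
      times_quat_def scaleR_quat_def algebra_simps)

end

lemma quat_sel [simp]:
  "qa 0 = 0" "qb 0 = 0" "qc 0 = 0" "qd 0 = 0"
  "qa 1 = 1" "qb 1 = 0" "qc 1 = 0" "qd 1 = 0"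
  "qa (x + y) = qa x + qa y" "qb (x + y) = qb x + qb y"
  "qc (x + y) = qc x + qc y" "qd (x + y) = qd x + qd y"
  "qa (- x) = - qa x" "qb (- x) = - qb x" "qc (- x) = - qc x" "qd (- x) = - qd x"
  "qa (x - y) = qa x - qa y" "qb (x - y) = qb x - qb y"
  "qc (x - y) = qc x - qc y" "qd (x - y) = qd x - qd y"
  "qa (r *\<^sub>R x) = r * qa x" "qb (r *\<^sub>R x) = r * qb x"
  "qc (r *\<^sub>R x) = r * qc x" "qd (r *\<^sub>R x) = r * qd x"
  by (simp_all add: zero_quat_def one_quat_def plus_quat_def uminus_quat_def minus_quat_def
      scaleR_quat_def)

lemma quat_sel_times [simp]:
  "qa (x * y) = qa x * qa y - qb x * qb y - qc x * qc y - qd x * qd y"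
  "qb (x * y) = qa x * qb y + qb x * qa y + qc x * qd y - qd x * qc y"
  "qc (x * y) = qa x * qc y - qb x * qd y + qc x * qa y + qd x * qb y"
  "qd (x * y) = qa x * qd y + qb x * qc y - qc x * qb y + qd x * qa y"
  by (simp_all add: times_quat_def)

lemma quat_sel_of_nat [simp]:
  "qa (of_nat n) = of_nat n" "qb (of_nat n) = 0" "qc (of_nat n) = 0" "qd (of_nat n) = 0"
  by (induction n) simp_all

lemma quat_sel_of_int [simp]:
  "qa (of_int n) = of_int n" "qb (of_int n) = 0" "qc (of_int n) = 0" "qd (of_int n) = 0"
  by (cases n rule: int_cases2; simp)+

lemma quat_sel_of_real [simp]:
  "qa (of_real r) = r" "qb (of_real r) = 0" "qc (of_real r) = 0" "qd (of_real r) = 0"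
  by (simp_all add: of_real_def)

lemma quat_sel_numeral [simp]:
  "qa (numeral n) = numeral n" "qb (numeral n) = 0" "qc (numeral n) = 0" "qd (numeral n) = 0"
  using quat_sel_of_nat[of "numeral n"] by (simp_all only: of_nat_numeral)

definition qconj :: "quat \<Rightarrow> quat" where
  "qconj x = Quat (qa x) (- qb x) (- qc x) (- qd x)"

definition nrm :: "quat \<Rightarrow> real" where
  "nrm x = (qa x)\<^sup>2 + (qb x)\<^sup>2 + (qc x)\<^sup>2 + (qd x)\<^sup>2"

lemma qconj_sel [simp]:
  "qa (qconj x) = qa x" "qb (qconj x) = - qb x" "qc (qconj x) = - qc x" "qd (qconj x) = - qd x"
  by (simp_all add: qconj_def)

lemma qconj_simps [simp]:
  "qconj (qconj x) = x" "qconj 0 = 0" "qconj 1 = 1"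
  "qconj (x + y) = qconj x + qconj y" "qconj (x - y) = qconj x - qconj y"
  "qconj (- x) = - qconj x" "qconj (r *\<^sub>R x) = r *\<^sub>R qconj x"
  "qconj (of_nat n) = of_nat n" "qconj (of_int k) = of_int k"
  by (auto intro!: quat_eqI)

lemma qconj_mult: "qconj (x * y) = qconj y * qconj x"
  by (auto intro!: quat_eqI simp: algebra_simps)

lemma qconj_eq_iff [simp]: "qconj x = qconj y \<longleftrightarrow> x = y"
  by (metis qconj_simps(1))

lemma nrm_conj [simp]: "nrm (qconj x) = nrm x"
  by (simp add: nrm_def)

lemma mult_qconj: "x * qconj x = of_real (nrm x)" "qconj x * x = of_real (nrm x)"
  by (auto intro!: quat_eqI simp: nrm_def power2_eq_square algebra_simps)

lemma nrm_mult: "nrm (x * y) = nrm x * nrm y"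
  by (simp add: nrm_def power2_eq_square algebra_simps)

lemma nrm_simps [simp]:
  "nrm 0 = 0" "nrm 1 = 1" "nrm (- x) = nrm x" "nrm (of_nat n) = (of_nat n)\<^sup>2"
  "nrm (r *\<^sub>R x) = r\<^sup>2 * nrm x" "nrm (of_real r) = r\<^sup>2"
  by (simp_all add: nrm_def algebra_simps power_mult_distrib)

lemma nrm_nonneg [simp]: "nrm x \<ge> 0"
  by (simp add: nrm_def)

lemma nrm_eq_0_iff [simp]: "nrm x = 0 \<longleftrightarrow> x = 0"
proof
  assume "nrm x = 0"
  then have "(qa x)\<^sup>2 = 0 \<and> (qb x)\<^sup>2 = 0 \<and> (qc x)\<^sup>2 = 0 \<and> (qd x)\<^sup>2 = 0"
    unfolding nrm_def
    by (smt (verit, best) zero_le_power2)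
  then show "x = 0" by (auto intro!: quat_eqI)
qed simp

lemma nrm_pos_iff [simp]: "nrm x > 0 \<longleftrightarrow> x \<noteq> 0"
  using nrm_nonneg[of x] nrm_eq_0_iff[of x] by linarith

instantiation quat :: division_ring
begin

definition "inverse x = (1 / nrm x) *\<^sub>R qconj x"
definition "x div (y::quat) = x * ((1 / nrm y) *\<^sub>R qconj y)"

instance
proof
  fix x y :: quat
  show "inverse x * x = 1" if "x \<noteq> 0"
    using that by (simp add: inverse_quat_def mult_qconj of_real_def)
  show "x * inverse x = 1" if "x \<noteq> 0"
    using that by (simp add: inverse_quat_def mult_qconj of_real_def)
  show "x div y = x * inverse y" by (simp add: divide_quat_def inverse_quat_def)
  show "inverse (0::quat) = 0" by (simp add: inverse_quat_def)
qed

end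

instance quat :: real_div_algebra ..

lemma nrm_inverse: "nrm (inverse x) = inverse (nrm x)"
proof (cases "x = 0")
  case False
  then have "nrm (inverse x) * nrm x = 1"
    by (metis left_inverse nrm_mult nrm_simps(2))
  then show ?thesis using False by (simp add: field_simps)
qed simp

lemma mult_inverse_cancel [simp]:
  fixes x y :: quat
  assumes "x \<noteq> 0"
  shows "inverse x * (x * y) = y" "x * (inverse x * y) = y"
  using assms by (simp_all flip: mult.assoc)

lemma of_nat_mult_commute: "x * (of_nat n * y) = of_nat n * (x * (y::quat))"
  by (metis mult.assoc mult_of_nat_commute)

section \<open>The Hurwitz ring\<close>

abbreviation "q\<i> \<equiv> Quat 0 1 0 0"
abbreviation "q\<j> \<equiv> Quat 0 0 1 0"
abbreviation "q\<k> \<equiv> Quat 0 0 0 1"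
abbreviation "\<h> \<equiv> Quat (1/2) (1/2) (1/2) (1/2)"
abbreviation "\<theta> \<equiv> Quat 1 1 0 0"

text \<open>\<open>A\<close>, \<open>b\<close>, \<open>c\<close>, \<open>d\<close> are the
  coordinates in the Z-basis \<open>\<h>\<close>, \<open>q\<i>\<close>, \<open>q\<j>\<close>,
  \<open>q\<k>\<close>. Even \<open>A\<close> gives the integral and odd \<open>A\<close> the
  half-integral elements, so one formula serves both in later calculations.\<close>

definition hur :: "quat set" where
  "hur = {x. \<exists>A b c d. x = Quat (of_int A/2) (of_int A/2 + of_int b) (of_int A/2 + of_int c) (of_int A/2 + of_int d)}"

definition lip :: "quat set" where
  "lip = {x. \<exists>a b c d. x = Quat (of_int a) (of_int b) (of_int c) (of_int d)}"

lemma hurI: "x = Quat (of_int A/2) (of_int A/2+ of_int b) (of_int A/2+ of_int c) (of_int A/2+ of_int d) \<Longrightarrow> x \<in> hur"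
  unfolding hur_def by blast

lemma hurE:
  assumes "x \<in> hur"
  obtains A b c d :: int where "x = Quat (A/2) (A/2+b) (A/2+c) (A/2+d)"
  using assms unfolding hur_def by blast

lemma lipI: "x = Quat (of_int a) (of_int b) (of_int c) (of_int d) \<Longrightarrow> x \<in> lip"
  unfolding lip_def by blast

lemma lipE:
  assumes "x \<in> lip"
  obtains a b c d :: int where "x = Quat a b c d"
  using assms unfolding lip_def by blast

lemma Quat_arith:
  "Quat a b c d + Quat a' b' c' d' = Quat (a+a') (b+b') (c+c') (d+d')"
  "Quat a b c d - Quat a' b' c' d' = Quat (a-a') (b-b') (c-c') (d-d')"
  "- Quat a b c d = Quat (-a) (-b) (-c) (-d)"
  "qconj (Quat a b c d) = Quat a (-b) (-c) (-d)"
  by (auto intro!: quat_eqI)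

lemma lip_hur: "x \<in> lip \<Longrightarrow> x \<in> hur"
  by (erule lipE, rule_tac A="2*a" and b="b-a" and c="c-a" and d="d-a" in hurI) simp

lemma hur_add: "x \<in> hur \<Longrightarrow> y \<in> hur \<Longrightarrow> x + y \<in> hur"
  by (elim hurE, rule_tac A="A+Aa" and b="b+ba" and c="c+ca" and d="d+da" in hurI)
    (simp add: Quat_arith field_simps)

lemma hur_uminus: "x \<in> hur \<Longrightarrow> - x \<in> hur"
  by (elim hurE, rule_tac A="-A" and b="-b" and c="-c" and d="-d" in hurI)
    (simp add: Quat_arith)

lemma hur_diff: "x \<in> hur \<Longrightarrow> y \<in> hur \<Longrightarrow> x - y \<in> hur"
  using hur_add[of x "- y"] hur_uminus[of y] by simp

lemma hur_conj: "x \<in> hur \<Longrightarrow> qconj x \<in> hur"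
  by (elim hurE, rule_tac A="A" and b="-A-b" and c="-A-c" and d="-A-d" in hurI)
    (simp add: Quat_arith field_simps)

lemma hur_mult:
  assumes "x \<in> hur" "y \<in> hur"
  shows "x * y \<in> hur"
proof -
  obtain A b c d :: int where x: "x = Quat (A/2) (A/2+b) (A/2+c) (A/2+d)"
    using assms(1) by (rule hurE)
  obtain A' b' c' d' :: int where y: "y = Quat (A'/2) (A'/2+b') (A'/2+c') (A'/2+d')"
    using assms(2) by (rule hurE)
  define s where "s = b*b' + c*c' + d*d'"
  show ?thesis
    by (rule hurI[where A = "- A*A' - A*(b'+c'+d') - A'*(b+c+d) - 2 * s"
          and b = "A*A' + A*(b'+d') + A'*(b+c) + c*d' - d*c' + s"
          and c = "A*A' + A*(c'+b') + A'*(c+d) + d*b' - b*d' + s"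
          and d = "A*A' + A*(d'+c') + A'*(d+b) + b*c' - c*b' + s"], rule quat_eqI)
      (simp add: x y s_def field_simps)
qed

lemma lip_add: "x \<in> lip \<Longrightarrow> y \<in> lip \<Longrightarrow> x + y \<in> lip"
  by (elim lipE, rule_tac a="a+aa" and b="b+ba" and c="c+ca" and d="d+da" in lipI)
    (simp add: Quat_arith)

lemma lip_uminus: "x \<in> lip \<Longrightarrow> - x \<in> lip"
  by (elim lipE, rule_tac a="-a" and b="-b" and c="-c" and d="-d" in lipI)
    (simp add: Quat_arith)

lemma lip_diff: "x \<in> lip \<Longrightarrow> y \<in> lip \<Longrightarrow> x - y \<in> lip"
  using lip_add[of x "- y"] lip_uminus[of y] by simp

lemma lip_conj: "x \<in> lip \<Longrightarrow> qconj x \<in> lip"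
  by (elim lipE, rule_tac a="a" and b="-b" and c="-c" and d="-d" in lipI)
    (simp add: Quat_arith)

lemma lip_mult:
  assumes "x \<in> lip" "y \<in> lip"
  shows "x * y \<in> lip"
proof -
  obtain a b c d :: int where x: "x = Quat a b c d"
    using assms(1) by (rule lipE)
  obtain a' b' c' d' :: int where y: "y = Quat a' b' c' d'"
    using assms(2) by (rule lipE)
  show ?thesis
    by (rule lipI[where a = "a*a' - b*b' - c*c' - d*d'" and b = "a*b' + b*a' + c*d' - d*c'"
          and c = "a*c' - b*d' + c*a' + d*b'" and d = "a*d' + b*c' - c*b' + d*a'"], rule quat_eqI)
      (simp add: x y)
qed

lemma lip_of_int [simp]: "of_int n \<in> lip"
  by (rule lipI[of _ n 0 0 0], rule quat_eqI) simp

lemma lip_of_nat [simp]: "of_nat n \<in> lip"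
  using lip_of_int[of "int n"] by simp

lemma lip_0_1 [simp]: "0 \<in> lip" "1 \<in> lip"
  using lip_of_int[of 0] lip_of_int[of 1] by simp_all

lemma lip_basis [simp]: "q\<i> \<in> lip" "q\<j> \<in> lip" "q\<k> \<in> lip" "\<theta> \<in> lip"
  by (rule lipI[of _ 0 1 0 0] lipI[of _ 0 0 1 0] lipI[of _ 0 0 0 1] lipI[of _ 1 1 0 0], simp)+

lemma hur_basis [simp]: "0 \<in> hur" "1 \<in> hur" "of_int n \<in> hur" "of_nat m \<in> hur"
  "q\<i> \<in> hur" "q\<j> \<in> hur" "q\<k> \<in> hur" "\<theta> \<in> hur"
  by (simp_all add: lip_hur)

lemma hur_h [simp]: "\<h> \<in> hur"
  by (rule hurI[of _ 1 0 0 0]) simp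

lemma hur_decomp:
  assumes "x \<in> hur"
  obtains A b c d :: int where
    "x = of_int A * \<h> + of_int b * q\<i> + of_int c * q\<j> + of_int d * q\<k>"
proof -
  obtain A b c d :: int where x: "x = Quat (A/2) (A/2+b) (A/2+c) (A/2+d)"
    using assms by (rule hurE)
  show ?thesis by (rule that[of A b c d], rule quat_eqI) (simp add: x)
qed

lemma lip_decomp:
  assumes "x \<in> lip"
  obtains a b c d :: int where
    "x = of_int a + of_int b * q\<i> + of_int c * q\<j> + of_int d * q\<k>"
proof -
  obtain a b c d :: int where x: "x = Quat a b c d"
    using assms by (rule lipE)
  show ?thesis by (rule that[of a b c d], rule quat_eqI) (simp add: x)
qed

section \<open>The norm as a natural number\<close>

definition nnrm :: "quat \<Rightarrow> nat" where
  "nnrm x = nat \<lfloor>nrm x\<rfloor>"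

lemma real_nnrm: "x \<in> hur \<Longrightarrow> real (nnrm x) = nrm x"
proof (elim hurE)
  fix A b c d :: int
  assume x: "x = Quat (A/2) (A/2+b) (A/2+c) (A/2+d)"
  define k where "k = A*A + A*(b+c+d) + b*b+c*c+d*d"
  have k: "nrm x = of_int k"
    by (simp add: x k_def nrm_def power2_eq_square field_simps)
  then have "k \<ge> 0" using nrm_nonneg[of x] by simp
  then show ?thesis unfolding nnrm_def k by simp
qed

lemma nnrm_eqI: "x \<in> hur \<Longrightarrow> nrm x = real n \<Longrightarrow> nnrm x = n"
  by (metis of_nat_eq_iff real_nnrm)

lemma nnrm_mult: "x \<in> hur \<Longrightarrow> y \<in> hur \<Longrightarrow> nnrm (x * y) = nnrm x * nnrm y"
  by (rule nnrm_eqI) (simp_all add: hur_mult nrm_mult real_nnrm)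

lemma nnrm_conj [simp]: "nnrm (qconj x) = nnrm x"
  by (simp add: nnrm_def)

lemma nnrm_simps [simp]: "nnrm 0 = 0" "nnrm 1 = 1" "nnrm (of_nat n) = n\<^sup>2" "nnrm \<theta> = 2"
  by (rule nnrm_eqI; simp add: nrm_def)+

lemma nnrm_eq_0_iff: "x \<in> hur \<Longrightarrow> nnrm x = 0 \<longleftrightarrow> x = 0"
  by (metis nrm_eq_0_iff of_nat_eq_0_iff real_nnrm)

lemma nnrm_pos: "x \<in> hur \<Longrightarrow> x \<noteq> 0 \<Longrightarrow> nnrm x > 0"
  using nnrm_eq_0_iff by blast

lemma mult_qconj_nnrm:
  assumes "x \<in> hur"
  shows "x * qconj x = of_nat (nnrm x)" "qconj x * x = of_nat (nnrm x)"
  using assms by (simp_all add: mult_qconj flip: real_nnrm)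

lemma unit_inverse:
  assumes "x \<in> hur" "nnrm x = 1"
  shows "x * qconj x = 1" "qconj x * x = 1"
  using assms by (simp_all add: mult_qconj_nnrm)

lemma finite_hur_nnrm: "finite {x \<in> hur. nnrm x = n}"
proof -
  let ?B = "{- int (2*n) .. int (2*n)}"
  let ?f = "\<lambda>(a,b,c,d). Quat (of_int a/2) (of_int b/2) (of_int c/2) (of_int d/2)"
  have "{x \<in> hur. nnrm x = n} \<subseteq> ?f ` (?B \<times> ?B \<times> ?B \<times> ?B)"
  proof
    fix x assume "x \<in> {x \<in> hur. nnrm x = n}"
    then have x: "x \<in> hur" "nnrm x = n" by auto
    then obtain A b c d :: int where xx: "x = Quat (A/2) (A/2+b) (A/2+c) (A/2+d)"
      using hurE by blast
    \<comment> \<open>\<open>z\<close> stands for a doubled coordinate: z^2 <= 4n <= (2n)^2 for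
      every natural number n.\<close>
    have bd: "\<bar>z\<bar> \<le> int (2*n)" if "(real_of_int z / 2)\<^sup>2 \<le> nrm x" for z :: int
    proof -
      have "nrm x = real n" using x real_nnrm by metis
      with that have "real_of_int (z\<^sup>2) \<le> real_of_int (4 * int n)"
        by (simp add: power_divide)
      then have "z\<^sup>2 \<le> 4 * int n" by (simp only: of_int_le_iff)
      also have "\<dots> \<le> (int (2*n))\<^sup>2"
        by (cases n) (auto simp: power2_eq_square algebra_simps)
      finally show ?thesis
        by (metis abs_of_nat abs_le_square_iff)
    qed
    have "\<bar>A\<bar> \<le> int (2*n)" "\<bar>A + 2*b\<bar> \<le> int (2*n)" "\<bar>A + 2*c\<bar> \<le> int (2*n)" "\<bar>A + 2*d\<bar> \<le> int (2*n)"
      by (rule bd; simp add: xx nrm_def add_divide_distrib)+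
    then have "(A, A+2*b, A+2*c, A+2*d) \<in> ?B \<times> ?B \<times> ?B \<times> ?B" by auto
    moreover have "x = ?f (A, A+2*b, A+2*c, A+2*d)"
      by (simp add: xx add_divide_distrib)
    ultimately show "x \<in> ?f ` (?B \<times> ?B \<times> ?B \<times> ?B)" by (rule rev_image_eqI)
  qed
  then show ?thesis by (rule finite_subset) simp
qed

section \<open>Euclidean division and principal ideals\<close>

text \<open>Rounding each coordinate leaves an error of norm at most 4 * 1/4 = 1. Equality forces
  all four coordinates to be half-odd, and then \<open>q\<close> itself is a Hurwitz element; this
  is the case in which the Lipschitz order fails to be Euclidean.\<close>

lemma hur_approx: "\<exists>x\<in>hur. nrm (q - x) < 1"
proof -
  define r where "r = (\<lambda>t::real. t - of_int (round t))"
  have r: "\<bar>r t\<bar> \<le> 1/2" for t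
    using of_int_round_abs_le[of t] by (simp add: r_def abs_minus_commute)
  then have r2: "(r t)\<^sup>2 \<le> 1/4" for t
    using power_mono[of "\<bar>r t\<bar>" "1/2" 2] by (simp add: power_divide)
  define x where "x = Quat (of_int (round (qa q))) (of_int (round (qb q))) (of_int (round (qc q))) (of_int (round (qd q)))"
  have x: "x \<in> lip" unfolding x_def by (rule lipI) simp
  have n: "nrm (q - x) = (r (qa q))\<^sup>2 + (r (qb q))\<^sup>2 + (r (qc q))\<^sup>2 + (r (qd q))\<^sup>2"
    by (simp add: nrm_def x_def r_def)
  show ?thesis
  proof (cases "nrm (q - x) < 1")
    case True
    then show ?thesis using x lip_hur by blast
  next
    case False
    have "(r (qa q))\<^sup>2 = 1/4" "(r (qb q))\<^sup>2 = 1/4" "(r (qc q))\<^sup>2 = 1/4" "(r (qd q))\<^sup>2 = 1/4"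
      using False r2[of "qa q"] r2[of "qb q"] r2[of "qc q"] r2[of "qd q"] n by linarith+
    then have *: "\<bar>r (qa q)\<bar> = 1/2" "\<bar>r (qb q)\<bar> = 1/2" "\<bar>r (qc q)\<bar> = 1/2" "\<bar>r (qd q)\<bar> = 1/2"
      by (metis abs_ge_zero power2_abs real_sqrt_divide real_sqrt_four real_sqrt_one real_sqrt_unique)+
    have half: "\<exists>k::int. t = of_int k + 1/2" if "\<bar>r t\<bar> = 1/2" for t
    proof (cases "r t \<ge> 0")
      case True
      with that show ?thesis by (intro exI[of _ "round t"]) (simp add: r_def)
    next
      case False
      with that show ?thesis by (intro exI[of _ "round t - 1"]) (simp add: r_def)
    qed
    obtain k1 k2 k3 k4 :: int where k: "qa q = k1 + 1/2" "qb q = k2 + 1/2" "qc q = k3 + 1/2" "qd q = k4 + 1/2"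
      using half *  by metis
    have "q \<in> hur"
      by (rule hurI[of _ "2*k1+1" "k2-k1" "k3-k1" "k4-k1"], rule quat_eqI) (simp add: k field_simps)
    then show ?thesis by (intro bexI[of _ q]) simp_all
  qed
qed

definition left_ideal :: "quat set \<Rightarrow> bool" where
  "left_ideal I \<longleftrightarrow> I \<subseteq> hur \<and> 0 \<in> I \<and> (\<forall>x\<in>I. \<forall>y\<in>I. x - y \<in> I) \<and> (\<forall>a\<in>hur. \<forall>x\<in>I. a * x \<in> I)"

definition lid :: "quat \<Rightarrow> quat set" where
  "lid b = (\<lambda>x. x * b) ` hur"

definition qlat :: "quat \<Rightarrow> quat \<Rightarrow> quat set" where
  "qlat a b = (\<lambda>x. a * x * b) ` hur"

lemma left_ideal_lid: "b \<in> hur \<Longrightarrow> left_ideal (lid b)"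
  unfolding left_ideal_def lid_def
  by (auto simp: hur_mult mult.assoc [symmetric] left_diff_distrib[symmetric]
      intro!: imageI hur_diff hur_mult image_eqI[of 0 _ 0])

lemma left_ideal_principal:
  assumes "left_ideal I" "I \<noteq> {0}"
  obtains b where "b \<in> hur" "b \<noteq> 0" "I = lid b"
proof -
  have I: "I \<subseteq> hur" "0 \<in> I" "\<And>x y. x\<in>I \<Longrightarrow> y\<in>I \<Longrightarrow> x - y \<in> I" "\<And>a x. a\<in>hur \<Longrightarrow> x\<in>I \<Longrightarrow> a * x \<in> I"
    using assms(1) unfolding left_ideal_def by auto
  from assms(2) I(2) obtain b0 where "b0 \<in> I \<and> b0 \<noteq> 0" by blast
  then obtain b where b: "b \<in> I" "b \<noteq> 0" and min: "\<And>y. y \<in> I \<Longrightarrow> y \<noteq> 0 \<Longrightarrow> nnrm b \<le> nnrm y"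
    using ex_has_least_nat[of "\<lambda>b. b \<in> I \<and> b \<noteq> 0" b0 nnrm] by blast
  have "lid b \<subseteq> I" unfolding lid_def using b I(4) by auto
  moreover have "x \<in> lid b" if "x \<in> I" for x
  proof -
    obtain q where q: "q \<in> hur" "nrm (x * inverse b - q) < 1" using hur_approx by blast
    have "x - q * b = (x * inverse b - q) * b"
      using b by (simp add: left_diff_distrib mult.assoc)
    then have "nrm (x - q * b) = nrm (x * inverse b - q) * nrm b" by (metis nrm_mult)
    also have "\<dots> < nrm b" using q(2) b(2) by simp
    finally have lt: "nrm (x - q * b) < nrm b" .
    have mem: "x - q * b \<in> I" using I(3,4) that b(1) q(1) by blast
    then have "real (nnrm (x - q * b)) < real (nnrm b)"
      using lt I(1) b(1) by (simp add: real_nnrm subset_iff)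
    then have "nnrm (x - q * b) < nnrm b" by simp
    then have "x - q * b = 0" using min[OF mem] by linarith
    then show ?thesis unfolding lid_def using q(1) by auto
  qed
  ultimately show ?thesis using that[of b] b I(1) by blast
qed

section \<open>Indices of sublattices\<close>

definition sgrp :: "quat set \<Rightarrow> bool" where
  "sgrp L \<longleftrightarrow> 0 \<in> L \<and> (\<forall>x\<in>L. \<forall>y\<in>L. x - y \<in> L)"

lemma sgrpD:
  assumes "sgrp L"
  shows "0 \<in> L" "x \<in> L \<Longrightarrow> y \<in> L \<Longrightarrow> x - y \<in> L" "x \<in> L \<Longrightarrow> - x \<in> L"
    "x \<in> L \<Longrightarrow> y \<in> L \<Longrightarrow> x + y \<in> L"
proof -
  show 0: "0 \<in> L" and d: "x \<in> L \<Longrightarrow> y \<in> L \<Longrightarrow> x - y \<in> L" for x y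
    using assms unfolding sgrp_def by blast+
  show m: "x \<in> L \<Longrightarrow> - x \<in> L" for x using d[OF 0, of x] by simp
  show "x \<in> L \<Longrightarrow> y \<in> L \<Longrightarrow> x + y \<in> L" using d[OF _ m, of x y] by simp
qed

lemma sgrp_of_int_mult:
  assumes "sgrp L" "x \<in> L"
  shows "of_int n * x \<in> L"
proof -
  have nat: "of_nat k * x \<in> L" for k
    by (induction k) (auto simp: distrib_right intro: sgrpD[OF assms(1)] assms(2))
  show ?thesis
    by (cases n rule: int_cases2) (use nat sgrpD(3)[OF assms(1)] in auto)
qed

definition coset :: "quat set \<Rightarrow> quat \<Rightarrow> quat set" where
  "coset M x = (\<lambda>y. x + y) ` M"

definition qindex :: "quat set \<Rightarrow> quat set \<Rightarrow> nat" where
  "qindex L M = card (coset M ` L)"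

lemma coset_eq_iff:
  assumes "sgrp M"
  shows "coset M x = coset M y \<longleftrightarrow> x - y \<in> M"
proof
  assume "coset M x = coset M y"
  moreover have "x \<in> coset M x"
    unfolding coset_def using sgrpD(1)[OF assms] by (auto intro: image_eqI[of _ _ 0])
  ultimately obtain m where "m \<in> M" "x = y + m" unfolding coset_def by auto
  then show "x - y \<in> M" by simp
next
  assume *: "x - y \<in> M"
  have "coset M x \<subseteq> coset M y" if "x - y \<in> M" for x y
  proof
    fix z assume "z \<in> coset M x"
    then obtain m where m: "m \<in> M" "z = x + m" unfolding coset_def by auto
    show "z \<in> coset M y"
      unfolding coset_def using sgrpD(4)[OF assms that m(1)] m(2)
      by (auto intro!: image_eqI[of _ _ "(x - y) + m"])
  qed
  from this[OF *] this[of y x] show "coset M x = coset M y"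
    using sgrpD(3)[OF assms *] by auto
qed

text \<open>Representatives \<open>r C\<close> of the cosets of \<open>M\<close> in \<open>L\<close>
  shift the cosets of \<open>N\<close> in \<open>M\<close> onto those of \<open>N\<close> in
  \<open>L\<close>. The convention that an infinite index is 0 respects the product.\<close>

lemma qindex_mult:
  assumes "sgrp L" "sgrp M" "sgrp N" "N \<subseteq> M" "M \<subseteq> L"
  shows "qindex L N = qindex L M * qindex M N"
proof -
  define r where "r C = (SOME x. x \<in> L \<and> coset M x = C)" for C
  have r: "r C \<in> L" "coset M (r C) = C" if "C \<in> coset M ` L" for C
    using someI_ex[of "\<lambda>x. x \<in> L \<and> coset M x = C"] that unfolding r_def by auto
  define f where "f = (\<lambda>(A, B). (\<lambda>y. r A + y) ` B)"
  have f: "f (A, coset N m) = coset N (r A + m)" for A m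
    unfolding f_def coset_def by (auto simp: image_image add.assoc)
  have "bij_betw f ((coset M ` L) \<times> (coset N ` M)) (coset N ` L)"
    unfolding bij_betw_def
  proof
    show "inj_on f (coset M ` L \<times> coset N ` M)"
    proof (rule inj_onI, clarify)
      fix x m y m' assume xs: "x \<in> L" "m \<in> M" "y \<in> L" "m' \<in> M"
        and eq: "f (coset M x, coset N m) = f (coset M y, coset N m')"
      let ?A = "r (coset M x)" and ?B = "r (coset M y)"
      have *: "(?A + m) - (?B + m') \<in> N"
        using eq coset_eq_iff[OF assms(3)] f by metis
      have "((?A + m) - (?B + m')) - (m - m') \<in> M"
        using sgrpD(2)[OF assms(2) subsetD[OF assms(4) *] sgrpD(2)[OF assms(2) xs(2,4)]] .
      then have "?A - ?B \<in> M" by (simp add: algebra_simps)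
      then have "coset M x = coset M y"
        using coset_eq_iff[OF assms(2), of ?A ?B] r(2) xs by (metis imageI)
      with * have "m - m' \<in> N" by simp
      then show "coset M x = coset M y \<and> coset N m = coset N m'"
        using \<open>coset M x = coset M y\<close> coset_eq_iff[OF assms(3)] by blast
    qed
    show "f ` (coset M ` L \<times> coset N ` M) = coset N ` L"
    proof
      show "f ` (coset M ` L \<times> coset N ` M) \<subseteq> coset N ` L"
        using r(1) assms(5) sgrpD(4)[OF assms(1)] by (auto simp: f)
      show "coset N ` L \<subseteq> f ` (coset M ` L \<times> coset N ` M)"
      proof clarify
        fix x assume x: "x \<in> L"
        let ?A = "coset M x"
        have "x - r ?A \<in> M" using r(2)[of ?A] x coset_eq_iff[OF assms(2)] by (metis imageI)
        moreover have "coset N x = f (?A, coset N (x - r ?A))" by (simp add: f)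
        ultimately show "coset N x \<in> f ` (coset M ` L \<times> coset N ` M)" using x by blast
      qed
    qed
  qed
  then show ?thesis
    unfolding qindex_def by (metis bij_betw_same_card card_cartesian_product)
qed

lemma qindex_image:
  assumes add: "\<And>x y. f (x + y) = f x + f y" and inj: "inj f"
  shows "qindex (f ` L) (f ` M) = qindex L M"
proof -
  have "coset (f ` M) (f x) = f ` coset M x" for x
    unfolding coset_def image_image add ..
  then have "coset (f ` M) ` f ` L = (`) f ` (coset M ` L)"
    by (simp add: image_image)
  moreover have "inj_on ((`) f) (coset M ` L)"
    using inj by (meson inj_image_eq_iff inj_onI)
  ultimately show ?thesis
    unfolding qindex_def by (simp add: card_image)
qed

lemma qindex_lmult: "a \<noteq> 0 \<Longrightarrow> qindex ((*) a ` L) ((*) a ` M) = qindex L M"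
  by (rule qindex_image) (auto simp: distrib_left inj_def)

lemma sgrp_hur [simp]: "sgrp hur"
  unfolding sgrp_def by (simp add: hur_diff)

lemma sgrp_lip [simp]: "sgrp lip"
  unfolding sgrp_def by (simp add: lip_diff)

lemma sgrp_image:
  assumes add: "\<And>x y. f (x - y) = f x - f y" and "sgrp L"
  shows "sgrp (f ` L)"
proof -
  have "f 0 = 0" using add[of 0 0] by simp
  then show ?thesis
    using assms(2) unfolding sgrp_def by (auto simp: add[symmetric] intro: image_eqI[of 0 _ 0])
qed

lemma sgrp_lmult: "sgrp L \<Longrightarrow> sgrp ((*) a ` L)"
  by (rule sgrp_image) (auto simp: right_diff_distrib)

lemma sgrp_rmult: "sgrp L \<Longrightarrow> sgrp ((\<lambda>x. x * a) ` L)"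
  by (rule sgrp_image) (auto simp: left_diff_distrib)

lemma qlat_eq_lmult: "qlat a b = (*) a ` lid b"
  by (auto simp: qlat_def lid_def image_image mult.assoc)

lemma sgrp_lid [simp]: "sgrp (lid b)"
  unfolding lid_def by (simp add: sgrp_rmult)

lemma lid_subset_hur: "b \<in> hur \<Longrightarrow> lid b \<subseteq> hur"
  by (auto simp: lid_def hur_mult)

lemma qlat_subset_hur: "a \<in> hur \<Longrightarrow> b \<in> hur \<Longrightarrow> qlat a b \<subseteq> hur"
  by (auto simp: qlat_def hur_mult)

lemma qlat_1_left: "qlat 1 b = lid b"
  by (simp add: qlat_def lid_def)

lemma lid_1 [simp]: "lid 1 = hur"
  by (simp add: lid_def)

section \<open>Indices of principal one-sided ideals\<close>

definition ridx :: "quat \<Rightarrow> nat" where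
  "ridx a = qindex hur ((*) a ` hur)"

lemma lmult_subset_hur: "a \<in> hur \<Longrightarrow> (*) a ` hur \<subseteq> hur"
  by (auto simp: hur_mult)

lemma ridx_mult:
  assumes "a \<in> hur" "b \<in> hur" "a \<noteq> 0" 
  shows "ridx (a * b) = ridx a * ridx b"
proof -
  have "qindex hur ((*) a ` (*) b ` hur) = qindex hur ((*) a ` hur) * qindex ((*) a ` hur) ((*) a ` (*) b ` hur)"
    using assms by (intro qindex_mult image_mono lmult_subset_hur) (simp_all add: sgrp_lmult)
  moreover have "(*) (a * b) ` hur = (*) a ` (*) b ` hur"
    by (auto simp: image_image mult.assoc)
  ultimately show ?thesis
    using assms unfolding ridx_def by (simp add: qindex_lmult)
qed

text \<open>In the Lipschitz order the four coordinates are independent, so cosets are quadruples of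
  residues modulo \<open>n\<close>; \<open>qindex_of_lip\<close> carries the value to the Hurwitz
  order.\<close>

lemma qindex_lip_of_nat:
  assumes "n > 0"
  shows "qindex lip ((*) (of_nat n) ` lip) = n ^ 4"
proof -
  let ?M = "(*) (of_nat n) ` lip"
  have M: "sgrp ?M" by (simp add: sgrp_lmult)
  let ?B = "{0..<int n}"
  let ?Q = "\<lambda>(a,b,c,d). Quat (of_int a) (of_int b) (of_int c) (of_int d)"
  have mem: "Quat (of_int a) (of_int b) (of_int c) (of_int d) \<in> ?M \<longleftrightarrow>
     int n dvd a \<and> int n dvd b \<and> int n dvd c \<and> int n dvd d" for a b c d
  proof
    assume "Quat (of_int a) (of_int b) (of_int c) (of_int d) \<in> ?M"
    then obtain a' b' c' d' :: int where
      "Quat (of_int a) (of_int b) (of_int c) (of_int d) = of_nat n * Quat a' b' c' d'"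
      by (auto elim!: lipE)
    from arg_cong[OF this, where f=qa] arg_cong[OF this, where f=qb]
      arg_cong[OF this, where f=qc] arg_cong[OF this, where f=qd]
    have "real_of_int a = of_int (int n * a')" "real_of_int b = of_int (int n * b')"
      "real_of_int c = of_int (int n * c')" "real_of_int d = of_int (int n * d')"
      by simp_all
    then show "int n dvd a \<and> int n dvd b \<and> int n dvd c \<and> int n dvd d"
      by (simp only: of_int_eq_iff dvd_triv_left)
  next
    assume "int n dvd a \<and> int n dvd b \<and> int n dvd c \<and> int n dvd d"
    then obtain a' b' c' d' where "a = int n * a'" "b = int n * b'" "c = int n * c'" "d = int n * d'"
      by (auto elim!: dvdE)
    then have "Quat (of_int a) (of_int b) (of_int c) (of_int d) = of_nat n * Quat (of_int a') (of_int b') (of_int c') (of_int d')"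
      by (intro quat_eqI) simp
    then show "Quat (of_int a) (of_int b) (of_int c) (of_int d) \<in> ?M"
      by (auto intro: lipI)
  qed
  have diff: "Quat (of_int a) (of_int b) (of_int c) (of_int d) - Quat (of_int a') (of_int b') (of_int c') (of_int d') \<in> ?M \<longleftrightarrow>
     a mod n = a' mod n \<and> b mod n = b' mod n \<and> c mod n = c' mod n \<and> d mod n = d' mod n" for a b c d a' b' c' d'
    using mem[of "a-a'" "b-b'" "c-c'" "d-d'"] by (simp add: Quat_arith mod_eq_dvd_iff)
  have "bij_betw (\<lambda>t. coset ?M (?Q t)) (?B \<times> ?B \<times> ?B \<times> ?B) (coset ?M ` lip)"
    unfolding bij_betw_def
  proof
    show "inj_on (\<lambda>t. coset ?M (?Q t)) (?B \<times> ?B \<times> ?B \<times> ?B)"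
    proof (rule inj_onI)
      fix s t assume st: "s \<in> ?B \<times> ?B \<times> ?B \<times> ?B" "t \<in> ?B \<times> ?B \<times> ?B \<times> ?B"
        and eq: "coset ?M (?Q s) = coset ?M (?Q t)"
      obtain a b c d a' b' c' d' where s: "s = (a,b,c,d)" and t: "t = (a',b',c',d')"
        by (metis prod_cases4)
      have "a mod n = a' mod n \<and> b mod n = b' mod n \<and> c mod n = c' mod n \<and> d mod n = d' mod n"
        using eq unfolding s t coset_eq_iff[OF M] prod.case diff .
      then show "s = t" using st unfolding s t by simp
    qed
    show "(\<lambda>t. coset ?M (?Q t)) ` (?B \<times> ?B \<times> ?B \<times> ?B) = coset ?M ` lip"
    proof
      show "(\<lambda>t. coset ?M (?Q t)) ` (?B \<times> ?B \<times> ?B \<times> ?B) \<subseteq> coset ?M ` lip"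
        by (auto intro!: imageI lipI)
      show "coset ?M ` lip \<subseteq> (\<lambda>t. coset ?M (?Q t)) ` (?B \<times> ?B \<times> ?B \<times> ?B)"
      proof (clarify elim!: lipE)
        fix a b c d :: int
        have "coset ?M (Quat a b c d) = coset ?M (?Q (a mod n, b mod n, c mod n, d mod n))"
          by (simp add: coset_eq_iff[OF M] diff)
        moreover have "(a mod n, b mod n, c mod n, d mod n) \<in> ?B \<times> ?B \<times> ?B \<times> ?B"
          using assms by simp
        ultimately show "coset ?M (Quat a b c d) \<in> (\<lambda>t. coset ?M (?Q t)) ` (?B \<times> ?B \<times> ?B \<times> ?B)"
          by blast
      qed
    qed
  qed
  then have "card (?B \<times> ?B \<times> ?B \<times> ?B) = qindex lip ?M"
    unfolding qindex_def by (rule bij_betw_same_card)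
  then show ?thesis by (simp add: card_cartesian_product power4_eq_xxxx)
qed

lemma lip_subset_hur: "lip \<subseteq> hur"
  by (auto simp: lip_hur)

lemma hur_lip_cases: "x \<in> hur \<Longrightarrow> x \<in> lip \<or> x - \<h> \<in> lip"
proof (elim hurE)
  fix A b c d :: int
  assume x: "x = Quat (A/2) (A/2+b) (A/2+c) (A/2+d)"
  show ?thesis
  proof (cases "even A")
    case True
    then obtain k where "A = 2 * k" by (elim evenE)
    then have "x \<in> lip" by (intro lipI[of _ k "k+b" "k+c" "k+d"]) (simp add: x)
    then show ?thesis ..
  next
    case False
    then obtain k where "A = 2 * k + 1" by (elim oddE)
    then have "x - \<h> \<in> lip" by (intro lipI[of _ k "k+b" "k+c" "k+d"]) (simp add: x Quat_arith field_simps)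
    then show ?thesis ..
  qed
qed

lemma qindex_hur_lip_pos: "qindex hur lip > 0"
proof -
  have "coset lip ` hur \<subseteq> {coset lip 0, coset lip \<h>}"
  proof
    fix C assume "C \<in> coset lip ` hur"
    then obtain x where "x \<in> hur" "C = coset lip x" by auto
    then show "C \<in> {coset lip 0, coset lip \<h>}"
      using hur_lip_cases[of x] by (simp add: coset_eq_iff)
  qed
  then have "finite (coset lip ` hur)" by (rule finite_subset) simp
  moreover have "coset lip ` hur \<noteq> {}" using hur_basis(1) by blast
  ultimately show ?thesis unfolding qindex_def by (simp add: card_gt_0_iff)
qed

text \<open>The two chains from \<open>hur\<close> down to f(lip), through \<open>lip\<close> and
  through f(hur), have the same product of indices. The factors [hur : lip] and [f(hur) : f(lip)]
  agree and are positive, so they cancel.\<close>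

lemma qindex_of_lip:
  assumes "inj f" "\<And>x y. f (x + y) = f x + f y" "f ` hur \<subseteq> hur" "f ` lip \<subseteq> lip"
  shows "qindex lip (f ` lip) = qindex hur (f ` hur)"
proof -
  have "f 0 = 0" using assms(2)[of 0 0] by simp
  then have d: "f (x - y) = f x - f y" for x y
    using assms(2)[of "x - y" y] by (simp add: algebra_simps)
  have "qindex hur (f ` lip) = qindex hur lip * qindex lip (f ` lip)"
    using assms lip_subset_hur d by (intro qindex_mult sgrp_image) auto
  moreover have "qindex hur (f ` lip) = qindex hur (f ` hur) * qindex (f ` hur) (f ` lip)"
    using assms lip_subset_hur d by (intro qindex_mult sgrp_image) auto
  moreover have "qindex (f ` hur) (f ` lip) = qindex hur lip"
    using assms by (intro qindex_image) auto
  ultimately show ?thesis using qindex_hur_lip_pos by simp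
qed

lemma ridx_of_nat: "n > 0 \<Longrightarrow> ridx (of_nat n) = n ^ 4"
  unfolding ridx_def qindex_lip_of_nat[symmetric]
  by (rule qindex_of_lip [symmetric]) (auto simp: inj_def distrib_left intro: hur_mult lip_mult)

lemma ridx_mult_qconj:
  assumes "a \<in> hur" "a \<noteq> 0"
  shows "ridx a * ridx (qconj a) = nnrm a ^ 4"
  using assms by (simp add: ridx_of_nat nnrm_pos mult_qconj_nnrm hur_conj flip: ridx_mult)

text \<open>The conjugate of \<open>a\<close> is \<open>q a q\<^sup>-\<^sup>1\<close> for any pure quaternion \<open>q\<close> orthogonal to \<open>a\<close>,
  so both have the same index; since the product of the two indices is known, so is each.\<close>

lemma ridx_eq:
  assumes "a \<in> hur" "a \<noteq> 0"
  shows "ridx a = (nnrm a)\<^sup>2"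
proof -
  obtain A b c d :: int where a: "a = Quat (A/2) (A/2+b) (A/2+c) (A/2+d)"
    using assms(1) by (rule hurE)
  \<comment> \<open>The vector is orthogonal to \<open>a\<close>, and the factor 2 clears
    denominators. It vanishes when \<open>qb a\<close> and \<open>qc a\<close> are 0, where
    \<open>q\<i>\<close> is orthogonal to \<open>a\<close> instead.\<close>
  define q where "q = (if qb a = 0 \<and> qc a = 0 then q\<i> else Quat 0 (- 2 * qc a) (2 * qb a) 0)"
  have "Quat 0 (- 2 * qc a) (2 * qb a) 0 \<in> lip"
    by (rule lipI[of _ 0 "- A - 2*c" "A + 2*b" 0]) (simp add: a algebra_simps)
  then have q: "q \<in> hur" unfolding q_def by (auto intro: lip_hur)
  have "nrm q \<noteq> 0"
    unfolding q_def by (auto simp: nrm_def add_nonneg_eq_0_iff)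
  then have q0: "q \<noteq> 0" by auto
  have qa: "q * a = qconj a * q"
    by (rule quat_eqI) (simp add: q_def algebra_simps)
  have "ridx q * ridx a = ridx (qconj a) * ridx q"
    using q q0 qa assms by (simp add: hur_conj flip: ridx_mult) (metis hur_conj qconj_eq_iff qconj_simps(2) ridx_mult)
  moreover have "ridx q \<noteq> 0"
    using ridx_mult_qconj[OF q q0] nnrm_pos[OF q q0]
    by (metis less_numeral_extra(3) mult_0 power_eq_0_iff)
  ultimately have "ridx a = ridx (qconj a)" by simp
  then have "(ridx a)\<^sup>2 = ((nnrm a)\<^sup>2)\<^sup>2"
    using ridx_mult_qconj[OF assms] by (simp add: power2_eq_square power4_eq_xxxx)
  then show ?thesis using power2_eq_iff_nonneg[of "ridx a" "(nnrm a)\<^sup>2"] by simp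
qed

lemma qconj_image [simp]: "qconj ` hur = hur" "qconj ` lip = lip"
  by (auto simp: hur_conj lip_conj intro!: image_eqI[of _ qconj "qconj _"])

lemma lmult_qconj: "(*) (qconj a) ` hur = qconj ` lid a"
proof -
  have "(*) (qconj a) ` qconj ` hur = qconj ` lid a"
    unfolding lid_def image_image by (simp add: qconj_mult)
  then show ?thesis by simp
qed

lemma qindex_lid:
  assumes "b \<in> hur" "b \<noteq> 0"
  shows "qindex hur (lid b) = (nnrm b)\<^sup>2"
proof -
  have "qindex (qconj ` hur) (qconj ` lid b) = qindex hur (lid b)"
    by (rule qindex_image) (auto simp: inj_def)
  then have "ridx (qconj b) = qindex hur (lid b)"
    unfolding ridx_def lmult_qconj by simp
  moreover have "qconj b \<noteq> 0" using assms(2) by (metis qconj_eq_iff qconj_simps(2))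
  ultimately show ?thesis using assms ridx_eq[of "qconj b"] by (simp add: hur_conj)
qed

lemma qindex_qlat:
  assumes "a \<in> hur" "a \<noteq> 0" "b \<in> hur" "b \<noteq> 0"
  shows "qindex hur (qlat a b) = (nnrm a * nnrm b)\<^sup>2"
proof -
  have "qindex hur (qlat a b) = qindex hur ((*) a ` hur) * qindex ((*) a ` hur) (qlat a b)"
    unfolding qlat_eq_lmult using assms
    by (intro qindex_mult image_mono lmult_subset_hur lid_subset_hur) (simp_all add: sgrp_lmult)
  then show ?thesis
    using assms ridx_eq[OF assms(1,2)] unfolding ridx_def
    by (simp add: qlat_eq_lmult qindex_lmult qindex_lid power_mult_distrib)
qed

section \<open>Similarities\<close>

text \<open>\<open>c\<close> is the square of the scaling factor \<alpha>; its root is taken only in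
  the transfer to \<open>real ^ 4\<close>.\<close>

definition sim :: "(quat \<Rightarrow> quat) \<Rightarrow> bool" where
  "sim F \<longleftrightarrow> (\<forall>x y. F (x + y) = F x + F y) \<and> (\<forall>r x. F (r *\<^sub>R x) = r *\<^sub>R F x) \<and>
     (\<exists>c>0. \<forall>x. nrm (F x) = c * nrm x)"

definition isom1 :: "(quat \<Rightarrow> quat) \<Rightarrow> bool" where
  "isom1 S \<longleftrightarrow> (\<forall>x y. S (x + y) = S x + S y) \<and> (\<forall>r x. S (r *\<^sub>R x) = r *\<^sub>R S x) \<and>
     (\<forall>x. nrm (S x) = nrm x) \<and> S 1 = 1"

lemma isom1D:
  assumes "isom1 S"
  shows "S (x + y) = S x + S y" "S (r *\<^sub>R x) = r *\<^sub>R S x" "nrm (S x) = nrm x" "S 1 = 1"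
    "S (- x) = - S x" "S (x - y) = S x - S y" "S 0 = 0" "qa (S x) = qa x" "S (of_int n * x) = of_int n * S x"
    "inj S"
proof -
  show add: "S (x + y) = S x + S y" and sc: "S (r *\<^sub>R x) = r *\<^sub>R S x" and n: "nrm (S x) = nrm x"
    and one: "S 1 = 1" for x y r
    using assms unfolding isom1_def by auto
  show m: "S (- x) = - S x" for x using sc[of "-1" x] by simp
  show d: "S (x - y) = S x - S y" for x y using add[of x "- y"] m by simp
  show "S 0 = 0" using d[of 0 0] by simp
  \<comment> \<open>Polarisation: \<open>nrm (1 + x) = 1 + 2 * qa x + nrm x\<close>.\<close>
  show "qa (S x) = qa x"
    using n[of "1 + x"] n[of x] unfolding add one nrm_def by (simp add: power2_eq_square algebra_simps)
  show "S (of_int n * x) = of_int n * S x"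
    using sc[of "of_int n" x] by (simp add: scaleR_conv_of_real)
  show "inj S"
    using d n by (intro injI) (metis eq_iff_diff_eq_0 nrm_eq_0_iff)
qed

lemma pure_mult_self:
  assumes "qa z = 0" "nrm z = 1"
  shows "z * z = -1"
  using assms by (intro quat_eqI) (simp add: nrm_def power2_eq_square)

lemma pure_anticommute:
  assumes "qa z = 0" "qa w = 0" "nrm (z + w) = nrm z + nrm w"
  shows "z * w = - (w * z)"
proof -
  have "2 * (qb z * qb w + qc z * qc w + qd z * qd w) = 0"
    using assms unfolding nrm_def by (simp add: power2_eq_square algebra_simps)
  then show ?thesis using assms by (intro quat_eqI) (simp add: algebra_simps)
qed

text \<open>\<open>K\<close> anticommutes with both factors of \<open>e = I * J\<close> and so
  commutes with \<open>e\<close>, which itself squares to -1. Hence \<open>K * e\<close> squares to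
  1, and in a division ring it is 1 or -1.\<close>

lemma anticommuting_triple:
  fixes I J K :: quat
  assumes sq: "I * I = -1" "J * J = -1" "K * K = -1"
    and ac: "J * I = - (I * J)" "K * I = - (I * K)" "K * J = - (J * K)"
  shows "I * J = K \<or> I * J = - K"
proof -
  define e where "e = I * J"
  have sq': "I * (I * z) = - z" "J * (J * z) = - z" "K * (K * z) = - z" for z
    by (simp_all flip: mult.assoc add: sq)
  have ac': "J * (I * z) = - (I * (J * z))" "K * (I * z) = - (I * (K * z))" "K * (J * z) = - (J * (K * z))" for z
    by (simp_all flip: mult.assoc add: ac)
  have "(K * e) * (K * e) = 1"
    unfolding e_def by (simp add: mult.assoc ac ac' sq sq')
  then have "(K * e - 1) * (K * e + 1) = 0" by (simp add: algebra_simps)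
  then have "K * e = 1 \<or> K * e = -1" by (auto simp: eq_neg_iff_add_eq_0)
  then have "K * (K * e) = K \<or> K * (K * e) = - K" by auto
  then show ?thesis unfolding sq' e_def by (metis minus_minus)
qed

lemma quat_expand: "x = qa x *\<^sub>R 1 + qb x *\<^sub>R q\<i> + qc x *\<^sub>R q\<j> + qd x *\<^sub>R q\<k>"
  by (rule quat_eqI) simp

lemma isom1_expand:
  assumes "isom1 S"
  shows "S x = qa x *\<^sub>R 1 + qb x *\<^sub>R S q\<i> + qc x *\<^sub>R S q\<j> + qd x *\<^sub>R S q\<k>"
  by (subst quat_expand[of x]) (simp only: isom1D[OF assms])

text \<open>The images of \<open>q\<i>\<close>, \<open>q\<j>\<close>, \<open>q\<k>\<close> are pure
  and orthonormal, hence anticommuting square roots of -1. The sign relating the product of the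
  first two to the third decides between the two cases.\<close>

lemma isom1_hom_or_antihom:
  assumes "isom1 S"
  shows "(\<forall>x y. S (x * y) = S x * S y) \<or> (\<forall>x y. S (x * y) = S y * S x)"
proof -
  define I J K where "I = S q\<i>" and "J = S q\<j>" and "K = S q\<k>"
  have S: "S x = qa x *\<^sub>R 1 + qb x *\<^sub>R I + qc x *\<^sub>R J + qd x *\<^sub>R K" for x
    unfolding I_def J_def K_def by (rule isom1_expand[OF assms])
  have re: "qa I = 0" "qa J = 0" "qa K = 0"
    unfolding I_def J_def K_def by (simp_all add: isom1D[OF assms])
  have nr: "nrm I = 1" "nrm J = 1" "nrm K = 1" "nrm (I + J) = 2" "nrm (I + K) = 2" "nrm (J + K) = 2"
    unfolding I_def J_def K_def isom1D(1)[OF assms, symmetric] isom1D(3)[OF assms]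
    by (simp_all add: nrm_def)
  have sq: "I * I = -1" "J * J = -1" "K * K = -1"
    using re nr by (simp_all add: pure_mult_self)
  have ac: "J * I = - (I * J)" "K * I = - (I * K)" "K * J = - (J * K)"
    by (rule pure_anticommute; simp add: re nr add.commute)+
  have sq': "I * (I * z) = - z" "J * (J * z) = - z" for z
    by (simp_all flip: mult.assoc add: sq)
  from anticommuting_triple[OF sq ac] show ?thesis
  proof
    assume K: "I * J = K"
    have "I * K = - J" "J * K = I"
      unfolding K[symmetric] using ac(1) by (simp_all add: sq' sq flip: mult.assoc) (simp add: mult.assoc sq)
    then have "S (x * y) = S x * S y" for x y
      unfolding S by (simp add: algebra_simps sq ac K)
    then show ?thesis by blast
  next
    assume K: "I * J = - K"
    then have "K = - (I * J)" by simp
    then have "I * K = J" "J * K = - I"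
      using ac(1) by (simp_all add: sq' sq flip: mult.assoc) (simp add: mult.assoc sq)
    then have "S (x * y) = S y * S x" for x y
      unfolding S by (simp add: algebra_simps sq ac K)
    then show ?thesis by blast
  qed
qed

lemma hur_pure_lip:
  assumes "x \<in> hur" "qa x = 0"
  shows "x \<in> lip"
proof -
  obtain A b c d :: int where x: "x = Quat (A/2) (A/2+b) (A/2+c) (A/2+d)"
    using assms(1) by (rule hurE)
  with assms(2) show ?thesis by (intro lipI[of _ 0 b c d]) simp
qed

text \<open>The doubled coordinates are integers whose squares sum to 4. Squares are 0 or 1 modulo
  4, so the number of odd ones is 0 or 4, and all share one parity.\<close>

lemma half_lip_hur:
  assumes "x + x \<in> lip" "nrm x = 1"
  shows "x \<in> hur"
proof -
  obtain A B C D :: int where eq: "x + x = Quat A B C D" using assms(1) by (rule lipE)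
  have x: "x = Quat (A/2) (B/2) (C/2) (D/2)"
    using arg_cong[OF eq, of qa] arg_cong[OF eq, of qb] arg_cong[OF eq, of qc] arg_cong[OF eq, of qd]
    by (intro quat_eqI) simp
  have "real_of_int (A*A + B*B + C*C + D*D) = of_int 4"
    using assms(2) unfolding x nrm_def by (simp add: power_divide power2_eq_square field_simps)
  then have sum: "A*A + B*B + C*C + D*D = 4" by (simp only: of_int_eq_iff)
  have sq: "\<exists>k. z*z = 4*k + (if odd z then 1 else 0)" for z :: int
  proof (cases "even z")
    case True
    then obtain k where "z = 2 * k" by (elim evenE)
    then show ?thesis by (intro exI[of _ "k*k"]) simp
  next
    case False
    then obtain k where "z = 2 * k + 1" by (elim oddE)
    then show ?thesis by (intro exI[of _ "k*k+k"]) (simp add: algebra_simps)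
  qed
  have "even (A - B) \<and> even (A - C) \<and> even (A - D)"
  proof -
    obtain k l m n where "A*A = 4*k + (if odd A then 1 else 0)" "B*B = 4*l + (if odd B then 1 else 0)"
      "C*C = 4*m + (if odd C then 1 else 0)" "D*D = 4*n + (if odd D then 1 else 0)"
      using sq by metis
    then have "4 * (k+l+m+n) + ((if odd A then 1 else 0) + (if odd B then 1 else 0)
        + (if odd C then 1 else 0) + (if odd D then 1 else 0)) = 4"
      using sum by (simp add: algebra_simps)
    then show ?thesis
      by (cases "even A"; cases "even B"; cases "even C"; cases "even D"; simp) presburger+
  qed
  then obtain b c d where "B = A + 2 * b" "C = A + 2 * c" "D = A + 2 * d"
    by (metis add.commute diff_add_cancel dvdE even_minus minus_diff_eq)
  then show ?thesis by (intro hurI[of _ A b c d]) (simp add: x add_divide_distrib)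
qed

lemma finite_image_self_inj:
  assumes "finite V" "f ` V \<subseteq> V" "inj f"
  shows "f ` V = V"
  by (rule endo_inj_surj[OF assms(1,2)]) (rule inj_on_subset[OF assms(3)], simp)

lemma finite_hur_unit: "finite {x \<in> hur. nrm x = 1}"
proof -
  have "{x \<in> hur. nrm x = 1} = {x \<in> hur. nnrm x = 1}"
    by (auto intro: nnrm_eqI) (metis One_nat_def of_nat_1 real_nnrm)
  then show ?thesis using finite_hur_nnrm[of 1] by simp
qed

lemma lip_subset_sgrp:
  assumes "sgrp L" "1 \<in> L" "q\<i> \<in> L" "q\<j> \<in> L" "q\<k> \<in> L"
  shows "lip \<subseteq> L"
proof
  fix x assume "x \<in> lip"
  then obtain a b c d :: int where "x = of_int a + of_int b * q\<i> + of_int c * q\<j> + of_int d * q\<k>"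
    by (rule lip_decomp)
  moreover have "of_int a \<in> L" using sgrp_of_int_mult[OF assms(1,2), of a] by simp
  ultimately show "x \<in> L"
    using assms by (auto intro!: sgrpD(4) sgrp_of_int_mult)
qed

lemma hur_subset_sgrp:
  assumes "sgrp L" "\<h> \<in> L" "q\<i> \<in> L" "q\<j> \<in> L" "q\<k> \<in> L"
  shows "hur \<subseteq> L"
proof
  fix x assume "x \<in> hur"
  then obtain A b c d :: int where "x = of_int A * \<h> + of_int b * q\<i> + of_int c * q\<j> + of_int d * q\<k>"
    by (rule hur_decomp)
  then show "x \<in> L"
    using assms by (auto intro!: sgrpD(4) sgrp_of_int_mult)
qed

lemma sgrp_vimage:
  assumes "isom1 T" "sgrp L"
  shows "sgrp (T -` L)"
  using assms(2) unfolding sgrp_def by (simp add: isom1D[OF assms(1)])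

text \<open>A linear isometry fixing \<open>1\<close> and mapping the Lipschitz order into the Hurwitz order
  permutes the finitely many elements of norm one, and these generate both orders.\<close>

lemma isom1_lip_hur:
  assumes T: "isom1 T" and sub: "T ` lip \<subseteq> hur"
  shows "T ` lip = lip" "T ` hur = hur"
proof -
  note D = isom1D[OF T]
  have pure: "T x \<in> lip" if "x \<in> lip" "qa x = 0" for x
    using that sub by (intro hur_pure_lip) (auto simp: D)
  have "lip \<subseteq> T -` lip"
    by (rule lip_subset_sgrp) (simp_all add: sgrp_vimage T D pure)
  then have l: "T ` lip \<subseteq> lip" by blast
  \<comment> \<open>The hypothesis says nothing about \<open>T \<h>\<close> directly, but its double
    lies in \<open>lip\<close> and its norm is 1.\<close>
  have "\<h> + \<h> \<in> lip" by (rule lipI[of _ 1 1 1 1]) (simp add: Quat_arith)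
  then have "T \<h> + T \<h> \<in> lip" using l D(1)[of \<h> \<h>] by auto
  moreover have "nrm (T \<h>) = 1" unfolding D by (simp add: nrm_def power2_eq_square)
  ultimately have "T \<h> \<in> hur" by (rule half_lip_hur)
  then have "hur \<subseteq> T -` hur"
    by (intro hur_subset_sgrp) (simp_all add: sgrp_vimage T lip_hur pure)
  then have h: "T ` hur \<subseteq> hur" by blast
  have lip_fin: "finite {x \<in> lip. nrm x = 1}"
    by (rule finite_subset[OF _ finite_hur_unit]) (auto simp: lip_hur)
  have "T ` {x \<in> lip. nrm x = 1} = {x \<in> lip. nrm x = 1}"
    by (rule finite_image_self_inj[OF lip_fin]) (use l D in auto)
  then have le: "e \<in> T ` lip" if "e \<in> lip" "nrm e = 1" for e using that by blast
  have "T ` {x \<in> hur. nrm x = 1} = {x \<in> hur. nrm x = 1}"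
    by (rule finite_image_self_inj[OF finite_hur_unit]) (use h D in auto)
  then have he: "e \<in> T ` hur" if "e \<in> hur" "nrm e = 1" for e using that by blast
  have sg: "sgrp (T ` L)" if "sgrp L" for L
    using that by (intro sgrp_image) (simp_all add: D)
  have "lip \<subseteq> T ` lip"
    by (rule lip_subset_sgrp) (simp_all add: sg le nrm_def)
  with l show "T ` lip = lip" by blast
  have "hur \<subseteq> T ` hur"
    by (rule hur_subset_sgrp) (simp_all add: sg he nrm_def power2_eq_square)
  with h show "T ` hur = hur" by blast
qed

text \<open>The left ideal generated by \<open>M = y S(lip)\<close> is stable under right multiplication by the
  order \<open>S(lip)\<close>. Writing it as \<open>hur b\<close> yields \<open>b S(lip) b\<^sup>-\<^sup>1 \<subseteq> hur\<close>, whence \<open>M = a lip b\<close>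
  with \<open>a = y b\<^sup>-\<^sup>1\<close>.\<close>

lemma similarity_image_hom:
  assumes S: "isom1 S" and hom: "\<And>x y. S (x * y) = S x * S y"
    and y: "y \<noteq> 0" and sub: "\<And>x. x \<in> lip \<Longrightarrow> y * S x \<in> hur"
  obtains a b where "a \<in> hur" "a \<noteq> 0" "b \<in> hur" "b \<noteq> 0"
    "(\<lambda>x. y * S x) ` lip = (\<lambda>x. a * x * b) ` lip" "(\<lambda>x. y * S x) ` hur = qlat a b"
proof -
  define M where "M = (\<lambda>x. y * S x) ` lip"
  \<comment> \<open>\<open>hur\<close> belongs to the family, so the intersection is not the whole
    space.\<close>
  define I where "I = \<Inter>{K. left_ideal K \<and> M \<subseteq> K}"
  have "left_ideal hur" unfolding left_ideal_def by (simp add: hur_diff hur_mult)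
  moreover have "M \<subseteq> hur" unfolding M_def using sub by auto
  ultimately have "I \<subseteq> hur" unfolding I_def by blast
  then have I: "left_ideal I" "M \<subseteq> I"
    unfolding I_def left_ideal_def by blast+
  have least: "I \<subseteq> K" if "left_ideal K" "M \<subseteq> K" for K
    using that unfolding I_def by blast
  have "y \<in> M" unfolding M_def using isom1D(4)[OF S] by (auto intro: image_eqI[of _ _ 1])
  then have yI: "y \<in> I" using I by blast
  with y have "I \<noteq> {0}" by blast
  then obtain b where b: "b \<in> hur" "b \<noteq> 0" "I = lid b"
    using left_ideal_principal[OF I(1)] by blast
  have stab: "x * S l \<in> I" if "l \<in> lip" "x \<in> I" for x l
  proof -
    \<comment> \<open>The elements that \<open>S l\<close> keeps inside \<open>I\<close> form a left
      ideal containing \<open>M\<close>, hence all of \<open>I\<close> by minimality.\<close>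
    have "left_ideal {x \<in> I. x * S l \<in> I}"
      using I(1) unfolding left_ideal_def by (auto simp: left_diff_distrib mult.assoc)
    moreover have "M \<subseteq> {x \<in> I. x * S l \<in> I}"
    proof
      fix z assume z: "z \<in> M"
      then obtain m where m: "m \<in> lip" "z = y * S m" unfolding M_def by auto
      then have "z * S l = y * S (m * l)" by (simp add: hom mult.assoc)
      then have "z * S l \<in> M" unfolding M_def using lip_mult[OF m(1) that(1)] by blast
      then show "z \<in> {x \<in> I. x * S l \<in> I}" using z I(2) by blast
    qed
    ultimately show ?thesis using least that(2) by blast
  qed
  define T where "T x = b * S x * inverse b" for x
  have "isom1 T"
    using S b(2) unfolding isom1_def T_def
    by (simp add: distrib_left distrib_right nrm_mult nrm_inverse)
  moreover have "T ` lip \<subseteq> hur"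
  proof clarify
    fix l assume l: "l \<in> lip"
    have "b \<in> I" unfolding b(3) lid_def by (auto intro: image_eqI[of _ _ 1])
    then obtain z where "z \<in> hur" "b * S l = z * b"
      using stab[OF l] unfolding b(3) lid_def by auto
    then show "T l \<in> hur" unfolding T_def using b(2) by (simp add: mult.assoc)
  qed
  ultimately have T: "T ` lip = lip" "T ` hur = hur" by (rule isom1_lip_hur)+
  obtain a where a: "a \<in> hur" "y = a * b" using yI unfolding b(3) lid_def by auto
  have ST: "y * S x = a * T x * b" for x
    unfolding T_def a(2) using b(2) by (simp add: mult.assoc)
  have "(\<lambda>x. y * S x) ` L = (\<lambda>x. a * x * b) ` T ` L" for L
    by (simp add: ST image_image)
  then show ?thesis
    using that[of a b] a b y T unfolding qlat_def by auto
qed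

text \<open>An antihomomorphism becomes a homomorphism after composition with conjugation, which
  maps \<open>lip\<close> and \<open>hur\<close> onto themselves and so leaves the image lattices
  unchanged. The hypothesis concerns the image of \<open>lip\<close> alone, which makes the lemma
  apply to sublattices of either order.\<close>

lemma similarity_image:
  assumes F: "sim F" and sub: "F ` lip \<subseteq> hur"
  obtains a b where "a \<in> hur" "a \<noteq> 0" "b \<in> hur" "b \<noteq> 0"
    "F ` lip = (\<lambda>x. a * x * b) ` lip" "F ` hur = qlat a b"
proof -
  define y where "y = F 1"
  from F obtain c where c: "c > 0" "\<And>x. nrm (F x) = c * nrm x"
    and lin: "\<And>x y. F (x + y) = F x + F y" "\<And>r x. F (r *\<^sub>R x) = r *\<^sub>R F x"
    unfolding sim_def by auto
  have ny: "nrm y = c" using c by (simp add: y_def)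
  then have y0: "y \<noteq> 0" using c by auto
  define S where "S x = inverse y * F x" for x
  have S: "isom1 S"
    unfolding isom1_def S_def using lin c ny y0
    by (simp add: distrib_left nrm_mult nrm_inverse y_def[symmetric])
  have FS: "F x = y * S x" for x using y0 by (simp add: S_def)
  from isom1_hom_or_antihom[OF S] show ?thesis
  proof
    assume "\<forall>x y. S (x * y) = S x * S y"
    then show ?thesis
      using similarity_image_hom[OF S _ y0] sub that unfolding FS by blast
  next
    assume anti: "\<forall>x y. S (x * y) = S y * S x"
    define S' where "S' x = S (qconj x)" for x
    have S': "isom1 S'" using S unfolding isom1_def S'_def by simp
    have hom: "S' (x * y) = S' x * S' y" for x y using anti unfolding S'_def by (simp add: qconj_mult)
    have sub': "y * S' x \<in> hur" if "x \<in> lip" for x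
      using sub that lip_conj unfolding S'_def FS[symmetric] by blast
    have "(\<lambda>x. y * S' x) ` L = F ` qconj ` L" for L
      unfolding S'_def FS[symmetric] by (simp add: image_image)
    then have "(\<lambda>x. y * S' x) ` lip = F ` lip" "(\<lambda>x. y * S' x) ` hur = F ` hur" by simp_all
    then show ?thesis
      using similarity_image_hom[OF S' hom y0 sub'] that by metis
  qed
qed

lemma sim_mult:
  assumes "a \<noteq> 0" "b \<noteq> 0"
  shows "sim (\<lambda>x. a * x * b)"
  unfolding sim_def
proof (intro conjI allI exI[of _ "nrm a * nrm b"])
  show "nrm a * nrm b > 0" using assms by simp
qed (simp_all add: distrib_left distrib_right nrm_mult)

section \<open>Primitive quaternions and two-sided ideals\<close>

lemma nnrm_Quat:
  fixes A b c d :: int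
  assumes "x = Quat (A/2) (A/2+b) (A/2+c) (A/2+d)"
  shows "int (nnrm x) = A*A + A*(b+c+d) + b*b + c*c + d*d"
proof -
  have "x \<in> hur" using assms by (rule hurI)
  then have "real_of_int (int (nnrm x)) = nrm x" by (simp add: real_nnrm)
  also have "\<dots> = real_of_int (A*A + A*(b+c+d) + b*b + c*c + d*d)"
    by (simp add: assms nrm_def power2_eq_square field_simps)
  finally show ?thesis by (simp only: of_int_eq_iff)
qed

text \<open>With s = b + c + d the norm is (A + 1)(s + 1) - 1 modulo 2, so it is even only if both
  \<open>A\<close> and s are. The quotient is half of \<open>qconj \<theta> * x\<close>, written in
  Hurwitz coordinates.\<close>

lemma even_nnrm_lmult:
  assumes "x \<in> hur" "even (nnrm x)"
  obtains y where "y \<in> hur" "x = \<theta> * y"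
proof -
  obtain A b c d :: int where x: "x = Quat (A/2) (A/2+b) (A/2+c) (A/2+d)"
    using assms(1) by (rule hurE)
  have "even (A*A + A*(b+c+d) + b*b + c*c + d*d)"
    using assms(2) nnrm_Quat[OF x] by (metis even_of_nat)
  then have "even A \<and> even (b + c + d)" by (auto simp: even_add even_mult_iff)
  then obtain k t where A: "A = 2 * k" and t: "b + c + d = 2 * t" by (metis evenE)
  from t have d: "d = 2 * t - b - c" by simp
  have "x = \<theta> * Quat (of_int (2*k+b)/2) (of_int (2*k+b)/2 + of_int (-k))
      (of_int (2*k+b)/2 + of_int (t-b)) (of_int (2*k+b)/2 + of_int (t-c-b-k))"
    by (rule quat_eqI) (simp add: x A d field_simps)
  then show ?thesis using that hurI by blast
qed

lemma even_nnrm_rmult: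
  assumes "x \<in> hur" "even (nnrm x)"
  obtains y where "y \<in> hur" "x = y * \<theta>"
proof -
  obtain y where y: "y \<in> hur" "qconj x = \<theta> * y"
    using even_nnrm_lmult[of "qconj x"] assms by (auto simp: hur_conj)
  have "x = qconj y * qconj \<theta>" using y(2) by (metis qconj_mult qconj_simps(1))
  moreover have "qconj \<theta> = - q\<i> * \<theta>" by (rule quat_eqI) simp
  ultimately have "x = (qconj y * - q\<i>) * \<theta>" by (simp add: mult.assoc)
  moreover have "qconj y * - q\<i> \<in> hur" using y(1) by (intro hur_mult hur_conj hur_uminus) simp_all
  ultimately show ?thesis using that by blast
qed

section \<open>Generators of two-sided ideals\<close>

definition normalizing :: "quat \<Rightarrow> bool" where
  "normalizing z \<longleftrightarrow> z \<in> hur \<and> z \<noteq> 0 \<and>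
     (\<forall>x\<in>hur. \<exists>y\<in>hur. z * x = y * z) \<and> (\<forall>x\<in>hur. \<exists>y\<in>hur. x * z = z * y)"

lemma normalizing_theta: "normalizing \<theta>"
proof -
  have "\<exists>y\<in>hur. \<theta> * x = y * \<theta>" if "x \<in> hur" for x
    using even_nnrm_rmult[of "\<theta> * x"] that by (metis dvd_triv_left hur_basis(8) hur_mult nnrm_mult nnrm_simps(4))
  moreover have "\<exists>y\<in>hur. x * \<theta> = \<theta> * y" if "x \<in> hur" for x
    using even_nnrm_lmult[of "x * \<theta>"] that by (metis dvd_triv_right hur_basis(8) hur_mult nnrm_mult nnrm_simps(4))
  moreover have "\<theta> \<noteq> 0" by (metis nnrm_simps(1,4) zero_neq_numeral)
  ultimately show ?thesis unfolding normalizing_def by simp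
qed

lemma of_nat_quat_eq_0 [simp]: "of_nat m = (0::quat) \<longleftrightarrow> m = 0"
  by (metis nnrm_simps(1,3) of_nat_0 power_eq_0_iff zero_neq_numeral)

lemma normalizing_of_nat: "m > 0 \<Longrightarrow> normalizing (of_nat m)"
  unfolding normalizing_def by (auto intro: mult_of_nat_commute mult_of_nat_commute[symmetric])

lemma normalizing_mult:
  assumes "normalizing z" "normalizing w"
  shows "normalizing (z * w)"
proof -
  have "\<exists>y\<in>hur. z * w * x = y * (z * w)" if "x \<in> hur" for x
  proof -
    obtain y where y: "y \<in> hur" "w * x = y * w" using assms(2) \<open>x \<in> hur\<close> unfolding normalizing_def by blast
    obtain y' where "y' \<in> hur" "z * y = y' * z" using assms(1) y(1) unfolding normalizing_def by blast
    then show ?thesis using y by (metis mult.assoc)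
  qed
  moreover have "\<exists>y\<in>hur. x * (z * w) = z * w * y" if "x \<in> hur" for x
  proof -
    obtain y where y: "y \<in> hur" "x * z = z * y" using assms(1) \<open>x \<in> hur\<close> unfolding normalizing_def by blast
    obtain y' where "y' \<in> hur" "y * w = w * y'" using assms(2) y(1) unfolding normalizing_def by blast
    then show ?thesis using y by (metis mult.assoc)
  qed
  ultimately show ?thesis using assms unfolding normalizing_def by (auto simp: hur_mult)
qed

text \<open>\<open>\<theta> ^ 2\<close> is twice the unit \<open>q\<i>\<close>, so powers of
  \<open>\<theta>\<close> account for all powers of 2. For odd \<open>m\<close> distinct parameters
  give distinct norms 2^k m^2.\<close>

definition tsgen :: "nat \<Rightarrow> nat \<Rightarrow> quat" where
  "tsgen k m = \<theta> ^ k * of_nat m"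

lemma normalizing_tsgen: "m > 0 \<Longrightarrow> normalizing (tsgen k m)"
  unfolding tsgen_def
  by (induction k) (auto simp: normalizing_of_nat mult.assoc intro: normalizing_mult normalizing_theta)

lemma hur_tsgen [simp]: "tsgen k m \<in> hur"
  unfolding tsgen_def by (induction k) (auto simp: mult.assoc intro!: hur_mult)

lemma nnrm_tsgen: "nnrm (tsgen k m) = 2 ^ k * m\<^sup>2"
proof (induction k)
  case (Suc k)
  have "tsgen (Suc k) m = \<theta> * tsgen k m" by (simp add: tsgen_def mult.assoc)
  then show ?case by (simp add: nnrm_mult Suc del: times_quat_def)
qed (simp add: tsgen_def)

text \<open>Odd norm excludes the factor \<open>\<theta>\<close> and the last condition excludes
  rational integers: nothing can be split off into a two-sided ideal.\<close>

definition prim :: "quat \<Rightarrow> bool" where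
  "prim b \<longleftrightarrow> b \<in> hur \<and> odd (nnrm b) \<and> (\<forall>m. \<forall>c\<in>hur. b = of_nat m * c \<longrightarrow> m = 1)"

lemma primD:
  assumes "prim b"
  shows "b \<in> hur" "b \<noteq> 0" "odd (nnrm b)" "c \<in> hur \<Longrightarrow> b = of_nat m * c \<Longrightarrow> m = 1"
  using assms unfolding prim_def by auto

text \<open>Subtracting from x its sandwiches between \<open>q\<i>\<close>, \<open>q\<j>\<close> and
  \<open>q\<k>\<close> leaves four times its real part. So \<open>I\<close> contains the norm of
  \<open>b\<close> and twice each of its doubled coordinates. A prime dividing all of these is odd
  because the norm is, and it would divide \<open>b\<close>; hence their gcd is 1.\<close>

lemma prim_one_mem:
  assumes b: "prim b" "b \<in> I" and I: "sgrp I" "\<And>x y z. x \<in> I \<Longrightarrow> y \<in> hur \<Longrightarrow> z \<in> hur \<Longrightarrow> y * x * z \<in> I"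
  shows "1 \<in> I"
proof -
  have I': "y * x \<in> I" "x * y \<in> I" if "x \<in> I" "y \<in> hur" for x y
    using I(2)[of x y 1] I(2)[of x 1 y] that by simp_all
  have trace: "of_int (2 * n) \<in> I" if "x \<in> I" "2 * qa x = of_int n" for x n
  proof -
    have "x - q\<i> * x * q\<i> - q\<j> * x * q\<j> - q\<k> * x * q\<k> \<in> I"
      using that(1) I by (intro sgrpD(2)[OF I(1)]) simp_all
    moreover have "x - q\<i> * x * q\<i> - q\<j> * x * q\<j> - q\<k> * x * q\<k> = of_int (2 * n)"
      using that(2) by (intro quat_eqI) simp
    ultimately show ?thesis by simp
  qed
  have gcd: "of_int (gcd m n) \<in> I" if "of_int m \<in> I" "of_int n \<in> I" for m n
  proof -
    obtain u v where uv: "u * m + v * n = gcd m n" using bezout_int by blast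
    have "of_int u * of_int m + of_int v * of_int n \<in> I"
      using that by (intro sgrpD(4)[OF I(1)] sgrp_of_int_mult[OF I(1)])
    then show ?thesis by (simp flip: uv)
  qed
  obtain A b1 c d :: int where bb: "b = Quat (A/2) (A/2+b1) (A/2+c) (A/2+d)"
    using primD(1)[OF b(1)] by (rule hurE)
  have "of_int (2 * A) \<in> I" by (rule trace[OF b(2)]) (simp add: bb)
  \<comment> \<open>Left multiplication by \<open>- q\<i>\<close> moves the second coordinate into
    the real part; likewise for the other two units.\<close>
  moreover have "of_int (2 * (A + 2 * b1)) \<in> I"
    by (rule trace[of "- q\<i> * b"]) (rule I'(1)[OF b(2)], simp_all add: hur_uminus, simp add: bb)
  moreover have "of_int (2 * (A + 2 * c)) \<in> I"
    by (rule trace[of "- q\<j> * b"]) (rule I'(1)[OF b(2)], simp_all add: hur_uminus, simp add: bb)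
  moreover have "of_int (2 * (A + 2 * d)) \<in> I"
    by (rule trace[of "- q\<k> * b"]) (rule I'(1)[OF b(2)], simp_all add: hur_uminus, simp add: bb)
  moreover have "of_int (int (nnrm b)) \<in> I"
    using I'(2)[OF b(2) hur_conj[OF primD(1)[OF b(1)]]] by (simp add: mult_qconj_nnrm primD(1)[OF b(1)])
  ultimately have mem: "of_int (gcd (gcd (gcd (gcd (2 * A) (2 * (A + 2 * b1))) (2 * (A + 2 * c))) (2 * (A + 2 * d))) (int (nnrm b))) \<in> I"
    (is "of_int ?g \<in> I") by (intro gcd)
  have "?g = 1"
  proof (rule ccontr)
    assume "?g \<noteq> 1"
    then have "\<not> is_unit ?g" using gcd_ge_0_int unfolding zdvd1_eq by (metis abs_of_nonneg)
    moreover have "?g \<noteq> 0" using primD(3)[OF b(1)] by (metis even_zero gcd_eq_0_iff of_nat_0_eq_iff)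
    ultimately obtain q where q: "prime q" "q dvd ?g" using prime_divisor_exists by blast
    have "q dvd int (nnrm b)" using q(2) by (meson dvd_trans gcd_dvd2)
    then have "odd q" using primD(3)[OF b(1)] by (metis dvd_trans even_of_nat)
    then have two: "q dvd z" if "q dvd 2 * z" for z
      using that by (metis coprime_dvd_mult_right_iff coprime_right_2_iff_odd)
    have "q dvd 2 * A" "q dvd 2 * (A + 2 * b1)" "q dvd 2 * (A + 2 * c)" "q dvd 2 * (A + 2 * d)"
      using q(2) by (meson dvd_trans gcd_dvd1 gcd_dvd2)+
    then have "q dvd A" "q dvd b1" "q dvd c" "q dvd d"
      using two by (metis dvd_add_right_iff)+
    then obtain A' b' c' d' where "A = q * A'" "b1 = q * b'" "c = q * c'" "d = q * d'"
      by (auto elim!: dvdE)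
    then have "b = of_nat (nat q) * Quat (of_int A'/2) (of_int A'/2 + of_int b') (of_int A'/2 + of_int c') (of_int A'/2 + of_int d')"
      using prime_gt_0_int[OF q(1)] by (intro quat_eqI) (simp add: bb algebra_simps)
    then have "nat q = 1" using primD(4)[OF b(1)] hurI by blast
    then show False using prime_gt_1_int[OF q(1)] by simp
  qed
  then show ?thesis using mem by simp
qed

text \<open>Hence \<open>hur b hur = hur\<close> for primitive \<open>b\<close>, so that \<open>c hur\<close> is recovered from
  \<open>c hur b\<close> as \<open>c hur b hur\<close>.\<close>

lemma qlat_prim_subset:
  assumes "prim b" "c' \<noteq> 0" "qlat c b \<subseteq> (*) c' ` hur"
  shows "c \<in> (*) c' ` hur"
proof -
  define w where "w = inverse c' * c"
  \<comment> \<open>The \<open>x\<close> all of whose two-sided multiples are carried into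
    \<open>hur\<close> by \<open>w\<close>. They include \<open>b\<close> by assumption, hence 1 by
    \<open>prim_one_mem\<close>, and this says that \<open>w\<close> is integral.\<close>
  define I where "I = {x. \<forall>y\<in>hur. \<forall>z\<in>hur. w * (y * x * z) \<in> hur}"
  have "b \<in> I"
    unfolding I_def
  proof clarify
    fix y z assume yz: "y \<in> hur" "z \<in> hur"
    then have "c * y * b \<in> (*) c' ` hur" using assms(3) unfolding qlat_def by blast
    then obtain v where "v \<in> hur" "c * y * b = c' * v" by blast
    then have "w * (y * b * z) = v * z"
      unfolding w_def using assms(2) by (metis mult.assoc mult_inverse_cancel(1))
    then show "w * (y * b * z) \<in> hur" using \<open>v \<in> hur\<close> yz by (simp add: hur_mult)
  qed
  moreover have "sgrp I"
    unfolding sgrp_def I_def by (auto simp: right_diff_distrib left_diff_distrib hur_diff)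
  moreover have "y * x * z \<in> I" if "x \<in> I" "y \<in> hur" "z \<in> hur" for x y z
    unfolding I_def
  proof clarify
    fix y' z' assume "y' \<in> hur" "z' \<in> hur"
    then have "w * ((y' * y) * x * (z * z')) \<in> hur"
      using that hur_mult unfolding I_def by blast
    then show "w * (y' * (y * x * z) * z') \<in> hur" by (simp add: mult.assoc)
  qed
  ultimately have "1 \<in> I" using prim_one_mem[OF assms(1)] by blast
  then have "w * (1 * 1 * 1) \<in> hur" unfolding I_def using hur_basis(2) by blast
  then have "w \<in> hur" by simp
  moreover have "c = c' * w" unfolding w_def using assms(2) by simp
  ultimately show ?thesis by blast
qed

lemma lmult_hur_subset: "c \<in> (*) c' ` hur \<Longrightarrow> (*) c ` hur \<subseteq> (*) c' ` hur"
  by (auto simp: mult.assoc intro: hur_mult)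

text \<open>Two applications of \<open>qlat_prim_subset\<close> identify the right ideals of
  \<open>c\<close> and \<open>c'\<close>. Then \<open>c'\<close> may be replaced by \<open>c\<close>
  in the second lattice, and this common left factor cancels.\<close>

lemma qlat_prim_inj:
  assumes "prim b" "prim b'" "c \<in> hur" "c \<noteq> 0" "c' \<in> hur" "c' \<noteq> 0" "qlat c b = qlat c' b'"
  shows "(*) c ` hur = (*) c' ` hur" "lid b = lid b'"
proof -
  have sub: "qlat c b \<subseteq> (*) c ` hur" if "prim b" for c b
    unfolding qlat_eq_lmult using lid_subset_hur primD(1)[OF that] by blast
  show eq: "(*) c ` hur = (*) c' ` hur"
    using qlat_prim_subset[OF assms(1,6), of c] qlat_prim_subset[OF assms(2,4), of c']
      sub[OF assms(1), of c] sub[OF assms(2), of c'] assms(7) lmult_hur_subset by blast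
  have "qlat c' b' = (\<lambda>x. x * b') ` (*) c' ` hur" by (simp add: qlat_def image_image)
  also have "\<dots> = qlat c b'" unfolding eq[symmetric] by (simp add: qlat_def image_image)
  finally have "(*) c ` lid b = (*) c ` lid b'" using assms(7) unfolding qlat_eq_lmult by simp
  then show "lid b = lid b'"
    using assms(4) by (metis (no_types, lifting) inj_image_eq_iff injI mult_left_cancel)
qed

section \<open>Generators of principal left ideals\<close>

lemma lid_subset_iff: "b \<in> lid b' \<longleftrightarrow> lid b \<subseteq> lid b'"
proof
  assume "b \<in> lid b'"
  then show "lid b \<subseteq> lid b'"
    unfolding lid_def by (auto simp flip: mult.assoc intro: hur_mult)
next
  have "b \<in> lid b" unfolding lid_def by (auto intro: image_eqI[of _ _ 1])
  then show "lid b \<subseteq> lid b' \<Longrightarrow> b \<in> lid b'" by blast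
qed

lemma lid_self [simp]: "b \<in> lid b"
  using lid_subset_iff by blast

lemma lid_eq_iff:
  assumes "b \<in> hur" "b \<noteq> 0" "b' \<in> hur" "b' \<noteq> 0"
  shows "lid b = lid b' \<longleftrightarrow> (\<exists>u\<in>hur. nnrm u = 1 \<and> b' = u * b)"
proof
  assume "lid b = lid b'"
  then have "b' \<in> lid b" "b \<in> lid b'" by (metis lid_self)+
  then obtain u v where uv: "u \<in> hur" "b' = u * b" "v \<in> hur" "b = v * b'" unfolding lid_def by auto
  have 1: "nnrm b' = nnrm u * nnrm b" unfolding uv(2) by (rule nnrm_mult[OF uv(1) assms(1)])
  have 2: "nnrm b = nnrm v * nnrm b'" unfolding uv(4) by (rule nnrm_mult[OF uv(3) assms(3)])
  have "1 * nnrm b = nnrm v * nnrm u * nnrm b" using 2 unfolding 1 by (simp only: mult.assoc mult_1)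
  then have "nnrm v * nnrm u = 1" using nnrm_pos[OF assms(1,2)] unfolding mult_cancel2 by linarith
  then show "\<exists>u\<in>hur. nnrm u = 1 \<and> b' = u * b" using uv(1,2) by auto
next
  assume "\<exists>u\<in>hur. nnrm u = 1 \<and> b' = u * b"
  then obtain u where u: "u \<in> hur" "nnrm u = 1" "b' = u * b" by blast
  then have "b = qconj u * b'" by (simp add: unit_inverse flip: mult.assoc)
  then have "b' \<in> lid b" "b \<in> lid b'" using u hur_conj unfolding lid_def by blast+
  then show "lid b = lid b'" using lid_subset_iff by blast
qed

lemma lid_eq_nnrm:
  assumes "b \<in> hur" "b \<noteq> 0" "b' \<in> hur" "b' \<noteq> 0" "lid b = lid b'"
  shows "nnrm b = nnrm b'"
  using assms lid_eq_iff[OF assms(1-4)] nnrm_mult by (metis mult_1)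

lemma lmult_eq_nnrm:
  assumes "c \<in> hur" "c \<noteq> 0" "c' \<in> hur" "c' \<noteq> 0" "(*) c ` hur = (*) c' ` hur"
  shows "nnrm c = nnrm c'"
  using assms ridx_eq[of c] ridx_eq[of c'] unfolding ridx_def by simp

text \<open>Descent on the norm: an element that is not primitive loses a factor
  \<open>\<theta>\<close> if its norm is even, and otherwise a rational integer \<open>m\<close>,
  which is odd because its square divides the norm.\<close>

lemma prim_decomp:
  assumes "c \<in> hur" "c \<noteq> 0"
  obtains k m b where "odd m" "prim b" "c = tsgen k m * b"
proof -
  have "\<exists>k m b. odd m \<and> prim b \<and> c = tsgen k m * b"
    using assms
  proof (induction "nnrm c" arbitrary: c rule: less_induct)
    case less
    consider "prim c" | "even (nnrm c)" | m c' where "odd (nnrm c)" "c' \<in> hur" "c = of_nat m * c'" "m \<noteq> 1"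
      using less.prems unfolding prim_def by blast
    then show ?case
    proof cases
      case 1
      then show ?thesis by (intro exI[of _ 0] exI[of _ 1] exI[of _ c]) (simp add: tsgen_def)
    next
      case 2
      then obtain y where y: "y \<in> hur" "c = \<theta> * y" using even_nnrm_lmult less.prems by blast
      then have "y \<noteq> 0" using less.prems by auto
      moreover have "nnrm y < nnrm c"
        using y nnrm_mult[of \<theta> y] nnrm_pos[OF y(1) \<open>y \<noteq> 0\<close>] by simp
      ultimately obtain k m b where "odd m" "prim b" "y = tsgen k m * b"
        using less.hyps y(1) by blast
      moreover from this have "c = tsgen (Suc k) m * b"
        by (simp add: y(2) tsgen_def mult.assoc)
      ultimately show ?thesis by blast
    next
      case 3
      have n: "nnrm c = m\<^sup>2 * nnrm c'" using nnrm_mult[of "of_nat m" c'] 3 by simp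
      then have m: "odd m" using 3(1) by auto
      then have "m > 1" using 3(4) by (metis One_nat_def dvd_0_right gr0I less_one linorder_neqE_nat)
      have c0: "c' \<noteq> 0" using 3(3) less.prems by auto
      have "m\<^sup>2 > 1" using \<open>m > 1\<close> by (intro one_less_power) simp_all
      then have "nnrm c' < nnrm c" unfolding n using nnrm_pos[OF 3(2) c0] by simp
      then obtain k m' b where "odd m'" "prim b" "c' = tsgen k m' * b"
        using less.hyps 3(2) c0 by blast
      moreover from this have "c = tsgen k (m * m') * b"
        by (simp add: 3(3) tsgen_def mult.assoc flip: of_nat_mult_commute[of "\<theta> ^ k"])
      ultimately show ?thesis using m by (metis even_mult_iff)
    qed
  qed
  then show ?thesis using that by blast
qed

section \<open>Sublattices and left ideals as unique products\<close>

definition left_ideals :: "quat set set" where "left_ideals = {lid b |b. b \<in> hur \<and> b \<noteq> 0}"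
definition prim_ideals :: "quat set set" where "prim_ideals = {lid b |b. prim b}"
definition hur_ssls :: "quat set set" where "hur_ssls = {qlat a b |a b. a \<in> hur \<and> a \<noteq> 0 \<and> b \<in> hur \<and> b \<noteq> 0}"

definition lgen :: "quat set \<Rightarrow> quat" where
  "lgen B = (SOME b. b \<in> hur \<and> b \<noteq> 0 \<and> B = lid b)"

definition lnorm :: "quat set \<Rightarrow> nat" where
  "lnorm B = nnrm (lgen B)"

lemma prim_ideals_subset_left_ideals: "prim_ideals \<subseteq> left_ideals"
  unfolding prim_ideals_def left_ideals_def using primD by blast

lemma lgen:
  assumes "B \<in> left_ideals"
  shows "lgen B \<in> hur" "lgen B \<noteq> 0" "lid (lgen B) = B"
proof -
  obtain b where "b \<in> hur \<and> b \<noteq> 0 \<and> B = lid b" using assms unfolding left_ideals_def by blast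
  from someI[of "\<lambda>b. b \<in> hur \<and> b \<noteq> 0 \<and> B = lid b", OF this]
  show "lgen B \<in> hur" "lgen B \<noteq> 0" "lid (lgen B) = B" unfolding lgen_def by auto
qed

lemma lid_left_ideals: "b \<in> hur \<Longrightarrow> b \<noteq> 0 \<Longrightarrow> lid b \<in> left_ideals"
  unfolding left_ideals_def by blast

lemma lnorm_lid:
  assumes "b \<in> hur" "b \<noteq> 0"
  shows "lnorm (lid b) = nnrm b"
  using lid_eq_nnrm[OF lgen(1,2)[OF lid_left_ideals[OF assms]] assms lgen(3)[OF lid_left_ideals[OF assms]]]
  by (simp add: lnorm_def)

lemma lnorm_pos: "B \<in> left_ideals \<Longrightarrow> lnorm B > 0"
  unfolding lnorm_def by (simp add: lgen nnrm_pos)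

lemma prim_unit_mult:
  assumes "prim b" "u \<in> hur" "nnrm u = 1"
  shows "prim (u * b)"
  unfolding prim_def
proof (intro conjI allI ballI impI)
  show "u * b \<in> hur" "odd (nnrm (u * b))"
    using assms primD(1,3)[OF assms(1)] by (simp_all add: hur_mult nnrm_mult)
  fix m c assume "c \<in> hur" "u * b = of_nat m * c"
  moreover from this have "b = of_nat m * (qconj u * c)"
    using unit_inverse[OF assms(2,3)] by (metis mult.assoc mult_1 of_nat_mult_commute)
  ultimately show "m = 1" using primD(4)[OF assms(1)] hur_mult hur_conj assms(2) by blast
qed

lemma prim_lgen:
  assumes "B \<in> prim_ideals"
  shows "prim (lgen B)"
proof -
  have B: "B \<in> left_ideals" using assms prim_ideals_subset_left_ideals by blast
  obtain b where b: "prim b" "B = lid b" using assms unfolding prim_ideals_def by blast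
  then obtain u where "u \<in> hur" "nnrm u = 1" "lgen B = u * b"
    using lid_eq_iff[of b "lgen B"] lgen[OF B] primD(1,2)[OF b(1)] by metis
  then show ?thesis using prim_unit_mult[OF b(1)] by simp
qed

lemma qlat_normalizing:
  assumes "normalizing z"
  shows "qlat a (z * b) = qlat (a * z) b"
proof
  show "qlat a (z * b) \<subseteq> qlat (a * z) b"
  proof (unfold qlat_def, clarify)
    fix x assume "x \<in> hur"
    then obtain y where "y \<in> hur" "x * z = z * y" using assms unfolding normalizing_def by blast
    then show "a * x * (z * b) \<in> (\<lambda>x. a * z * x * b) ` hur"
      by (metis (no_types, lifting) image_eqI mult.assoc)
  qed
  show "qlat (a * z) b \<subseteq> qlat a (z * b)"
  proof (unfold qlat_def, clarify)
    fix x assume "x \<in> hur"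
    then obtain y where "y \<in> hur" "z * x = y * z" using assms unfolding normalizing_def by blast
    then show "a * z * x * b \<in> (\<lambda>x. a * x * (z * b)) ` hur"
      by (metis (no_types, lifting) image_eqI mult.assoc)
  qed
qed

lemma qlat_hur_ssls: "a \<in> hur \<Longrightarrow> a \<noteq> 0 \<Longrightarrow> b \<in> hur \<Longrightarrow> b \<noteq> 0 \<Longrightarrow> qlat a b \<in> hur_ssls"
  unfolding hur_ssls_def by blast

lemma lid_prim_ideals: "prim b \<Longrightarrow> lid b \<in> prim_ideals"
  unfolding prim_ideals_def by blast

lemma qconj_0_iff [simp]: "qconj x = 0 \<longleftrightarrow> x = 0"
  using qconj_eq_iff[of x 0] by simp

text \<open>Conjugation turns the right ideal of the left factor into a left ideal. Both parameters
  then range over left ideals and contribute series of the same kind.\<close>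

definition pair_lat :: "quat set \<times> quat set \<Rightarrow> quat set" where
  "pair_lat = (\<lambda>(A, B). qlat (qconj (lgen A)) (lgen B))"

lemma bij_pair_lat: "bij_betw pair_lat (left_ideals \<times> prim_ideals) hur_ssls"
  unfolding bij_betw_def
proof
  show "inj_on pair_lat (left_ideals \<times> prim_ideals)"
  proof (rule inj_onI, clarify)
    fix A B A' B' assume mem: "A \<in> left_ideals" "B \<in> prim_ideals" "A' \<in> left_ideals" "B' \<in> prim_ideals"
      and eq: "pair_lat (A, B) = pair_lat (A', B')"
    have "B \<in> left_ideals" "B' \<in> left_ideals" using mem prim_ideals_subset_left_ideals by auto
    note * = qlat_prim_inj[OF prim_lgen[OF mem(2)] prim_lgen[OF mem(4)], of "qconj (lgen A)" "qconj (lgen A')"]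
    have "lid (lgen B) = lid (lgen B')" "qconj ` lid (lgen A) = qconj ` lid (lgen A')"
      unfolding lmult_qconj[symmetric] using * mem eq by (simp_all add: hur_conj lgen pair_lat_def)
    then show "A = A' \<and> B = B'"
      using mem \<open>B \<in> left_ideals\<close> \<open>B' \<in> left_ideals\<close> by (metis (no_types, lifting) inj_image_eq_iff injI lgen(3) qconj_eq_iff)
  qed
  show "pair_lat ` (left_ideals \<times> prim_ideals) = hur_ssls"
  proof
    show "pair_lat ` (left_ideals \<times> prim_ideals) \<subseteq> hur_ssls"
    proof clarify
      fix A B assume A: "A \<in> left_ideals" and B: "B \<in> prim_ideals"
      from B have "B \<in> left_ideals" using prim_ideals_subset_left_ideals by blast
      then show "pair_lat (A, B) \<in> hur_ssls" using A by (simp add: pair_lat_def qlat_hur_ssls hur_conj lgen)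
    qed
    show "hur_ssls \<subseteq> pair_lat ` (left_ideals \<times> prim_ideals)"
    proof
      fix M assume "M \<in> hur_ssls"
      then obtain a b where ab: "a \<in> hur" "a \<noteq> 0" "b \<in> hur" "b \<noteq> 0" "M = qlat a b"
        unfolding hur_ssls_def by blast
      obtain k m b' where b': "odd m" "prim b'" "b = tsgen k m * b'"
        using prim_decomp[OF ab(3,4)] by blast
      \<comment> \<open>The two-sided part of \<open>b\<close> moves across \<open>hur\<close> into
        the left factor, leaving a primitive right factor.\<close>
      define c where "c = a * tsgen k m"
      have z: "normalizing (tsgen k m)" using b'(1) by (intro normalizing_tsgen) (auto elim: oddE)
      then have c: "c \<in> hur" "c \<noteq> 0" using ab unfolding c_def normalizing_def by (simp_all add: hur_mult)
      have M: "M = qlat c b'" unfolding ab(5) b'(3) c_def by (rule qlat_normalizing[OF z])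
      define A B where "A = lid (qconj c)" and "B = lid b'"
      have AB: "A \<in> left_ideals" "B \<in> prim_ideals" "B \<in> left_ideals"
        unfolding A_def B_def using c b'(2) primD(1,2)[OF b'(2)] by (simp_all add: lid_left_ideals lid_prim_ideals hur_conj)
      have "qlat (qconj (lgen A)) (lgen B) = (\<lambda>x. x * lgen B) ` (*) (qconj (lgen A)) ` hur"
        by (simp add: qlat_def image_image)
      also have "(*) (qconj (lgen A)) ` hur = (*) c ` hur"
        unfolding lmult_qconj lgen(3)[OF AB(1)] by (simp add: A_def flip: lmult_qconj)
      also have "(\<lambda>x. x * lgen B) ` (*) c ` hur = (*) c ` lid (lgen B)"
        by (simp add: lid_def image_image mult.assoc)
      also have "\<dots> = qlat c b'" unfolding lgen(3)[OF AB(3)] by (simp add: B_def qlat_eq_lmult)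
      finally have "M = pair_lat (A, B)" using M by (simp add: pair_lat_def)
      then show "M \<in> pair_lat ` (left_ideals \<times> prim_ideals)" using AB by blast
    qed
  qed
qed

lemma qindex_pair_lat:
  assumes "A \<in> left_ideals" "B \<in> prim_ideals"
  shows "qindex hur (pair_lat (A, B)) = (lnorm A * lnorm B)\<^sup>2"
proof -
  have "B \<in> left_ideals" using assms prim_ideals_subset_left_ideals by blast
  then show ?thesis
    using assms by (simp add: pair_lat_def qindex_qlat lgen hur_conj lnorm_def)
qed

definition ts_ideal :: "(nat \<times> nat) \<times> quat set \<Rightarrow> quat set" where
  "ts_ideal = (\<lambda>((k, m), B). lid (tsgen k m * lgen B))"

lemma two_power_odd_square_inj:
  assumes "2 ^ k * m\<^sup>2 = 2 ^ k' * m'\<^sup>2" "odd (m::nat)" "odd m'"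
  shows "k = k' \<and> m = m'"
proof -
  have *: "k' \<le> k" if "2 ^ k * m\<^sup>2 = 2 ^ k' * m'\<^sup>2" "odd m" "odd (m'::nat)" for k k' m m'
  proof (rule ccontr)
    assume "\<not> k' \<le> k"
    then obtain j where "k' = k + Suc j" by (metis less_iff_Suc_add not_le add_Suc_right)
    then have "m\<^sup>2 = 2 * (2 ^ j * m'\<^sup>2)" using that(1) by (simp add: power_add)
    then have "even (m\<^sup>2)" by simp
    then show False using that(2) by simp
  qed
  have "k = k'" using *[OF assms] *[OF assms(1)[symmetric] assms(3,2)] by simp
  then show ?thesis using assms(1) by (simp add: power2_eq_iff_nonneg)
qed

lemma lid_tsgen: "odd m \<Longrightarrow> lid (tsgen k m * b) = qlat (tsgen k m) b"
  using qlat_normalizing[of "tsgen k m" 1 b] by (simp add: normalizing_tsgen odd_pos qlat_1_left)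

lemma tsgen_nonzero: "odd m \<Longrightarrow> tsgen k m \<noteq> 0"
  using normalizing_tsgen[of m k] odd_pos[of m] unfolding normalizing_def by simp

lemma lnorm_ts_ideal:
  assumes "odd m" "B \<in> prim_ideals"
  shows "lnorm (ts_ideal ((k, m), B)) = 2 ^ k * m\<^sup>2 * lnorm B"
proof -
  have "B \<in> left_ideals" using assms prim_ideals_subset_left_ideals by blast
  then show ?thesis
    using assms(1) by (simp add: ts_ideal_def lnorm_lid lgen hur_mult tsgen_nonzero nnrm_mult nnrm_tsgen)
      (simp add: lnorm_def)
qed

text \<open>Since t = \<open>tsgen k m\<close> normalises \<open>hur\<close>, the left ideal hur t b
  is also t hur b, and uniqueness comes from \<open>qlat_prim_inj\<close>. The norm 2^k m^2 of the
  two-sided part then determines \<open>k\<close> and \<open>m\<close>.\<close>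

lemma bij_ts_ideal: "bij_betw ts_ideal ((UNIV \<times> {m. odd m}) \<times> prim_ideals) left_ideals"
  unfolding bij_betw_def
proof
  show "inj_on ts_ideal ((UNIV \<times> {m. odd m}) \<times> prim_ideals)"
  proof (rule inj_onI)
    fix s t assume st: "s \<in> (UNIV \<times> {m. odd m}) \<times> prim_ideals" "t \<in> (UNIV \<times> {m. odd m}) \<times> prim_ideals"
      and eq': "ts_ideal s = ts_ideal t"
    obtain k m B k' m' B' where s: "s = ((k, m), B)" and t: "t = ((k', m'), B')"
      by (metis prod.exhaust)
    have mem: "B \<in> prim_ideals" "B' \<in> prim_ideals" and odd: "odd m" "odd m'"
      and eq: "ts_ideal ((k, m), B) = ts_ideal ((k', m'), B')"
      using st eq' unfolding s t by auto
    have left_ideals: "B \<in> left_ideals" "B' \<in> left_ideals" using mem prim_ideals_subset_left_ideals by auto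
    have eq': "qlat (tsgen k m) (lgen B) = qlat (tsgen k' m') (lgen B')"
      using eq odd by (simp add: ts_ideal_def lid_tsgen)
    note * = qlat_prim_inj[OF prim_lgen[OF mem(1)] prim_lgen[OF mem(2)] hur_tsgen tsgen_nonzero[OF odd(1)]
        hur_tsgen tsgen_nonzero[OF odd(2)] eq']
    have "B = B'" using *(2) lgen(3) left_ideals by simp
    moreover have "2 ^ k * m\<^sup>2 = 2 ^ k' * m'\<^sup>2"
      using lmult_eq_nnrm[OF hur_tsgen tsgen_nonzero[OF odd(1)] hur_tsgen tsgen_nonzero[OF odd(2)] *(1)]
      by (simp add: nnrm_tsgen)
    ultimately show "s = t" unfolding s t using two_power_odd_square_inj odd by blast
  qed
  show "ts_ideal ` ((UNIV \<times> {m. odd m}) \<times> prim_ideals) = left_ideals"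
  proof
    show "ts_ideal ` ((UNIV \<times> {m. odd m}) \<times> prim_ideals) \<subseteq> left_ideals"
    proof clarify
      fix k m B assume "odd (m::nat)" and B: "B \<in> prim_ideals"
      from B have "B \<in> left_ideals" using prim_ideals_subset_left_ideals by blast
      then show "ts_ideal ((k, m), B) \<in> left_ideals"
        using \<open>odd m\<close> by (simp add: ts_ideal_def lid_left_ideals hur_mult lgen tsgen_nonzero)
    qed
    show "left_ideals \<subseteq> ts_ideal ` ((UNIV \<times> {m. odd m}) \<times> prim_ideals)"
    proof
      fix C assume "C \<in> left_ideals"
      then obtain c where c: "c \<in> hur" "c \<noteq> 0" "C = lid c" unfolding left_ideals_def by blast
      obtain k m b where b: "odd m" "prim b" "c = tsgen k m * b"
        using prim_decomp[OF c(1,2)] by blast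
      have "lid (lgen (lid b)) = lid b" using primD(1,2)[OF b(2)] by (intro lgen lid_left_ideals)
      then have "C = ts_ideal ((k, m), lid b)"
        unfolding c(3) b(3) ts_ideal_def using b(1) by (simp add: lid_tsgen qlat_eq_lmult)
      then show "C \<in> ts_ideal ` ((UNIV \<times> {m. odd m}) \<times> prim_ideals)" using b lid_prim_ideals by blast
    qed
  qed
qed

section \<open>Counting left ideals by norm\<close>

abbreviation "hunits \<equiv> {x \<in> hur. nnrm x = 1}"

definition nunits :: nat where "nunits = card hunits"

lemma nunits_pos: "nunits > 0"
  unfolding nunits_def using finite_hur_nnrm[of 1] nnrm_simps(2) hur_basis(2) by (subst card_gt_0_iff) blast

definition left_ideal_number :: "nat \<Rightarrow> nat" where "left_ideal_number n = card {B \<in> left_ideals. lnorm B = n}"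
definition prim_ideal_number :: "nat \<Rightarrow> nat" where "prim_ideal_number n = card {B \<in> prim_ideals. lnorm B = n}"

lemma finite_left_ideals_norm: "finite {B \<in> left_ideals. lnorm B = n}"
proof (rule finite_subset)
  show "{B \<in> left_ideals. lnorm B = n} \<subseteq> lid ` {x \<in> hur. nnrm x = n}"
    unfolding left_ideals_def using lnorm_lid by auto
qed (simp add: finite_hur_nnrm)

text \<open>Every left ideal has exactly \<open>nunits\<close> generators. Passing to elements makes
  factorisations c = a b available for counting; \<open>P\<close> will be either trivial or
  \<open>prim\<close>.\<close>

lemma card_elements_ideals:
  assumes "n > 0" and inv: "\<And>u b. b \<in> hur \<Longrightarrow> P b \<Longrightarrow> u \<in> hunits \<Longrightarrow> P (u * b)"
  shows "card {x \<in> hur. nnrm x = n \<and> P x} = nunits * card {B \<in> left_ideals. lnorm B = n \<and> P (lgen B)}"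
proof -
  let ?L = "{B \<in> left_ideals. lnorm B = n \<and> P (lgen B)}"
  have "bij_betw (\<lambda>(u, B). u * lgen B) (hunits \<times> ?L) {x \<in> hur. nnrm x = n \<and> P x}"
    unfolding bij_betw_def
  proof
    show "inj_on (\<lambda>(u, B). u * lgen B) (hunits \<times> ?L)"
    proof (rule inj_onI, clarify)
      fix u B u' B' assume u: "u \<in> hur" "nnrm u = 1" and u': "u' \<in> hur" "nnrm u' = 1"
        and B: "B \<in> left_ideals" and B': "B' \<in> left_ideals" and eq: "u * lgen B = u' * lgen B'"
      have "lgen B' = (qconj u' * u) * lgen B"
        using eq unit_inverse(2)[OF u'] by (metis mult.assoc mult_1)
      moreover have "qconj u' * u \<in> hur" "nnrm (qconj u' * u) = 1"
        using u u' by (simp_all add: hur_mult hur_conj nnrm_mult)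
      ultimately have "lid (lgen B) = lid (lgen B')"
        using lid_eq_iff[OF lgen(1,2)[OF B] lgen(1,2)[OF B']] by blast
      then have "B = B'" using lgen(3) B B' by simp
      then show "u = u' \<and> B = B'" using eq lgen(2)[OF B] by simp
    qed
    show "(\<lambda>(u, B). u * lgen B) ` (hunits \<times> ?L) = {x \<in> hur. nnrm x = n \<and> P x}"
    proof
      show "(\<lambda>(u, B). u * lgen B) ` (hunits \<times> ?L) \<subseteq> {x \<in> hur. nnrm x = n \<and> P x}"
        using inv by (auto simp: hur_mult lgen nnrm_mult lnorm_def)
      show "{x \<in> hur. nnrm x = n \<and> P x} \<subseteq> (\<lambda>(u, B). u * lgen B) ` (hunits \<times> ?L)"
      proof
        fix x assume "x \<in> {x \<in> hur. nnrm x = n \<and> P x}"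
        then have x: "x \<in> hur" "nnrm x = n" "P x" by auto
        then have x0: "x \<noteq> 0" using assms(1) by auto
        define B where "B = lid x"
        have B: "B \<in> left_ideals" unfolding B_def using x(1) x0 by (rule lid_left_ideals)
        obtain u where u: "u \<in> hur" "nnrm u = 1" "lgen B = u * x"
          using lid_eq_iff[OF x(1) x0 lgen(1,2)[OF B]] lgen(3)[OF B] B_def by auto
        have "lnorm B = n" unfolding B_def using x x0 by (simp add: lnorm_lid)
        moreover have "P (lgen B)" unfolding u(3) using inv x u by blast
        ultimately have "(qconj u, B) \<in> hunits \<times> ?L"
          using B u(1,2) hur_conj by simp
        moreover have "x = (\<lambda>(u, B). u * lgen B) (qconj u, B)"
          unfolding u(3) prod.case using unit_inverse(2)[OF u(1,2)] by (simp flip: mult.assoc)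
        ultimately show "x \<in> (\<lambda>(u, B). u * lgen B) ` (hunits \<times> ?L)"
          by (rule rev_image_eqI)
      qed
    qed
  qed
  from bij_betw_same_card[OF this] show ?thesis by (simp only: card_cartesian_product nunits_def)
qed

lemma card_norm: "n > 0 \<Longrightarrow> card {x \<in> hur. nnrm x = n} = nunits * left_ideal_number n"
  using card_elements_ideals[of n "\<lambda>_. True"] unfolding left_ideal_number_def by simp

lemma prim_ideals_iff: "B \<in> prim_ideals \<longleftrightarrow> B \<in> left_ideals \<and> prim (lgen B)"
  using prim_lgen prim_ideals_subset_left_ideals lid_prim_ideals lgen(3) by (metis subsetD)

lemma card_prim_norm: "n > 0 \<Longrightarrow> card {x \<in> hur. nnrm x = n \<and> prim x} = nunits * prim_ideal_number n"
  using card_elements_ideals[of n prim] prim_unit_mult unfolding prim_ideal_number_def prim_ideals_iff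
  by (simp add: conj_commute conj_left_commute)

lemma left_ideal_number_1: "left_ideal_number 1 = 1"
  using card_norm[of 1] nunits_pos unfolding nunits_def by (simp del: One_nat_def)

text \<open>\<open>a\<close> generates the right ideal c hur + m hur. Conjugation turns that ideal
  into a left ideal, where \<open>left_ideal_principal\<close> applies.\<close>

lemma right_gcd:
  assumes "c \<in> hur" "m > 0"
  obtains a x y c' m' where "a \<in> hur" "x \<in> hur" "y \<in> hur" "c' \<in> hur" "m' \<in> hur"
    "a = c * x + of_nat m * y" "c = a * c'" "of_nat m = a * m'"
proof -
  define I where "I = {x * qconj c + y * of_nat m |x y. x \<in> hur \<and> y \<in> hur}"
  have memI: "x * qconj c + y * of_nat m \<in> I" if "x \<in> hur" "y \<in> hur" for x y
    using that unfolding I_def by blast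
  have "left_ideal I"
    unfolding left_ideal_def
  proof (intro conjI ballI)
    show "I \<subseteq> hur" unfolding I_def using assms by (auto intro!: hur_add hur_mult hur_conj)
    show "0 \<in> I" using memI[of 0 0] by simp
    fix z assume "z \<in> I"
    then obtain x y where z: "x \<in> hur" "y \<in> hur" "z = x * qconj c + y * of_nat m" unfolding I_def by blast
    { fix w assume "w \<in> I"
      then obtain x' y' where w: "x' \<in> hur" "y' \<in> hur" "w = x' * qconj c + y' * of_nat m" unfolding I_def by blast
      have "z - w = (x - x') * qconj c + (y - y') * of_nat m"
        by (simp add: z w left_diff_distrib)
      then show "z - w \<in> I" using memI z w hur_diff by metis }
    { fix a assume "a \<in> hur"
      moreover have "a * z = (a * x) * qconj c + (a * y) * of_nat m"
        by (simp add: z distrib_left mult.assoc)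
      ultimately show "a * z \<in> I" using memI z hur_mult by metis }
  qed
  moreover have mI: "of_nat m \<in> I" using memI[of 0 1] by simp
  then have "I \<noteq> {0}" using assms(2) by force
  ultimately obtain b where b: "b \<in> hur" "I = lid b" using left_ideal_principal by blast
  have "qconj c \<in> I" using memI[of 1 0] by simp
  then obtain c' where c': "c' \<in> hur" "qconj c = c' * b" unfolding b lid_def by blast
  obtain m' where m': "m' \<in> hur" "of_nat m = m' * b" using mI unfolding b lid_def by blast
  have "b \<in> I" unfolding b by simp
  then obtain x y where xy: "x \<in> hur" "y \<in> hur" "b = x * qconj c + y * of_nat m" unfolding I_def by blast
  have "qconj b = qconj (x * qconj c + y * of_nat m)" using xy(3) by (rule arg_cong)
  then have 1: "qconj b = c * qconj x + of_nat m * qconj y" by (simp add: qconj_mult)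
  have 2: "c = qconj b * qconj c'" using c'(2) by (metis qconj_mult qconj_simps(1))
  have 3: "of_nat m = qconj b * qconj m'" using m'(2) by (metis qconj_mult qconj_simps(8))
  show ?thesis
    by (rule that[OF hur_conj[OF b(1)] hur_conj[OF xy(1)] hur_conj[OF xy(2)] hur_conj[OF c'(1)] hur_conj[OF m'(1)] 1 2 3])
qed

text \<open>The mixed term in the norm of the sum is \<open>m\<close> times the trace of
  \<open>z * qconj w\<close>, and traces of Hurwitz elements are integers.\<close>

lemma dvd_nnrm_add:
  assumes "z \<in> hur" "w \<in> hur" "m dvd nnrm z"
  shows "m dvd nnrm (z + of_nat m * w)"
proof -
  define v where "v = z * qconj w"
  have "v \<in> hur" unfolding v_def using assms by (simp add: hur_mult hur_conj)
  then obtain A b c d :: int where "v = Quat (A/2) (A/2+b) (A/2+c) (A/2+d)" by (rule hurE)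
  then have A: "2 * qa v = of_int A" by simp
  have "nrm (z + of_nat m * w) = nrm z + real m * (2 * qa v) + (real m)\<^sup>2 * nrm w"
    unfolding v_def nrm_def by (simp add: power2_eq_square algebra_simps)
  then have "real_of_int (int (nnrm (z + of_nat m * w))) = real_of_int (int (nnrm z) + int m * A + (int m)\<^sup>2 * int (nnrm w))"
    using assms unfolding A by (simp add: hur_add hur_mult flip: real_nnrm)
  then have "int (nnrm (z + of_nat m * w)) = int (nnrm z) + int m * A + (int m)\<^sup>2 * int (nnrm w)"
    by (simp only: of_int_eq_iff)
  moreover have "int m dvd int (nnrm z) + int m * A + (int m)\<^sup>2 * int (nnrm w)"
    using assms(3) by (intro dvd_add) (auto simp: power2_eq_square)
  ultimately show ?thesis by (metis int_dvd_int_iff)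
qed

text \<open>If \<open>a\<^sub>0 hur = c hur + m hur\<close> has norm \<open>m\<close>, then every left divisor of \<open>c\<close> of norm \<open>m\<close>
  generates this right ideal, so the left divisors of norm \<open>m\<close> form a torsor under the units.\<close>

lemma card_left_divisors:
  assumes c: "c \<in> hur" and m: "m > 0"
    and a0: "a0 \<in> hur" "nnrm a0 = m" and xy: "x \<in> hur" "y \<in> hur" "a0 = c * x + of_nat m * y"
    and c': "c' \<in> hur" "c = a0 * c'"
  shows "card {a \<in> hur. nnrm a = m \<and> (\<exists>b\<in>hur. c = a * b)} = nunits"
proof -
  have a00: "a0 \<noteq> 0" using a0 m by auto
  have "bij_betw (\<lambda>e. a0 * e) hunits {a \<in> hur. nnrm a = m \<and> (\<exists>b\<in>hur. c = a * b)}"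
    unfolding bij_betw_def
  proof
    show "inj_on (\<lambda>e. a0 * e) hunits" using a00 by (auto simp: inj_on_def)
    show "(\<lambda>e. a0 * e) ` hunits = {a \<in> hur. nnrm a = m \<and> (\<exists>b\<in>hur. c = a * b)}"
    proof
      show "(\<lambda>e. a0 * e) ` hunits \<subseteq> {a \<in> hur. nnrm a = m \<and> (\<exists>b\<in>hur. c = a * b)}"
      proof clarify
        fix e assume e: "e \<in> hur" "nnrm e = 1"
        have "c = (a0 * e) * (qconj e * c')"
          using c'(2) unit_inverse(1)[OF e] by (metis mult.assoc mult_1)
        moreover have "qconj e * c' \<in> hur" using e c' by (simp add: hur_mult hur_conj)
        ultimately show "a0 * e \<in> hur \<and> nnrm (a0 * e) = m \<and> (\<exists>b\<in>hur. c = a0 * e * b)"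
          using e a0 by (auto simp: hur_mult nnrm_mult)
      qed
      show "{a \<in> hur. nnrm a = m \<and> (\<exists>b\<in>hur. c = a * b)} \<subseteq> (\<lambda>e. a0 * e) ` hunits"
      proof clarify
        fix a b assume a: "a \<in> hur" "m = nnrm a" and b: "b \<in> hur" "c = a * b"
        \<comment> \<open>Both \<open>c\<close> and \<open>m\<close> have the left factor
          \<open>a\<close>, so the combination giving \<open>a0\<close> has it too, with cofactor
          \<open>w\<close>. Equal norms make \<open>w\<close> a unit.\<close>
        define w where "w = b * x + qconj a * y"
        have w: "w \<in> hur" unfolding w_def using a b xy by (simp add: hur_add hur_mult hur_conj)
        have a0w: "a0 = a * w"
          unfolding xy(3) w_def a(2) b(2) by (simp add: mult_qconj_nnrm[OF a(1), symmetric] distrib_left mult.assoc)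
        then have "m * nnrm w = m * 1" using a0(2) a nnrm_mult[OF a(1) w] by simp
        then have nw: "nnrm w = 1" using m by simp
        have "a = a0 * qconj w" unfolding a0w mult.assoc unit_inverse(1)[OF w nw] by simp
        then show "a \<in> (\<lambda>e. a0 * e) ` hunits" using w nw hur_conj by auto
      qed
    qed
  qed
  then show ?thesis unfolding nunits_def by (simp add: bij_betw_same_card)
qed

text \<open>The norm of the right gcd \<open>a\<close> of \<open>c\<close> and \<open>m\<close>
  divides both m n and m^2, hence m; by \<open>dvd_nnrm_add\<close> it is also a multiple of
  m.\<close>

lemma card_left_divisors_coprime:
  assumes c: "c \<in> hur" "nnrm c = m * n" and "coprime m n" "m > 0" "n > 0"
  shows "card {a \<in> hur. nnrm a = m \<and> (\<exists>b\<in>hur. c = a * b)} = nunits"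
proof -
  obtain a x y c' m' where *: "a \<in> hur" "x \<in> hur" "y \<in> hur" "c' \<in> hur" "m' \<in> hur"
    "a = c * x + of_nat m * y" "c = a * c'" "of_nat m = a * m'"
    using right_gcd[OF c(1) \<open>m > 0\<close>] by blast
  have "nnrm a dvd m * n" using nnrm_mult[OF *(1,4)] *(7) c(2) by (metis dvd_triv_left)
  moreover have "nnrm a dvd m * m"
    using nnrm_mult[OF *(1,5)] unfolding *(8)[symmetric] by (simp add: power2_eq_square)
  ultimately have "nnrm a dvd gcd (m * n) (m * m)" by (rule gcd_greatest)
  then have "nnrm a dvd m" using assms(3) by (simp add: gcd_mult_distrib_nat[symmetric] coprime_commute)
  moreover have "m dvd nnrm a"
    unfolding *(6) by (rule dvd_nnrm_add[OF hur_mult[OF c(1) *(2)] *(3)]) (simp add: nnrm_mult[OF c(1) *(2)] c(2))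
  ultimately have "nnrm a = m" by (rule dvd_antisym)
  then show ?thesis using card_left_divisors[OF c(1) \<open>m > 0\<close> *(1) _ *(2,3,6,4,7)] by blast
qed

text \<open>A double count of the pairs (a, b) by their product: the product together with
  \<open>a\<close> recovers \<open>b\<close> by cancellation.\<close>

lemma card_product_fibers:
  assumes "m > 0" "n > 0"
    and P: "\<And>a b. a \<in> hur \<Longrightarrow> b \<in> hur \<Longrightarrow> nnrm a = m \<Longrightarrow> nnrm b = n \<Longrightarrow> P (a * b) \<longleftrightarrow> P a \<and> P b"
  shows "card {a \<in> hur. nnrm a = m \<and> P a} * card {b \<in> hur. nnrm b = n \<and> P b} =
    (\<Sum>c\<in>{c \<in> hur. nnrm c = m * n \<and> P c}. card {a \<in> hur. nnrm a = m \<and> (\<exists>b\<in>hur. c = a * b)})"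
proof -
  let ?A = "{a \<in> hur. nnrm a = m \<and> P a}" and ?B = "{b \<in> hur. nnrm b = n \<and> P b}"
  let ?C = "{c \<in> hur. nnrm c = m * n \<and> P c}" and ?D = "\<lambda>c. {a \<in> hur. nnrm a = m \<and> (\<exists>b\<in>hur. c = a * b)}"
  have "bij_betw (\<lambda>(a, b). (a * b, a)) (?A \<times> ?B) (Sigma ?C ?D)"
    unfolding bij_betw_def
  proof
    show "inj_on (\<lambda>(a, b). (a * b, a)) (?A \<times> ?B)"
    proof (rule inj_onI)
      fix s t assume s: "s \<in> ?A \<times> ?B" and eq: "(\<lambda>(a, b). (a * b, a)) s = (\<lambda>(a, b). (a * b, a)) t"
      obtain a b a' b' where st: "s = (a, b)" "t = (a', b')" by fastforce
      have "nnrm a = m" using s unfolding st by simp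
      then have "a \<noteq> 0" using assms(1) by auto
      then show "s = t" using eq unfolding st by auto
    qed
    show "(\<lambda>(a, b). (a * b, a)) ` (?A \<times> ?B) = Sigma ?C ?D"
    proof
      show "(\<lambda>(a, b). (a * b, a)) ` (?A \<times> ?B) \<subseteq> Sigma ?C ?D"
        using P by (auto simp: hur_mult nnrm_mult)
      show "Sigma ?C ?D \<subseteq> (\<lambda>(a, b). (a * b, a)) ` (?A \<times> ?B)"
      proof clarify
        fix a b assume *: "a * b \<in> hur" "P (a * b)" "a \<in> hur" "b \<in> hur" and m: "m = nnrm a"
          and "nnrm (a * b) = nnrm a * n"
        then have "nnrm b = n" using nnrm_mult[OF *(3,4)] assms(1) by simp
        then show "(a * b, a) \<in> (\<lambda>(a, b). (a * b, a)) ` ({x \<in> hur. nnrm x = nnrm a \<and> P x} \<times> ?B)"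
          using P[of a b] * m by (intro image_eqI[of _ _ "(a, b)"]) auto
      qed
    qed
  qed
  then have "card (?A \<times> ?B) = card (Sigma ?C ?D)" by (rule bij_betw_same_card)
  moreover have "finite ?C" by (rule finite_subset[OF _ finite_hur_nnrm[of "m * n"]]) blast
  moreover have "finite (?D c)" for c by (rule finite_subset[OF _ finite_hur_nnrm[of m]]) blast
  ultimately show ?thesis by (simp add: card_cartesian_product)
qed

lemma card_coprime_mult:
  assumes "coprime m n" "m > 0" "n > 0"
    and P: "\<And>a b. a \<in> hur \<Longrightarrow> b \<in> hur \<Longrightarrow> nnrm a = m \<Longrightarrow> nnrm b = n \<Longrightarrow> P (a * b) \<longleftrightarrow> P a \<and> P b"
  shows "card {a \<in> hur. nnrm a = m \<and> P a} * card {b \<in> hur. nnrm b = n \<and> P b} =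
    card {c \<in> hur. nnrm c = m * n \<and> P c} * nunits"
proof -
  have "card {a \<in> hur. nnrm a = m \<and> P a} * card {b \<in> hur. nnrm b = n \<and> P b} =
      (\<Sum>c\<in>{c \<in> hur. nnrm c = m * n \<and> P c}. card {a \<in> hur. nnrm a = m \<and> (\<exists>b\<in>hur. c = a * b)})"
    by (rule card_product_fibers[OF assms(2,3)]) (rule P)
  then show ?thesis by (simp add: card_left_divisors_coprime[OF _ _ assms(1-3)])
qed

lemma cancel_unit_factors:
  fixes u :: nat
  assumes "(u * a) * (u * b) = (u * c) * u" "u > 0"
  shows "c = a * b"
proof -
  have "(u * u) * c = (u * u) * (a * b)" using assms(1) by (simp only: mult_ac)
  then show ?thesis using assms(2) unfolding mult_cancel1 by simp
qed

lemma left_ideal_number_mult: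
  assumes "coprime m n" "m > 0" "n > 0"
  shows "left_ideal_number (m * n) = left_ideal_number m * left_ideal_number n"
proof (rule cancel_unit_factors[OF _ nunits_pos])
  show "nunits * left_ideal_number m * (nunits * left_ideal_number n) = nunits * left_ideal_number (m * n) * nunits"
    using card_coprime_mult[OF assms, of "\<lambda>_. True"] assms unfolding simp_thms
    by (simp only: card_norm mult_pos_pos)
qed

text \<open>A prime q dividing \<open>a * b\<close> divides one of the norms, say that of
  \<open>a\<close>, and is coprime to the other. Multiplying \<open>a * b\<close> by
  \<open>qconj b\<close> shows that q divides \<open>a\<close> times the norm of \<open>b\<close>,
  and a Bezout relation removes the latter factor, so q divides \<open>a\<close>.\<close>

lemma prim_mult_iff:
  assumes "a \<in> hur" "b \<in> hur" "coprime (nnrm a) (nnrm b)" "nnrm a > 0" "nnrm b > 0"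
  shows "prim (a * b) \<longleftrightarrow> prim a \<and> prim b"
proof
  assume ab: "prim (a * b)"
  then have odd: "odd (nnrm a)" "odd (nnrm b)"
    using primD(3)[OF ab] assms by (simp_all add: nnrm_mult)
  have "m = 1" if "c \<in> hur" "a = of_nat m * c" for m c
    using that assms(2) by (intro primD(4)[OF ab, of "c * b"]) (simp_all add: hur_mult mult.assoc)
  moreover have "m = 1" if "c \<in> hur" "b = of_nat m * c" for m c
    using that assms(1) by (intro primD(4)[OF ab, of "a * c"]) (simp_all add: hur_mult of_nat_mult_commute)
  ultimately show "prim a \<and> prim b" unfolding prim_def using assms odd by blast
next
  assume prims: "prim a \<and> prim b"
  show "prim (a * b)"
    unfolding prim_def
  proof (intro conjI allI ballI impI)
    show "a * b \<in> hur" using assms by (simp add: hur_mult)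
    show "odd (nnrm (a * b))" using assms prims primD(3) by (simp add: nnrm_mult)
    fix m c assume c: "c \<in> hur" "a * b = of_nat m * c"
    show "m = 1"
    proof (rule ccontr)
      assume "m \<noteq> 1"
      then obtain q where q: "prime q" "q dvd m" using prime_factor_nat by blast
      then obtain k where k: "m = q * k" by blast
      define e where "e = of_nat k * c"
      have e: "e \<in> hur" "a * b = of_nat q * e"
        unfolding e_def using c by (simp_all add: hur_mult k mult.assoc)
      have comb: "\<exists>f\<in>hur. x = of_nat q * f" if "x \<in> hur" "coprime q n" "g \<in> hur" "of_nat n * x = of_nat q * g" for x n g
      proof -
        obtain s t where "s * int q + t * int n = gcd (int q) (int n)" using bezout_int by blast
        then have st: "s * int q + t * int n = 1" using that(2) by simp
        have "x = of_int (s * int q + t * int n) * x" unfolding st by simp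
        also have "\<dots> = of_nat q * (of_int s * x) + of_int t * (of_nat n * x)"
          by (simp add: distrib_right mult.assoc of_nat_mult_commute)
        also have "\<dots> = of_nat q * (of_int s * x + of_int t * g)"
          unfolding that(4) by (simp add: distrib_left of_nat_mult_commute)
        finally have "x = of_nat q * (of_int s * x + of_int t * g)" .
        moreover have "of_int s * x + of_int t * g \<in> hur" using that by (simp add: hur_add hur_mult)
        ultimately show ?thesis by blast
      qed
      have "q dvd nnrm a * nnrm b"
        using arg_cong[OF e(2), of nnrm] assms e(1) by (simp add: nnrm_mult power2_eq_square)
      then consider "q dvd nnrm a" | "q dvd nnrm b" using q(1) prime_dvd_mult_nat by blast
      then show False
      proof cases
        case 1
        then have cop: "coprime q (nnrm b)" by (rule coprime_divisors[OF _ dvd_refl assms(3)])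
        have "of_nat (nnrm b) * a = (a * b) * qconj b"
          unfolding mult.assoc mult_qconj_nnrm(1)[OF assms(2)] by (rule mult_of_nat_commute)
        also have "\<dots> = of_nat q * (e * qconj b)" unfolding e(2) by (rule mult.assoc)
        finally obtain f where "f \<in> hur" "a = of_nat q * f"
          using comb[OF assms(1) cop hur_mult[OF e(1) hur_conj[OF assms(2)]]] by blast
        then have "q = 1" using prims primD(4) by blast
        then show False using q(1) by simp
      next
        case 2
        then have cop: "coprime q (nnrm a)"
          using coprime_divisors[OF dvd_refl _ assms(3)] by (subst coprime_commute)
        have "of_nat (nnrm a) * b = qconj a * (a * b)"
          by (simp only: mult_qconj_nnrm(2)[OF assms(1)] flip: mult.assoc)
        also have "\<dots> = of_nat q * (qconj a * e)" unfolding e(2) by (rule of_nat_mult_commute)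
        finally obtain f where "f \<in> hur" "b = of_nat q * f"
          using comb[OF assms(2) cop hur_mult[OF hur_conj[OF assms(1)] e(1)]] by blast
        then have "q = 1" using prims primD(4) by blast
        then show False using q(1) by simp
      qed
    qed
  qed
qed

lemma prim_ideal_number_mult:
  assumes "coprime m n" "m > 0" "n > 0"
  shows "prim_ideal_number (m * n) = prim_ideal_number m * prim_ideal_number n"
proof -
  have "prim (a * b) \<longleftrightarrow> prim a \<and> prim b" if "a \<in> hur" "b \<in> hur" "nnrm a = m" "nnrm b = n" for a b
    by (rule prim_mult_iff[OF that(1,2)]) (simp_all only: that(3,4) assms)
  from card_coprime_mult[OF assms this]
  have "nunits * prim_ideal_number m * (nunits * prim_ideal_number n) = nunits * prim_ideal_number (m * n) * nunits"
    unfolding card_prim_norm[OF assms(2)] card_prim_norm[OF assms(3)]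
      card_prim_norm[OF mult_pos_pos[OF assms(2,3)]] .
  then show ?thesis by (rule cancel_unit_factors[OF _ nunits_pos])
qed

lemma prim_ideal_number_1: "prim_ideal_number 1 = 1"
proof -
  have "{x \<in> hur. nnrm x = 1 \<and> prim x} = hunits"
  proof -
    have "prim x" if "x \<in> hur" "nnrm x = 1" for x
    proof -
      have "m = 1" if "c \<in> hur" "x = of_nat m * c" for m c
      proof -
        have "nnrm x = m\<^sup>2 * nnrm c" unfolding that(2) using nnrm_mult[of "of_nat m" c] that(1) by simp
        then show ?thesis using \<open>nnrm x = 1\<close> by simp
      qed
      moreover have "odd (nnrm x)" using that(2) by simp
      ultimately show ?thesis unfolding prim_def using that(1) by blast
    qed
    then show ?thesis by blast
  qed
  then show ?thesis using card_prim_norm[of 1] nunits_pos unfolding nunits_def by (simp del: One_nat_def)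
qed

text \<open>By \<open>even_nnrm_lmult\<close>, multiplication by \<open>\<theta>\<close> reaches
  every element of even norm.\<close>

lemma left_ideal_number_double:
  assumes "n > 0"
  shows "left_ideal_number (2 * n) = left_ideal_number n"
proof -
  have "bij_betw ((*) \<theta>) {x \<in> hur. nnrm x = n} {x \<in> hur. nnrm x = 2 * n}"
    unfolding bij_betw_def
  proof
    have t0: "\<theta> \<noteq> 0" using normalizing_theta unfolding normalizing_def by blast
    then show "inj_on ((*) \<theta>) {x \<in> hur. nnrm x = n}" by (auto simp: inj_on_def)
    show "(*) \<theta> ` {x \<in> hur. nnrm x = n} = {x \<in> hur. nnrm x = 2 * n}"
    proof
      show "(*) \<theta> ` {x \<in> hur. nnrm x = n} \<subseteq> {x \<in> hur. nnrm x = 2 * n}"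
        by (auto simp: hur_mult nnrm_mult)
      show "{x \<in> hur. nnrm x = 2 * n} \<subseteq> (*) \<theta> ` {x \<in> hur. nnrm x = n}"
      proof clarify
        fix x assume x: "x \<in> hur" "nnrm x = 2 * n"
        then obtain y where y: "y \<in> hur" "x = \<theta> * y" using even_nnrm_lmult[of x] by auto
        then have "nnrm y = n" using x nnrm_mult[of \<theta> y] by simp
        then show "x \<in> (*) \<theta> ` {x \<in> hur. nnrm x = n}" using y by blast
      qed
    qed
  qed
  then have "card {x \<in> hur. nnrm x = n} = card {x \<in> hur. nnrm x = 2 * n}" by (rule bij_betw_same_card)
  then show ?thesis using nunits_pos assms by (simp add: card_norm)
qed

text \<open>The Hecke relation: an element of norm \<open>p n\<close> has \<open>nunits\<close> left divisors of norm
  \<open>p\<close> unless it is divisible by \<open>p\<close>, when every element of norm \<open>p\<close> is a left divisor.\<close>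

lemma left_ideal_number_hecke:
  assumes p: "prime p" and n: "n > 0"
  shows "left_ideal_number (p * n) + left_ideal_number p * (if p dvd n then left_ideal_number (n div p) else 0) =
    left_ideal_number p * left_ideal_number n + (if p dvd n then left_ideal_number (n div p) else 0)"
proof -
  define u where "u = nunits"
  have p0: "p > 0" using p prime_gt_0_nat by blast
  let ?C = "{c \<in> hur. nnrm c = p * n}"
  define D where "D = {c \<in> ?C. \<exists>c'\<in>hur. c = of_nat p * c'}"
  define f where "f c = card {a \<in> hur. nnrm a = p \<and> (\<exists>b\<in>hur. c = a * b)}" for c
  have fin: "finite ?C" by (rule finite_hur_nnrm)
  have fD: "f c = u * left_ideal_number p" if cD: "c \<in> D" for c
  proof -
    obtain c' where c': "c' \<in> hur" "c = of_nat p * c'" using cD unfolding D_def by blast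
    have "\<exists>b\<in>hur. c = a * b" if "a \<in> hur" "nnrm a = p" for a
      using that c' mult_qconj_nnrm(1)[OF that(1)] hur_conj hur_mult by (metis mult.assoc)
    then have "{a \<in> hur. nnrm a = p \<and> (\<exists>b\<in>hur. c = a * b)} = {a \<in> hur. nnrm a = p}" by blast
    then show ?thesis unfolding f_def u_def by (simp add: card_norm p0)
  qed
  have fCD: "f c = u" if "c \<in> ?C - D" for c
  proof -
    have c: "c \<in> hur" "nnrm c = p * n" and nd: "\<And>c'. c' \<in> hur \<Longrightarrow> c \<noteq> of_nat p * c'"
      using that unfolding D_def by auto
    obtain a x y c' m' where *: "a \<in> hur" "x \<in> hur" "y \<in> hur" "c' \<in> hur" "m' \<in> hur"
      "a = c * x + of_nat p * y" "c = a * c'" "of_nat p = a * m'"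
      using right_gcd[OF c(1) p0] by blast
    have sq: "nnrm a * nnrm m' = p\<^sup>2" using nnrm_mult[OF *(1,5)] *(8) by (metis nnrm_simps(3))
    have pa: "p dvd nnrm a"
      unfolding *(6) by (rule dvd_nnrm_add[OF hur_mult[OF c(1) *(2)] *(3)]) (simp add: nnrm_mult[OF c(1) *(2)] c(2))
    \<comment> \<open>If \<open>m'\<close> were a unit, \<open>a\<close> would be associated to
      \<open>p\<close> and \<open>p\<close> would divide \<open>c\<close>. So the norm of
      \<open>a\<close>, a multiple of \<open>p\<close> dividing p^2, is exactly
      \<open>p\<close>.\<close>
    have "nnrm m' \<noteq> 1"
    proof
      assume "nnrm m' = 1"
      then have "a = of_nat p * qconj m'"
        unfolding *(8) by (simp add: mult.assoc unit_inverse(1)[OF *(5)])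
      then have "c = of_nat p * (qconj m' * c')" using *(7) by (simp add: mult.assoc)
      then show False using nd *(4,5) hur_mult hur_conj by blast
    qed
    obtain k where k: "nnrm a = p * k" using pa by blast
    then have "k * nnrm m' = p" using sq p0 by (simp add: power2_eq_square)
    then have "k = 1" using p \<open>nnrm m' \<noteq> 1\<close> by (metis prime_product)
    then have "nnrm a = p" using k by simp
    then show ?thesis
      unfolding f_def u_def using card_left_divisors[OF c(1) p0 *(1) _ *(2,3,6,4,7)] by blast
  qed
  \<comment> \<open>\<open>D\<close> consists of \<open>p\<close> times the elements of norm n /
    p.\<close>
  have cD: "card D = u * (if p dvd n then left_ideal_number (n div p) else 0)"
  proof (cases "p dvd n")
    case True
    then obtain k where k: "n = p * k" by blast
    have k0: "k > 0" using n k by simp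
    have "bij_betw ((*) (of_nat p)) {x \<in> hur. nnrm x = k} D"
      unfolding bij_betw_def
    proof
      show "inj_on ((*) (of_nat p :: quat)) {x \<in> hur. nnrm x = k}" using p0 by (auto simp: inj_on_def)
      show "(*) (of_nat p) ` {x \<in> hur. nnrm x = k} = D"
        unfolding D_def using p0 k by (auto simp: hur_mult nnrm_mult power2_eq_square)
    qed
    then have "card D = card {x \<in> hur. nnrm x = k}" by (metis bij_betw_same_card)
    then show ?thesis using k k0 p0 by (simp add: card_norm u_def)
  next
    case False
    have "D = {}"
    proof (rule ccontr)
      assume "D \<noteq> {}"
      then obtain c' where c': "c' \<in> hur" "nnrm (of_nat p * c') = p * n" unfolding D_def by blast
      then have "p * (p * nnrm c') = p * n" by (auto simp: nnrm_mult power2_eq_square)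
      then have "p * nnrm c' = n" using p0 by simp
      then show False using False by auto
    qed
    then show ?thesis using False by simp
  qed
  have "(u * left_ideal_number p) * (u * left_ideal_number n) = (\<Sum>c\<in>?C. f c)"
    using card_product_fibers[OF p0 n, of "\<lambda>_. True"] unfolding f_def u_def
    by (simp add: card_norm p0 n)
  also have "\<dots> = (\<Sum>c\<in>?C - D. f c) + (\<Sum>c\<in>D. f c)"
    by (rule sum.subset_diff) (auto simp: D_def fin)
  also have "\<dots> = card (?C - D) * u + card D * (u * left_ideal_number p)"
    by (simp add: fD fCD)
  \<comment> \<open>Adding \<open>card D * u\<close> to both sides completes the count of
    \<open>?C\<close> and avoids subtraction of natural numbers.\<close>
  finally have "(u * left_ideal_number p) * (u * left_ideal_number n) + card D * u = (card (?C - D) + card D) * u + card D * (u * left_ideal_number p)"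
    by (simp add: algebra_simps)
  also have "card (?C - D) + card D = card ?C"
  proof -
    have sub: "D \<subseteq> ?C" unfolding D_def by blast
    show ?thesis
      using card_Diff_subset[OF finite_subset[OF sub fin] sub] card_mono[OF fin sub] by simp
  qed
  also have "card ?C = u * left_ideal_number (p * n)" using p0 n by (simp add: card_norm u_def)
  finally have "u * u * (left_ideal_number p * left_ideal_number n + (if p dvd n then left_ideal_number (n div p) else 0))
    = u * u * (left_ideal_number (p * n) + left_ideal_number p * (if p dvd n then left_ideal_number (n div p) else 0))"
    unfolding cD by (simp add: algebra_simps)
  moreover have "u * u > 0" using nunits_pos unfolding u_def by simp
  ultimately show ?thesis by (metis mult_left_cancel less_numeral_extra(3))
qed

section \<open>Left ideals of prime norm\<close>

text \<open>Doubled coordinates as integers; the floor is exact on \<open>hur\<close> only.\<close>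

definition dbl0 :: "quat \<Rightarrow> int" where "dbl0 x = \<lfloor>2 * qa x\<rfloor>"
definition dbl1 :: "quat \<Rightarrow> int" where "dbl1 x = \<lfloor>2 * qb x\<rfloor>"
definition dbl2 :: "quat \<Rightarrow> int" where "dbl2 x = \<lfloor>2 * qc x\<rfloor>"
definition dbl3 :: "quat \<Rightarrow> int" where "dbl3 x = \<lfloor>2 * qd x\<rfloor>"

lemma of_int_dbl:
  assumes "x \<in> hur"
  shows "real_of_int (dbl0 x) = 2 * qa x" "real_of_int (dbl1 x) = 2 * qb x"
    "real_of_int (dbl2 x) = 2 * qc x" "real_of_int (dbl3 x) = 2 * qd x"
proof -
  obtain A b c d :: int where x: "x = Quat (A/2) (A/2+b) (A/2+c) (A/2+d)"
    using assms by (rule hurE)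
  have "2 * qa x = of_int A" "2 * qb x = of_int (A + 2 * b)" "2 * qc x = of_int (A + 2 * c)" "2 * qd x = of_int (A + 2 * d)"
    by (simp_all add: x)
  then show "real_of_int (dbl0 x) = 2 * qa x" "real_of_int (dbl1 x) = 2 * qb x"
    "real_of_int (dbl2 x) = 2 * qc x" "real_of_int (dbl3 x) = 2 * qd x"
    unfolding dbl0_def dbl1_def dbl2_def dbl3_def by (simp_all only: floor_of_int)
qed

lemma of_int_real_eqD: "real_of_int a = real_of_int b \<Longrightarrow> a = b"
  by simp

lemma dbl_diff:
  assumes "x \<in> hur" "y \<in> hur"
  shows "dbl0 (x - y) = dbl0 x - dbl0 y" "dbl1 (x - y) = dbl1 x - dbl1 y"
    "dbl2 (x - y) = dbl2 x - dbl2 y" "dbl3 (x - y) = dbl3 x - dbl3 y"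
  by (rule of_int_real_eqD, use assms in \<open>simp add: of_int_dbl hur_diff algebra_simps\<close>)+

lemma dbl_mult:
  assumes "x \<in> hur" "y \<in> hur"
  shows "2 * dbl0 (x * y) = dbl0 x * dbl0 y - dbl1 x * dbl1 y - dbl2 x * dbl2 y - dbl3 x * dbl3 y"
    "2 * dbl1 (x * y) = dbl0 x * dbl1 y + dbl1 x * dbl0 y + dbl2 x * dbl3 y - dbl3 x * dbl2 y"
    "2 * dbl2 (x * y) = dbl0 x * dbl2 y - dbl1 x * dbl3 y + dbl2 x * dbl0 y + dbl3 x * dbl1 y"
    "2 * dbl3 (x * y) = dbl0 x * dbl3 y + dbl1 x * dbl2 y - dbl2 x * dbl1 y + dbl3 x * dbl0 y"
  by (rule of_int_real_eqD, use assms in \<open>simp add: of_int_dbl hur_mult algebra_simps\<close>)+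

lemma dbl_of_nat [simp]: "dbl0 (of_nat n) = 2 * int n" "dbl1 (of_nat n) = 0" "dbl2 (of_nat n) = 0" "dbl3 (of_nat n) = 0"
  unfolding dbl0_def dbl1_def dbl2_def dbl3_def by (simp_all, linarith)

lemma dbl_of_nat_mult:
  assumes "y \<in> hur"
  shows "dbl0 (of_nat n * y) = int n * dbl0 y" "dbl1 (of_nat n * y) = int n * dbl1 y"
    "dbl2 (of_nat n * y) = int n * dbl2 y" "dbl3 (of_nat n * y) = int n * dbl3 y"
  using dbl_mult[of "of_nat n" y] assms by simp_all

lemma odd_dvd_hur:
  assumes x: "x \<in> hur" and "odd p" and "int p dvd dbl0 x" "int p dvd dbl1 x" "int p dvd dbl2 x" "int p dvd dbl3 x"
  obtains y where "y \<in> hur" "x = of_nat p * y"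
proof -
  obtain A b c d :: int where xx: "x = Quat (A/2) (A/2+b) (A/2+c) (A/2+d)"
    using x by (rule hurE)
  have "dbl0 x = A" "dbl1 x = A + 2 * b" "dbl2 x = A + 2 * c" "dbl3 x = A + 2 * d"
    by (rule of_int_real_eqD, simp add: of_int_dbl[OF x], simp add: xx)+
  then have A: "int p dvd A" and *: "int p dvd A + 2 * b" "int p dvd A + 2 * c" "int p dvd A + 2 * d"
    using assms by simp_all
  have "int p dvd z" if "int p dvd A + 2 * z" for z
  proof -
    have "int p dvd 2 * z" using dvd_diff[OF that A] by simp
    then show ?thesis
      using \<open>odd p\<close> by (metis coprime_dvd_mult_right_iff coprime_right_2_iff_odd even_of_nat)
  qed
  then have "int p dvd b" "int p dvd c" "int p dvd d" using * by blast+
  with A obtain A' b' c' d' where "A = int p * A'" "b = int p * b'" "c = int p * c'" "d = int p * d'"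
    by (auto elim!: dvdE)
  then have "x = of_nat p * Quat (of_int A'/2) (of_int A'/2 + of_int b') (of_int A'/2 + of_int c') (of_int A'/2 + of_int d')"
    by (intro quat_eqI) (simp add: xx algebra_simps)
  then show ?thesis using that hurI by blast
qed

lemma lid_subset_eq:
  assumes "b \<in> hur" "b' \<in> hur" "b \<noteq> 0" "lid b \<subseteq> lid b'" "nnrm b = nnrm b'"
  shows "lid b = lid b'"
proof -
  have "b \<in> lid b'" using assms(4) lid_self by blast
  then obtain z where z: "z \<in> hur" "b = z * b'" unfolding lid_def by blast
  have "nnrm b = nnrm z * nnrm b'" unfolding z(2) by (rule nnrm_mult[OF z(1) assms(2)])
  then have nz: "nnrm z = 1" using assms(5) nnrm_pos[OF assms(1,3)] by simp
  have "b' = qconj z * b" unfolding z(2) using unit_inverse(2)[OF z(1) nz] by (simp flip: mult.assoc)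
  then have "b' \<in> lid b" using hur_conj[OF z(1)] unfolding lid_def by blast
  then show ?thesis using assms(4) lid_subset_iff by blast
qed

text \<open>For an odd prime \<open>p\<close> and \<open>u\<^sup>2 + v\<^sup>2 \<equiv> -1\<close>, the quaternions act on pairs of integers modulo
  \<open>p\<close> via \<open>i \<mapsto> [[0, -1], [1, 0]]\<close> and \<open>j \<mapsto> [[u, v], [v, -u]]\<close>. Applied to the doubled coordinates,
  the two rows of this action are \<open>row1\<close> and \<open>row2\<close>. The left ideals of norm \<open>p\<close> are the
  annihilators of the points of the projective line.\<close>

locale split_prime =
  fixes p :: nat and u v :: int
  assumes p: "prime p" "odd p" and uv: "int p dvd u * u + v * v + 1"
begin

definition row1 :: "quat \<Rightarrow> int \<Rightarrow> int \<Rightarrow> int" where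
  "row1 x s t = (dbl0 x + u * dbl2 x - v * dbl3 x) * s + (- dbl1 x + v * dbl2 x + u * dbl3 x) * t"

definition row2 :: "quat \<Rightarrow> int \<Rightarrow> int \<Rightarrow> int" where
  "row2 x s t = (dbl1 x + v * dbl2 x + u * dbl3 x) * s + (dbl0 x - u * dbl2 x + v * dbl3 x) * t"

definition Ann :: "int \<Rightarrow> int \<Rightarrow> quat set" where
  "Ann s t = {x \<in> hur. int p dvd row1 x s t \<and> int p dvd row2 x s t}"

lemma p_pos: "p > 0" and p_gt_1: "p > 1"
  using prime_gt_0_nat[OF p(1)] prime_gt_1_nat[OF p(1)] by simp_all

lemma prime_int_p: "prime (int p)"
  using p(1) by simp

lemma dvd_two_mult: "int p dvd 2 * z \<Longrightarrow> int p dvd z"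
  using p(2) by (metis coprime_dvd_mult_right_iff coprime_right_2_iff_odd even_of_nat)

text \<open>The matrix of j squares to u^2 + v^2 instead of -1, which causes the error terms with
  factor u^2 + v^2 + 1. The factor 2 arises because a product of two doubled elements is twice the
  doubled product.\<close>

lemma row_mult:
  assumes "a \<in> hur" "x \<in> hur"
  shows "row1 a (row1 x s t) (row2 x s t) = 2 * row1 (a * x) s t +
      (u * u + v * v + 1) * ((dbl2 a * dbl2 x + dbl3 a * dbl3 x) * s + (dbl2 a * dbl3 x - dbl3 a * dbl2 x) * t)"
    "row2 a (row1 x s t) (row2 x s t) = 2 * row2 (a * x) s t +
      (u * u + v * v + 1) * ((dbl2 a * dbl2 x + dbl3 a * dbl3 x) * t - (dbl2 a * dbl3 x - dbl3 a * dbl2 x) * s)"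
proof -
  have 1: "2 * row1 (a * x) s t = (2 * dbl0 (a*x) + u * (2 * dbl2 (a*x)) - v * (2 * dbl3 (a*x))) * s
      + (- (2 * dbl1 (a*x)) + v * (2 * dbl2 (a*x)) + u * (2 * dbl3 (a*x))) * t"
    unfolding row1_def by (simp add: algebra_simps)
  show "row1 a (row1 x s t) (row2 x s t) = 2 * row1 (a * x) s t +
      (u * u + v * v + 1) * ((dbl2 a * dbl2 x + dbl3 a * dbl3 x) * s + (dbl2 a * dbl3 x - dbl3 a * dbl2 x) * t)"
    unfolding 1 dbl_mult[OF assms] unfolding row1_def row2_def by (simp add: algebra_simps)
  have 2: "2 * row2 (a * x) s t = (2 * dbl1 (a*x) + v * (2 * dbl2 (a*x)) + u * (2 * dbl3 (a*x))) * s
      + (2 * dbl0 (a*x) - u * (2 * dbl2 (a*x)) + v * (2 * dbl3 (a*x))) * t"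
    unfolding row2_def by (simp add: algebra_simps)
  show "row2 a (row1 x s t) (row2 x s t) = 2 * row2 (a * x) s t +
      (u * u + v * v + 1) * ((dbl2 a * dbl2 x + dbl3 a * dbl3 x) * t - (dbl2 a * dbl3 x - dbl3 a * dbl2 x) * s)"
    unfolding 2 dbl_mult[OF assms] unfolding row1_def row2_def by (simp add: algebra_simps)
qed

lemma row_linear:
  "row1 x (s + s') (t + t') = row1 x s t + row1 x s' t'" "row2 x (s + s') (t + t') = row2 x s t + row2 x s' t'"
  "row1 x (k * s) (k * t) = k * row1 x s t" "row2 x (k * s) (k * t) = k * row2 x s t"
  unfolding row1_def row2_def by (simp_all add: algebra_simps)

lemma row_dvd: "int p dvd s \<Longrightarrow> int p dvd t \<Longrightarrow> int p dvd row1 x s t \<and> int p dvd row2 x s t"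
  unfolding row1_def row2_def by (simp add: dvd_add)

lemma left_ideal_Ann: "left_ideal (Ann s t)"
  unfolding left_ideal_def
proof (intro conjI ballI)
  show "Ann s t \<subseteq> hur" "0 \<in> Ann s t"
    unfolding Ann_def row1_def row2_def using dbl_of_nat[of 0] by auto
  fix x assume x: "x \<in> Ann s t"
  then have hx: "x \<in> hur" "int p dvd row1 x s t" "int p dvd row2 x s t" unfolding Ann_def by auto
  { fix y assume "y \<in> Ann s t"
    then have hy: "y \<in> hur" "int p dvd row1 y s t" "int p dvd row2 y s t" unfolding Ann_def by auto
    have "row1 (x - y) s t = row1 x s t - row1 y s t" "row2 (x - y) s t = row2 x s t - row2 y s t"
      unfolding row1_def row2_def by (simp_all add: dbl_diff hx hy algebra_simps)
    then show "x - y \<in> Ann s t" using hx hy by (simp add: Ann_def hur_diff) }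
  { fix a assume a: "a \<in> hur"
    have w: "int p dvd (u * u + v * v + 1) * k" for k using uv by (rule dvd_mult2)
    have r: "int p dvd 2 * row1 (a * x) s t \<and> int p dvd 2 * row2 (a * x) s t"
      using row_dvd[OF hx(2,3), of a] unfolding row_mult[OF a hx(1), of s t] dvd_add_left_iff[OF w] .
    show "a * x \<in> Ann s t"
      unfolding Ann_def using hur_mult[OF a hx(1)] dvd_two_mult[OF conjunct1[OF r]] dvd_two_mult[OF conjunct2[OF r]]
      by simp }
qed

text \<open>Modulo \<open>p\<close> this element acts as the matrix [[2t, -2s], [0, 0]], which kills
  the vector (s, t); its coordinates come from solving for that matrix.\<close>

definition kelt :: "int \<Rightarrow> int \<Rightarrow> quat" where
  "kelt s t = Quat (of_int t) (of_int s) (of_int (v * s - u * t)) (of_int (v * t + u * s))"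

lemma kelt: "kelt s t \<in> hur"
  "dbl0 (kelt s t) = 2 * t" "dbl1 (kelt s t) = 2 * s" "dbl2 (kelt s t) = 2 * (v * s - u * t)" "dbl3 (kelt s t) = 2 * (v * t + u * s)"
proof -
  show h: "kelt s t \<in> hur" unfolding kelt_def
    by (rule lip_hur, rule lipI[of _ t s "v * s - u * t" "v * t + u * s"]) simp
  show "dbl0 (kelt s t) = 2 * t" "dbl1 (kelt s t) = 2 * s" "dbl2 (kelt s t) = 2 * (v * s - u * t)" "dbl3 (kelt s t) = 2 * (v * t + u * s)"
    by (rule of_int_real_eqD, simp add: of_int_dbl[OF h], simp add: kelt_def)+
qed

lemma row_kelt:
  "row1 (kelt s t) s' t' = 4 * (t * s' - s * t') + (u * u + v * v + 1) * (2 * (s * t' - t * s'))"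
  "row2 (kelt s t) s' t' = (u * u + v * v + 1) * (2 * (s * s' + t * t'))"
  unfolding row1_def row2_def kelt by (simp_all add: algebra_simps)

lemma kelt_Ann: "kelt s t \<in> Ann s t"
proof -
  have "row1 (kelt s t) s t = 0" unfolding row_kelt by (simp add: mult.commute)
  moreover have "int p dvd row2 (kelt s t) s t" unfolding row_kelt using uv by (rule dvd_mult2)
  ultimately show ?thesis unfolding Ann_def using kelt(1) by simp
qed

text \<open>\<open>p\<close> lies in the ideal, so the norm of a generator divides p^2. It is not 1,
  since 1 does not annihilate a nonzero vector, and not p^2, since then every element would be
  divisible by \<open>p\<close>, whereas \<open>kelt s t\<close> is not.\<close>

lemma Ann_principal:
  assumes "\<not> (int p dvd s \<and> int p dvd t)"
  shows "Ann s t \<in> left_ideals" "lnorm (Ann s t) = p"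
proof -
  have p_mem: "of_nat p \<in> Ann s t" unfolding Ann_def row1_def row2_def by simp
  then have "Ann s t \<noteq> {0}" using p_pos by force
  then obtain b where b: "b \<in> hur" "b \<noteq> 0" "Ann s t = lid b"
    using left_ideal_principal[OF left_ideal_Ann] by blast
  show "Ann s t \<in> left_ideals" unfolding b(3) using b by (intro lid_left_ideals)
  obtain c where c: "c \<in> hur" "of_nat p = c * b" using p_mem unfolding b(3) lid_def by blast
  have np: "nnrm c * nnrm b = p * p"
    using nnrm_mult[OF c(1) b(1)] unfolding c(2)[symmetric] by (simp add: power2_eq_square)
  have nb: "nnrm b \<noteq> 1"
  proof
    assume "nnrm b = 1"
    then have "1 = qconj b * b" using unit_inverse(2)[OF b(1)] by simp
    then have "1 \<in> Ann s t" unfolding b(3) lid_def using hur_conj[OF b(1)] by blast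
    then have "int p dvd 2 * s" "int p dvd 2 * t"
      unfolding Ann_def row1_def row2_def using dbl_of_nat[of 1] by simp_all
    then show False using assms dvd_two_mult by blast
  qed
  have nc: "nnrm c \<noteq> 1"
  proof
    assume n: "nnrm c = 1"
    have "b = qconj c * of_nat p" unfolding c(2) using unit_inverse(2)[OF c(1) n] by (simp flip: mult.assoc)
    moreover obtain z where z: "z \<in> hur" "kelt s t = z * b" using kelt_Ann[of s t] unfolding b(3) lid_def by blast
    ultimately have "kelt s t = (z * qconj c) * of_nat p" by (simp add: mult.assoc)
    then have "kelt s t = of_nat p * (z * qconj c)" by (metis mult_of_nat_commute)
    moreover have "z * qconj c \<in> hur" using z c by (simp add: hur_mult hur_conj)
    ultimately have "int p dvd dbl0 (kelt s t)" "int p dvd dbl1 (kelt s t)" by (simp_all add: dbl_of_nat_mult)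
    then show False using assms dvd_two_mult unfolding kelt by blast
  qed
  have "nnrm b dvd p ^ 2" using np by (metis dvd_triv_right power2_eq_square)
  then obtain i where i: "i \<le> 2" "nnrm b = p ^ i" using p(1) by (auto simp: divides_primepow_nat)
  have "i \<noteq> 0" using nb i by (metis power_0)
  moreover have "i \<noteq> 2" using nc np i p_pos by (auto simp: power2_eq_square)
  ultimately have "i = 1" using i(1) by linarith
  then show "lnorm (Ann s t) = p" unfolding b(3) lnorm_lid[OF b(1,2)] using i by simp
qed

text \<open>\<open>kelt s t\<close> annihilates (s', t') only if the determinant of the two vectors
  vanishes modulo \<open>p\<close>; this separates projective points.\<close>

lemma Ann_eq_dvd: "Ann s t = Ann s' t' \<Longrightarrow> int p dvd t * s' - s * t'"
proof -
  assume "Ann s t = Ann s' t'"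
  then have "kelt s t \<in> Ann s' t'" using kelt_Ann by blast
  then have "int p dvd row1 (kelt s t) s' t'" unfolding Ann_def by blast
  then have "int p dvd 4 * (t * s' - s * t')"
    unfolding row_kelt dvd_add_left_iff[OF dvd_mult2[OF uv]] .
  then have "int p dvd 2 * (2 * (t * s' - s * t'))" by (simp add: algebra_simps)
  then show ?thesis using dvd_two_mult by blast
qed

text \<open>For a generator a, the product of a and its conjugate is \<open>p\<close>, so a
  annihilates the image of the conjugate. This image is nonzero modulo \<open>p\<close>, as
  otherwise \<open>p\<close> would divide the conjugate, whose norm is only \<open>p\<close>. Equal
  norms turn the inclusion of ideals into equality.\<close>

lemma left_ideals_prime_Ann:
  assumes "B \<in> left_ideals" "lnorm B = p"
  obtains s t where "\<not> (int p dvd s \<and> int p dvd t)" "B = Ann s t"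
proof -
  define a where "a = lgen B"
  have a: "a \<in> hur" "a \<noteq> 0" "lid a = B" "nnrm a = p"
    using lgen[OF assms(1)] assms(2) unfolding a_def lnorm_def by auto
  have ca: "qconj a \<in> hur" using a(1) by (rule hur_conj)
  have col: "a \<in> Ann (row1 (qconj a) s t) (row2 (qconj a) s t)" for s t
  proof -
    have "row1 (a * qconj a) s t = int p * (2 * s)" "row2 (a * qconj a) s t = int p * (2 * t)"
      unfolding mult_qconj_nnrm(1)[OF a(1)] a(4) row1_def row2_def by simp_all
    then have "int p dvd row1 a (row1 (qconj a) s t) (row2 (qconj a) s t)"
      "int p dvd row2 a (row1 (qconj a) s t) (row2 (qconj a) s t)"
      unfolding row_mult[OF a(1) ca] by (intro dvd_add dvd_mult2[OF uv]; simp)+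
    then show ?thesis unfolding Ann_def using a(1) by blast
  qed
  have "\<exists>s t. \<not> (int p dvd row1 (qconj a) s t \<and> int p dvd row2 (qconj a) s t)"
  proof (rule ccontr)
    assume "\<not> ?thesis"
    then have dv: "int p dvd row1 (qconj a) s t" "int p dvd row2 (qconj a) s t" for s t by blast+
    define X0 X1 X2 X3 where X: "X0 = dbl0 (qconj a)" "X1 = dbl1 (qconj a)" "X2 = dbl2 (qconj a)" "X3 = dbl3 (qconj a)"
    have e: "int p dvd X0 + u * X2 - v * X3" "int p dvd - X1 + v * X2 + u * X3" "int p dvd X1 + v * X2 + u * X3" "int p dvd X0 - u * X2 + v * X3"
      using dv[of 1 0] dv[of 0 1] unfolding row1_def row2_def X by simp_all
    have "int p dvd 2 * X0" using dvd_add[OF e(1) e(4)] by (simp add: algebra_simps)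
    then have x0: "int p dvd X0" by (rule dvd_two_mult)
    have "int p dvd 2 * X1" using dvd_diff[OF e(3) e(2)] by (simp add: algebra_simps)
    then have x1: "int p dvd X1" by (rule dvd_two_mult)
    have f: "int p dvd u * X2 - v * X3" "int p dvd v * X2 + u * X3"
      using dvd_diff[OF e(1) x0] dvd_diff[OF e(3) x1] by (simp_all add: algebra_simps)
    \<comment> \<open>The matrix [[u, -v], [v, u]] has determinant u^2 + v^2, which is -1 modulo
      \<open>p\<close>; the identities spell out its inverse.\<close>
    have "X2 = (u * u + v * v + 1) * X2 - u * (u * X2 - v * X3) - v * (v * X2 + u * X3)"
      "X3 = (u * u + v * v + 1) * X3 - u * (v * X2 + u * X3) + v * (u * X2 - v * X3)"
      by (simp_all add: algebra_simps)
    moreover have "int p dvd (u * u + v * v + 1) * X2 - u * (u * X2 - v * X3) - v * (v * X2 + u * X3)"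
      "int p dvd (u * u + v * v + 1) * X3 - u * (v * X2 + u * X3) + v * (u * X2 - v * X3)"
      using uv f by (intro dvd_add dvd_diff; simp)+
    ultimately have "int p dvd X2" "int p dvd X3" by metis+
    then obtain y where y: "y \<in> hur" "qconj a = of_nat p * y"
      using odd_dvd_hur[OF ca p(2)] x0 x1 unfolding X by blast
    have "nnrm (qconj a) = p\<^sup>2 * nnrm y" unfolding y(2) using nnrm_mult[of "of_nat p" y] y(1) by simp
    then have "p * 1 = p * (p * nnrm y)" using a(4) by (simp add: power2_eq_square)
    then have "p * nnrm y = 1" using p_pos by simp
    then show False using p_gt_1 by simp
  qed
  then obtain s t where st: "\<not> (int p dvd row1 (qconj a) s t \<and> int p dvd row2 (qconj a) s t)" by blast
  let ?A = "Ann (row1 (qconj a) s t) (row2 (qconj a) s t)"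
  note A = Ann_principal[OF st]
  have "a \<in> lid (lgen ?A)" using col lgen(3)[OF A(1)] by simp
  then have "lid a \<subseteq> lid (lgen ?A)" using lid_subset_iff by blast
  then have "lid a = lid (lgen ?A)"
    using A(2) a(4) by (intro lid_subset_eq[OF a(1) lgen(1)[OF A(1)] a(2)]) (simp_all add: lnorm_def)
  then have "B = ?A" using a(3) lgen(3)[OF A(1)] by simp
  then show ?thesis using that st by blast
qed

text \<open>Linearity in the vector gives an inclusion, and both ideals have norm \<open>p\<close>.
  So the ideal depends only on the projective point.\<close>

lemma Ann_scale:
  assumes "\<not> (int p dvd s \<and> int p dvd t)" "\<not> (int p dvd s' \<and> int p dvd t')"
    "int p dvd s' - k * s" "int p dvd t' - k * t"
  shows "Ann s t = Ann s' t'"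
proof -
  note A = Ann_principal[OF assms(1)] and A' = Ann_principal[OF assms(2)]
  have "Ann s t \<subseteq> Ann s' t'"
  proof
    fix x assume x: "x \<in> Ann s t"
    have "row1 x s' t' = k * row1 x s t + row1 x (s' - k * s) (t' - k * t)"
      "row2 x s' t' = k * row2 x s t + row2 x (s' - k * s) (t' - k * t)"
      unfolding row_linear(3,4)[symmetric] row_linear(1,2)[symmetric] by simp_all
    then show "x \<in> Ann s' t'" using x row_dvd[OF assms(3,4), of x] unfolding Ann_def by (simp add: dvd_add)
  qed
  then have "lid (lgen (Ann s t)) \<subseteq> lid (lgen (Ann s' t'))" using lgen(3) A A' by simp
  then have "lid (lgen (Ann s t)) = lid (lgen (Ann s' t'))"
    using lid_subset_eq[OF lgen(1)[OF A(1)] lgen(1)[OF A'(1)] lgen(2)[OF A(1)]] A(2) A'(2) unfolding lnorm_def by simp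
  then show ?thesis using lgen(3) A A' by simp
qed

lemma inverse_mod_p:
  assumes "\<not> int p dvd s"
  obtains k where "int p dvd 1 - k * s"
proof -
  have "coprime s (int p)" using assms prime_int_p by (metis coprime_commute prime_imp_coprime)
  then obtain k l where "k * s + l * int p = 1" using bezout_int[of s "int p"] by auto
  then have "1 - k * s = int p * l" by (simp add: algebra_simps)
  then have "int p dvd 1 - k * s" by (rule dvdI)
  then show ?thesis by (rule that)
qed

lemma left_ideal_number_split_prime: "left_ideal_number p = p + 1"
proof -
  \<comment> \<open>\<open>j < p\<close> stands for the affine point (1 : j) and
    \<open>j = p\<close> for the point at infinity (0 : 1).\<close>
  define f where "f j = (if j = p then Ann 0 1 else Ann 1 (int j))" for j
  have n1: "\<not> int p dvd 1" using p_gt_1 by simp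
  have "bij_betw f {0..p} {B \<in> left_ideals. lnorm B = p}"
    unfolding bij_betw_def
  proof
    show "inj_on f {0..p}"
    proof (rule inj_onI)
      fix j l assume jl: "j \<in> {0..p}" "l \<in> {0..p}" and eq: "f j = f l"
      show "j = l"
      proof (cases "j = p \<or> l = p")
        case True
        then show ?thesis
          using eq n1 Ann_eq_dvd[of 0 1 1 "int l"] Ann_eq_dvd[of 0 1 1 "int j"]
          by (auto simp: f_def split: if_splits)
      next
        case False
        then have "int p dvd int j - int l" using eq Ann_eq_dvd[of 1 "int j" 1 "int l"] by (simp add: f_def)
        then have "int j mod int p = int l mod int p" by (simp add: mod_eq_dvd_iff)
        then show ?thesis using False jl by simp
      qed
    qed
    show "f ` {0..p} = {B \<in> left_ideals. lnorm B = p}"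
    proof
      show "f ` {0..p} \<subseteq> {B \<in> left_ideals. lnorm B = p}"
        using Ann_principal[of 0 1] Ann_principal[of 1] n1 by (auto simp: f_def)
      show "{B \<in> left_ideals. lnorm B = p} \<subseteq> f ` {0..p}"
      proof clarify
        fix B assume "B \<in> left_ideals" "p = lnorm B"
        then obtain s t where st: "\<not> (int p dvd s \<and> int p dvd t)" "B = Ann s t" using left_ideals_prime_Ann by metis
        have "B \<in> f ` {0..p}"
        proof (cases "int p dvd s")
          case True
          then have "\<not> int p dvd t" using st by blast
          then obtain k where "int p dvd 1 - k * t" by (rule inverse_mod_p)
          then have "Ann s t = Ann 0 1" using st n1 True by (intro Ann_scale[of _ _ _ _ k]) auto
          then show ?thesis using st by (intro image_eqI[of _ _ p]) (simp_all add: f_def)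
        next
          case False
          then obtain k where k: "int p dvd 1 - k * s" by (rule inverse_mod_p)
          define j where "j = nat (k * t mod int p)"
          have j: "int j = k * t mod int p" "j < p"
            unfolding j_def using p_pos by (simp_all add: nat_less_iff)
          have "int p dvd int j - k * t" unfolding j(1) by (simp flip: mod_eq_dvd_iff)
          then have "Ann s t = Ann 1 (int j)" using st n1 k by (intro Ann_scale[of _ _ _ _ k]) auto
          then show ?thesis using st j(2) by (intro image_eqI[of _ _ j]) (simp_all add: f_def)
        qed
        then show "B \<in> f ` {0..lnorm B}" using \<open>p = lnorm B\<close> by simp
      qed
    qed
  qed
  from bij_betw_same_card[OF this] show ?thesis unfolding left_ideal_number_def by simp
qed

end

text \<open>Pigeonhole: with p = 2k + 1 and x, y from 0 to k, both x^2 and -1 - y^2 take k + 1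
  values modulo \<open>p\<close>, together more than \<open>p\<close>.\<close>

lemma minus_one_sum_two_squares:
  assumes "prime p" "odd p"
  obtains u v :: int where "int p dvd u * u + v * v + 1"
proof -
  define k where "k = (p - 1) div 2"
  have k: "p = 2 * k + 1" unfolding k_def using assms(2) by (auto elim: oddE)
  define f where "f x = (int x * int x) mod int p" for x
  define g where "g x = (- 1 - int x * int x) mod int p" for x
  have p0: "int p > 0" using assms(1) prime_gt_0_nat by simp
  have main: "x = y" if xy: "x \<le> k" "y \<le> k" and d: "int p dvd int x * int x - int y * int y" for x y
  proof -
    have "int p dvd (int x - int y) * (int x + int y)" using d by (simp add: algebra_simps)
    then have "int p dvd int x - int y \<or> int p dvd int x + int y"
      using assms(1) prime_dvd_mult_iff by (metis prime_nat_int_transfer)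
    then show "x = y"
    proof
      assume "int p dvd int x - int y"
      then have "\<bar>int x - int y\<bar> < int p \<Longrightarrow> int x - int y = 0" using zdvd_not_zless by (metis abs_dvd_iff dvd_abs_iff abs_eq_0 zero_less_abs_iff)
      moreover have "\<bar>int x - int y\<bar> < int p" using xy k by linarith
      ultimately show ?thesis by simp
    next
      assume d: "int p dvd int x + int y"
      have "int x + int y < int p" using xy k by linarith
      then have "int x + int y = 0" using d zdvd_not_zless[of "int x + int y" "int p"] by force
      then show ?thesis by simp
    qed
  qed
  have inj: "inj_on f {0..k}" "inj_on g {0..k}"
  proof -
    show "inj_on f {0..k}"
      by (rule inj_onI, rule main) (simp_all add: f_def mod_eq_dvd_iff)
    show "inj_on g {0..k}"
    proof (rule inj_onI)
      fix x y assume "x \<in> {0..k}" "y \<in> {0..k}" "g x = g y"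
      then have "x \<le> k" "y \<le> k" "int p dvd int y * int y - int x * int x"
        by (simp_all add: g_def mod_eq_dvd_iff)
      then show "x = y" using main[of y x] by simp
    qed
  qed
  have sub: "f ` {0..k} \<union> g ` {0..k} \<subseteq> {0..<int p}" using p0 by (auto simp: f_def g_def)
  have "f ` {0..k} \<inter> g ` {0..k} \<noteq> {}"
  proof
    assume "f ` {0..k} \<inter> g ` {0..k} = {}"
    then have "card (f ` {0..k} \<union> g ` {0..k}) = (k + 1) + (k + 1)"
      using inj by (subst card_Un_disjoint) (simp_all add: card_image)
    moreover have "card (f ` {0..k} \<union> g ` {0..k}) \<le> p" using card_mono[OF _ sub] by simp
    ultimately show False using k by simp
  qed
  then obtain x y where "f x = g y" by auto
  then have "int p dvd int x * int x - (- 1 - int y * int y)" by (simp add: f_def g_def mod_eq_dvd_iff)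
  then show ?thesis using that[of "int x" "int y"] by (simp add: algebra_simps)
qed

lemma left_ideal_number_prime:
  assumes "prime p" "odd p"
  shows "left_ideal_number p = p + 1"
proof -
  obtain u v :: int where "int p dvd u * u + v * v + 1" using minus_one_sum_two_squares[OF assms] .
  with assms interpret split_prime p u v by unfold_locales
  show ?thesis by (rule left_ideal_number_split_prime)
qed

section \<open>The number of left ideals of given norm\<close>

lemma dvd_div_pos: "d dvd n \<Longrightarrow> n > 0 \<Longrightarrow> n div d > 0" for d n :: nat
  by (auto elim!: dvdE)

lemma div_div_cancel: "d dvd n \<Longrightarrow> n > 0 \<Longrightarrow> n div (n div d) = d" for d n :: nat
  by (auto elim!: dvdE)

lemma div_dvd_self: "d dvd n \<Longrightarrow> n div d dvd n" for d n :: nat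
  by (metis dvd_div_mult_self dvd_triv_left)

definition odd_divisor_sum :: "nat \<Rightarrow> nat" where
  "odd_divisor_sum n = (\<Sum>d | d dvd n \<and> odd d. d)"

text \<open>The odd divisors of p n are those of n and their p-fold multiples. The overlap consists
  of the p-fold odd divisors of n / p, or is empty.\<close>

lemma odd_divisor_sum_hecke:
  assumes p: "prime p" "odd p" and n: "n > 0"
  shows "odd_divisor_sum (p * n) + p * (if p dvd n then odd_divisor_sum (n div p) else 0) = (p + 1) * odd_divisor_sum n"
proof -
  let ?D = "\<lambda>n. {d. d dvd n \<and> odd d}"
  have p0: "p > 0" using p prime_gt_0_nat by blast
  have fin: "finite (?D n)" using n by simp
  have inj: "inj_on ((*) p) A" for A using p0 by (simp add: inj_on_def)
  have union: "?D (p * n) = ?D n \<union> (*) p ` ?D n"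
  proof
    show "?D (p * n) \<subseteq> ?D n \<union> (*) p ` ?D n"
    proof
      fix d assume "d \<in> ?D (p * n)"
      then have d: "d dvd p * n" "odd d" by auto
      show "d \<in> ?D n \<union> (*) p ` ?D n"
      proof (cases "p dvd d")
        case True
        then obtain e where e: "d = p * e" by blast
        then have "e dvd n" "odd e" using d p0 by auto
        then show ?thesis using e by blast
      next
        case False
        then have "coprime d p" using p(1) by (metis coprime_commute prime_imp_coprime)
        then have "d dvd n" using d(1) by (simp add: coprime_dvd_mult_right_iff)
        then show ?thesis using d(2) by blast
      qed
    qed
    show "?D n \<union> (*) p ` ?D n \<subseteq> ?D (p * n)" using p(2) by (auto intro: dvd_mult)
  qed
  have inter: "\<Sum>(?D n \<inter> (*) p ` ?D n) = p * (if p dvd n then odd_divisor_sum (n div p) else 0)"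
  proof (cases "p dvd n")
    case True
    then obtain k where k: "n = p * k" by blast
    have "?D n \<inter> (*) p ` ?D n = (*) p ` ?D k"
      unfolding k using p(2) p0 by (auto intro: dvd_mult)
    then have "\<Sum>(?D n \<inter> (*) p ` ?D n) = p * odd_divisor_sum k"
      by (simp add: sum.reindex[OF inj] sum_distrib_left odd_divisor_sum_def)
    then show ?thesis using k p0 by simp
  next
    case False
    then have "?D n \<inter> (*) p ` ?D n = {}" using dvd_mult_left by auto
    then show ?thesis using False by simp
  qed
  have "odd_divisor_sum (p * n) + \<Sum>(?D n \<inter> (*) p ` ?D n) = \<Sum>(?D n) + \<Sum>((*) p ` ?D n)"
    unfolding odd_divisor_sum_def union using fin by (intro sum.union_inter) simp_all
  also have "\<Sum>((*) p ` ?D n) = p * odd_divisor_sum n"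
    by (simp add: sum.reindex[OF inj] sum_distrib_left odd_divisor_sum_def)
  finally show ?thesis unfolding inter by (simp add: odd_divisor_sum_def)
qed

lemma odd_divisor_sum_double: "odd_divisor_sum (2 * n) = odd_divisor_sum n"
proof -
  have "{d. d dvd 2 * n \<and> odd d} = {d. d dvd n \<and> odd d}"
    by (auto simp: coprime_dvd_mult_right_iff)
  then show ?thesis unfolding odd_divisor_sum_def by simp
qed

text \<open>Write L(n) for the number of left ideals and X for L(k / p), or 0 if \<open>p\<close>
  does not divide k. As L(p) = p + 1, the Hecke relation L(pk) + (p + 1) X = (p + 1) L(k) + X
  reduces to L(pk) + p X = (p + 1) L(k), the recursion of \<open>odd_divisor_sum_hecke\<close>; and
  both functions ignore factors 2.\<close>

lemma left_ideal_number_eq_odd_divisor_sum: "n > 0 \<Longrightarrow> left_ideal_number n = odd_divisor_sum n"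
proof (induction n rule: less_induct)
  case (less n)
  consider "n = 1" | "even n" | "odd n" "n \<noteq> 1" by blast
  then show ?case
  proof cases
    case 1
    have "{d::nat. d dvd 1 \<and> odd d} = {1}" by auto
    then show ?thesis using 1 left_ideal_number_1 unfolding odd_divisor_sum_def by simp
  next
    case 2
    then obtain k where "n = 2 * k" by blast
    then show ?thesis using less left_ideal_number_double odd_divisor_sum_double by simp
  next
    case 3
    then obtain p where p: "prime p" "p dvd n" using prime_factor_nat by blast
    then obtain k where k: "n = p * k" by blast
    have odd: "odd p" using 3 p by auto
    have k0: "k > 0" "k < n" using less.prems k prime_gt_1_nat[OF p(1)] by auto
    have IH: "left_ideal_number k = odd_divisor_sum k" using less.IH k0 by blast
    have IH': "(if p dvd k then left_ideal_number (k div p) else 0) = (if p dvd k then odd_divisor_sum (k div p) else 0)"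
    proof (cases "p dvd k")
      case True
      then have "k div p > 0" using k0 by (simp add: dvd_div_pos)
      moreover have "k div p < n" using k0 div_le_dividend le_less_trans by blast
      ultimately show ?thesis using less.IH by simp
    qed simp
    show ?thesis
      using left_ideal_number_hecke[OF p(1) k0(1)] odd_divisor_sum_hecke[OF p(1) odd k0(1)]
      unfolding IH IH' left_ideal_number_prime[OF p(1) odd] k by (simp add: algebra_simps)
  qed
qed

lemma left_ideal_number_pos: "n > 0 \<Longrightarrow> left_ideal_number n > 0"
proof -
  assume n: "n > 0"
  have "(\<Sum>d\<in>{1}. d) \<le> odd_divisor_sum n" unfolding odd_divisor_sum_def using n by (intro sum_mono2) auto
  then show ?thesis using left_ideal_number_eq_odd_divisor_sum[OF n] by simp
qed

section \<open>The number of similarity sublattices of the Hurwitz ring\<close>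

text \<open>Parametrised by the product of the norms of the two factors, whose square is the
  index.\<close>

definition ssl_number :: "nat \<Rightarrow> nat" where
  "ssl_number n = card {M \<in> hur_ssls. qindex hur M = n\<^sup>2}"

lemma hur_ssls_norm_image: "{M \<in> hur_ssls. qindex hur M = n\<^sup>2} = pair_lat ` {(A, B) \<in> left_ideals \<times> prim_ideals. lnorm A * lnorm B = n}"
proof -
  have eq: "hur_ssls = pair_lat ` (left_ideals \<times> prim_ideals)" using bij_pair_lat unfolding bij_betw_def by simp
  have iff: "qindex hur (pair_lat (A, B)) = n\<^sup>2 \<longleftrightarrow> lnorm A * lnorm B = n" if "A \<in> left_ideals" "B \<in> prim_ideals" for A B
    unfolding qindex_pair_lat[OF that] by simp
  show ?thesis unfolding eq using iff by auto
qed

lemma norm_pairs_Sigma: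
  assumes "n > 0"
  shows "{(A, B) \<in> left_ideals \<times> prim_ideals. lnorm A * lnorm B = n} =
    (\<Union>d\<in>{d. d dvd n}. {A \<in> left_ideals. lnorm A = d} \<times> {B \<in> prim_ideals. lnorm B = n div d})"
proof -
  have "lnorm A * lnorm B = n \<longleftrightarrow> lnorm A dvd n \<and> lnorm B = n div lnorm A" if "A \<in> left_ideals" for A B
    using lnorm_pos[OF that] by auto
  then show ?thesis by auto
qed

lemma finite_prim_ideals_norm: "finite {B \<in> prim_ideals. lnorm B = n}"
  by (rule finite_subset[OF _ finite_left_ideals_norm[of n]]) (use prim_ideals_subset_left_ideals in blast)

lemma finite_hur_ssls_norm: "n > 0 \<Longrightarrow> finite {M \<in> hur_ssls. qindex hur M = n\<^sup>2}"
  unfolding hur_ssls_norm_image norm_pairs_Sigma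
  by (intro finite_imageI finite_UN_I) (auto simp: finite_left_ideals_norm finite_prim_ideals_norm)

lemma ssl_number_conv:
  assumes "n > 0"
  shows "ssl_number n = (\<Sum>d | d dvd n. left_ideal_number d * prim_ideal_number (n div d))"
proof -
  have "ssl_number n = card {(A, B) \<in> left_ideals \<times> prim_ideals. lnorm A * lnorm B = n}"
    unfolding ssl_number_def hur_ssls_norm_image
    by (rule card_image) (rule inj_on_subset[OF bij_betw_imp_inj_on[OF bij_pair_lat]], auto)
  also have "\<dots> = (\<Sum>d | d dvd n. card ({A \<in> left_ideals. lnorm A = d} \<times> {B \<in> prim_ideals. lnorm B = n div d}))"
    unfolding norm_pairs_Sigma[OF assms] using assms
    by (intro card_UN_disjoint) (auto simp: finite_left_ideals_norm finite_prim_ideals_norm)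
  finally show ?thesis by (simp add: card_cartesian_product left_ideal_number_def prim_ideal_number_def)
qed

lemma divisor_sum_mult:
  fixes f g :: "nat \<Rightarrow> nat"
  assumes "coprime m n" "m > 0" "n > 0"
    and f: "\<And>a b. coprime a b \<Longrightarrow> a > 0 \<Longrightarrow> b > 0 \<Longrightarrow> f (a * b) = f a * f b"
    and g: "\<And>a b. coprime a b \<Longrightarrow> a > 0 \<Longrightarrow> b > 0 \<Longrightarrow> g (a * b) = g a * g b"
  shows "(\<Sum>d | d dvd m * n. f d * g (m * n div d)) =
    (\<Sum>d | d dvd m. f d * g (m div d)) * (\<Sum>d | d dvd n. f d * g (n div d))"
proof -
  have "bij_betw (\<lambda>(a, b). a * b) ({d. d dvd m} \<times> {d. d dvd n}) {d. d dvd m * n}"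
    unfolding bij_betw_def
  proof
    show "inj_on (\<lambda>(a, b). a * b) ({d. d dvd m} \<times> {d. d dvd n})"
    proof (rule inj_onI)
      fix s t assume s: "s \<in> {d. d dvd m} \<times> {d. d dvd n}" and t: "t \<in> {d. d dvd m} \<times> {d. d dvd n}"
        and eq: "(\<lambda>(a, b). a * b) s = (\<lambda>(a, b). a * b) t"
      obtain a b a' b' where st: "s = (a, b)" "t = (a', b')" by fastforce
      have d: "a dvd m" "b dvd n" "a' dvd m" "b' dvd n" and e: "a * b = a' * b'" using s t eq unfolding st by auto
      have *: "a dvd a'" if "a dvd m" "b' dvd n" "a * b = a' * b'" for a b a' b'
      proof -
        have "coprime a b'" by (rule coprime_divisors[OF that(1,2) assms(1)])
        moreover have "a dvd a' * b'" unfolding that(3)[symmetric] by simp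
        ultimately show ?thesis by (simp add: coprime_dvd_mult_left_iff)
      qed
      have "a = a'" using *[OF d(1,4) e] *[OF d(3,2) e[symmetric]] by (rule dvd_antisym)
      moreover have "a > 0" using d(1) assms(2) by (metis dvd_0_left_iff gr0I less_numeral_extra(3))
      ultimately show "s = t" using e unfolding st by simp
    qed
    show "(\<lambda>(a, b). a * b) ` ({d. d dvd m} \<times> {d. d dvd n}) = {d. d dvd m * n}"
      using division_decomp[of _ m n] by (force intro: mult_dvd_mono)
  qed
  then have "(\<Sum>d | d dvd m * n. f d * g (m * n div d)) =
      (\<Sum>x\<in>{d. d dvd m} \<times> {d. d dvd n}. f (fst x * snd x) * g (m * n div (fst x * snd x)))"
    by (simp add: sum.reindex_bij_betw[symmetric] case_prod_beta)
  also have "\<dots> = (\<Sum>x\<in>{d. d dvd m} \<times> {d. d dvd n}. (f (fst x) * g (m div fst x)) * (f (snd x) * g (n div snd x)))"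
  proof (rule sum.cong[OF refl])
    fix x assume "x \<in> {d. d dvd m} \<times> {d. d dvd n}"
    then obtain a b k l where x: "x = (a, b)" "m = a * k" "n = b * l" by (auto elim!: dvdE)
    then have pos: "a > 0" "b > 0" "k > 0" "l > 0" using assms by auto
    have "coprime a b" "coprime k l" using assms(1) unfolding x by auto
    then have "f (a * b) = f a * f b" "g (k * l) = g k * g l" using f g pos by auto
    moreover have "a * k * (b * l) div (a * b) = k * l"
      using pos by (metis mult.assoc mult.left_commute nonzero_mult_div_cancel_left mult_pos_pos less_numeral_extra(3))
    ultimately show "f (fst x * snd x) * g (m * n div (fst x * snd x)) =
        f (fst x) * g (m div fst x) * (f (snd x) * g (n div snd x))"
      using pos unfolding x by simp
  qed
  also have "\<dots> = (\<Sum>d | d dvd m. f d * g (m div d)) * (\<Sum>d | d dvd n. f d * g (n div d))"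
    by (simp add: sum_product sum.cartesian_product case_prod_beta)
  finally show ?thesis .
qed

lemma ssl_number_mult:
  assumes "coprime m n" "m > 0" "n > 0"
  shows "ssl_number (m * n) = ssl_number m * ssl_number n"
  using divisor_sum_mult[OF assms, of left_ideal_number prim_ideal_number] left_ideal_number_mult prim_ideal_number_mult assms
  by (simp add: ssl_number_conv)

lemma ssl_number_1: "ssl_number 1 = 1"
  unfolding ssl_number_conv[OF zero_less_one] using left_ideal_number_1 prim_ideal_number_1 by simp

lemma ssl_number_pos:
  assumes "n > 0"
  shows "ssl_number n > 0"
proof -
  have "0 < (\<Sum>d\<in>{n}. left_ideal_number d * prim_ideal_number (n div d))"
    using left_ideal_number_pos[OF assms] prim_ideal_number_1 assms by simp
  also have "\<dots> \<le> ssl_number n"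
    unfolding ssl_number_conv[OF assms] using assms by (intro sum_mono2) auto
  finally show ?thesis .
qed

lemma prim_ideal_number_even: "even n \<Longrightarrow> prim_ideal_number n = 0"
proof -
  assume "even n"
  then have "{B \<in> prim_ideals. lnorm B = n} = {}" using prim_lgen primD(3) unfolding lnorm_def by blast
  then show ?thesis unfolding prim_ideal_number_def by (metis card.empty)
qed

text \<open>In the convolution primitive ideals occur only at odd norms, so the extra 2 goes to the
  left ideals, whose number it does not change.\<close>

lemma ssl_number_double:
  assumes n: "n > 0"
  shows "ssl_number (2 * n) = ssl_number n"
proof -
  have "ssl_number (2 * n) = (\<Sum>d | d dvd 2 * n. left_ideal_number (2 * n div d) * prim_ideal_number d)"
    unfolding ssl_number_conv[OF mult_pos_pos[OF zero_less_numeral n]] using n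
    by (intro sum.reindex_bij_witness[of _ "\<lambda>d. 2 * n div d" "\<lambda>d. 2 * n div d"])
      (simp_all add: div_div_cancel div_dvd_self)
  also have "\<dots> = (\<Sum>d | d dvd n. left_ideal_number (2 * n div d) * prim_ideal_number d)"
  proof (rule sum.mono_neutral_right)
    show "\<forall>i\<in>{d. d dvd 2 * n} - {d. d dvd n}. left_ideal_number (2 * n div i) * prim_ideal_number i = 0"
    proof
      fix i assume i: "i \<in> {d. d dvd 2 * n} - {d. d dvd n}"
      have "even i"
      proof (rule ccontr)
        assume "odd i"
        then have "coprime i 2" by simp
        then show False using i by (simp add: coprime_dvd_mult_right_iff)
      qed
      then show "left_ideal_number (2 * n div i) * prim_ideal_number i = 0" using prim_ideal_number_even by simp
    qed
  qed (use n in auto)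
  also have "\<dots> = (\<Sum>d | d dvd n. left_ideal_number (n div d) * prim_ideal_number d)"
  proof (rule sum.cong[OF refl])
    fix d assume "d \<in> {d. d dvd n}"
    then have d: "d dvd n" by simp
    then have "n div d > 0" using n by (simp add: dvd_div_pos)
    moreover have "2 * n div d = 2 * (n div d)" using d by (simp add: div_mult_swap)
    ultimately show "left_ideal_number (2 * n div d) * prim_ideal_number d = left_ideal_number (n div d) * prim_ideal_number d"
      using left_ideal_number_double by simp
  qed
  also have "\<dots> = ssl_number n"
    unfolding ssl_number_conv[OF n] using n
    by (intro sum.reindex_bij_witness[of _ "\<lambda>d. n div d" "\<lambda>d. n div d"])
      (simp_all add: div_div_cancel div_dvd_self)
  finally show ?thesis .
qed

section \<open>Similarity sublattices of the three hypercubic lattices\<close>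

definition QSSL :: "quat set \<Rightarrow> quat set \<Rightarrow> bool" where
  "QSSL L M \<longleftrightarrow> M \<subseteq> L \<and> (\<exists>F. sim F \<and> M = F ` L)"

lemma sim_comp: "sim F \<Longrightarrow> sim G \<Longrightarrow> sim (\<lambda>x. F (G x))"
  unfolding sim_def
proof (elim conjE exE, intro conjI)
  fix c d :: real assume "c > 0" "\<forall>x. nrm (F x) = c * nrm x" "d > 0" "\<forall>x. nrm (G x) = d * nrm x"
  then show "\<exists>c>0. \<forall>x. nrm (F (G x)) = c * nrm x" by (intro exI[of _ "c * d"]) simp
qed simp_all

lemma QSSL_hur_iff: "QSSL hur M \<longleftrightarrow> M \<in> hur_ssls"
proof
  assume "QSSL hur M"
  then obtain F where F: "sim F" "M = F ` hur" "F ` hur \<subseteq> hur" unfolding QSSL_def by blast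
  then have "F ` lip \<subseteq> hur" using lip_subset_hur by blast
  with F(1) obtain a b where "a \<in> hur" "a \<noteq> 0" "b \<in> hur" "b \<noteq> 0" "F ` hur = qlat a b"
    by (rule similarity_image)
  then show "M \<in> hur_ssls" using F(2) by (simp add: qlat_hur_ssls)
next
  assume "M \<in> hur_ssls"
  then obtain a b where "a \<in> hur" "a \<noteq> 0" "b \<in> hur" "b \<noteq> 0" "M = qlat a b" unfolding hur_ssls_def by blast
  then show "QSSL hur M"
    unfolding QSSL_def using qlat_subset_hur[of a b] sim_mult[of a b] unfolding qlat_def by blast
qed

lemma theta_nonzero: "\<theta> \<noteq> 0"
  using normalizing_theta unfolding normalizing_def by blast

definition d4 :: "quat set" where "d4 = (*) \<theta> ` hur"

lemma sim_lmult: "a \<noteq> 0 \<Longrightarrow> sim ((*) a)"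
  using sim_mult[of a 1] by simp

lemma QSSL_d4_iff: "QSSL d4 M \<longleftrightarrow> (\<exists>M'. QSSL hur M' \<and> M = (*) \<theta> ` M')"
proof
  assume "QSSL d4 M"
  then obtain F where F: "sim F" "M = F ` d4" "M \<subseteq> d4" unfolding QSSL_def by blast
  define G where "G x = inverse \<theta> * F (\<theta> * x)" for x
  have "sim G"
    unfolding G_def using sim_comp[OF sim_lmult sim_comp[OF F(1) sim_lmult]] theta_nonzero by simp
  moreover have M: "M = (*) \<theta> ` G ` hur"
    unfolding F(2) d4_def G_def using theta_nonzero by (simp add: image_image)
  moreover have "G ` hur \<subseteq> hur"
    using F(3) theta_nonzero unfolding M d4_def by (auto simp: image_subset_iff)
  ultimately show "\<exists>M'. QSSL hur M' \<and> M = (*) \<theta> ` M'" unfolding QSSL_def by blast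
next
  assume "\<exists>M'. QSSL hur M' \<and> M = (*) \<theta> ` M'"
  then obtain F where F: "sim F" "F ` hur \<subseteq> hur" "M = (*) \<theta> ` F ` hur" unfolding QSSL_def by blast
  define G where "G x = \<theta> * F (inverse \<theta> * x)" for x
  have "sim G"
    unfolding G_def using sim_comp[OF sim_lmult sim_comp[OF F(1) sim_lmult]] theta_nonzero by simp
  moreover have "M = G ` d4"
    unfolding F(3) d4_def G_def using theta_nonzero by (simp add: image_image)
  moreover have "M \<subseteq> d4" unfolding F(3) d4_def using F(2) by blast
  ultimately show "QSSL d4 M" unfolding QSSL_def by blast
qed

lemma QSSL_d4_set:
  "{M. QSSL d4 M \<and> qindex d4 M = m} = (`) ((*) \<theta>) ` {M. QSSL hur M \<and> qindex hur M = m}"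
  unfolding QSSL_d4_iff using qindex_lmult[OF theta_nonzero, of hur] unfolding d4_def by auto

lemma card_QSSL_d4:
  "card {M. QSSL d4 M \<and> qindex d4 M = m} = card {M. QSSL hur M \<and> qindex hur M = m}"
  unfolding QSSL_d4_set
  by (intro card_image inj_onI) (metis (no_types, lifting) theta_nonzero inj_image_eq_iff injI mult_left_cancel)

subsection \<open>The primitive hypercubic lattice\<close>

definition zlat :: "quat \<Rightarrow> quat \<Rightarrow> quat set" where
  "zlat a b = (\<lambda>x. a * x * b) ` lip"

definition lip_ssls :: "quat set set" where
  "lip_ssls = {zlat a b |a b. a \<in> hur \<and> a \<noteq> 0 \<and> b \<in> hur \<and> b \<noteq> 0 \<and> zlat a b \<subseteq> lip}"

lemma QSSL_lip_iff: "QSSL lip M \<longleftrightarrow> M \<in> lip_ssls"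
proof
  assume "QSSL lip M"
  then obtain F where F: "sim F" "M = F ` lip" "F ` lip \<subseteq> lip" unfolding QSSL_def by blast
  then have "F ` lip \<subseteq> hur" using lip_subset_hur by blast
  with F(1) obtain a b where "a \<in> hur" "a \<noteq> 0" "b \<in> hur" "b \<noteq> 0" "F ` lip = zlat a b"
    unfolding zlat_def by (rule similarity_image)
  then show "M \<in> lip_ssls" using F(2,3) unfolding lip_ssls_def by auto
next
  assume "M \<in> lip_ssls"
  then obtain a b where "a \<noteq> 0" "b \<noteq> 0" "M = zlat a b" "M \<subseteq> lip" unfolding lip_ssls_def by blast
  then show "QSSL lip M"
    unfolding QSSL_def using sim_mult[of a b] unfolding zlat_def by blast
qed

lemma qindex_zlat:
  assumes "a \<in> hur" "a \<noteq> 0" "b \<in> hur" "b \<noteq> 0" "zlat a b \<subseteq> lip"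
  shows "qindex lip (zlat a b) = (nnrm a * nnrm b)\<^sup>2"
proof -
  have "inj (\<lambda>x. a * x * b)" using assms by (intro injI) simp
  then have "qindex lip (zlat a b) = qindex hur (qlat a b)"
    unfolding zlat_def qlat_def using assms qlat_subset_hur[of a b]
    by (intro qindex_of_lip) (auto simp: distrib_left distrib_right zlat_def qlat_def)
  then show ?thesis using qindex_qlat[OF assms(1-4)] by simp
qed

text \<open>\<open>G\<close> compares the two lattices. The value e = \<open>G 1\<close> is a unit
  and its norm is the scale of \<open>G\<close>, so \<open>qconj e\<close> times \<open>G\<close> is
  an isometry fixing 1. By \<open>isom1_lip_hur\<close> it permutes \<open>lip\<close> and
  \<open>hur\<close>, and \<open>G\<close> differs from a symmetry of both orders only by the factor
  e.\<close>

lemma qlat_zlat_transport: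
  assumes nz: "a \<noteq> 0" "b \<noteq> 0"
    and G: "\<And>x. G x = inverse a * a' * x * b' * inverse b"
    and lip: "G ` lip \<subseteq> hur" and e: "nrm (G 1) = 1" "a' \<noteq> 0" "b' \<noteq> 0"
  shows "zlat a' b' = zlat (a * G 1) b" "qlat a' b' = qlat a b"
proof -
  define e where "e = G 1"
  have eh: "e \<in> hur" unfolding e_def using lip by auto
  have ne: "nnrm e = 1" using e(1) eh unfolding e_def by (intro nnrm_eqI) simp_all
  have "e = inverse a * a' * (b' * inverse b)" unfolding e_def G by (simp add: mult.assoc)
  then have c: "nrm (inverse a * a') * nrm (b' * inverse b) = 1"
    using e(1) unfolding e_def by (simp only: nrm_mult)
  define T where "T x = qconj e * G x" for x
  have "isom1 T"
    unfolding isom1_def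
  proof (intro conjI allI)
    show "T 1 = 1" unfolding T_def e_def[symmetric] by (rule unit_inverse(2)[OF eh ne])
    fix x
    have "nrm (T x) = nrm (inverse a * a') * nrm (b' * inverse b) * nrm x"
      unfolding T_def G nrm_mult nrm_conj using e(1) unfolding e_def[symmetric] by simp
    then show "nrm (T x) = nrm x" unfolding c by simp
  qed (simp_all add: T_def G distrib_left distrib_right)
  moreover have "T ` lip \<subseteq> hur" unfolding T_def using lip eh by (auto simp: hur_mult hur_conj)
  ultimately have T: "T ` lip = lip" "T ` hur = hur" by (rule isom1_lip_hur)+
  have GT: "G x = e * T x" for x
    unfolding T_def using unit_inverse(1)[OF eh ne] by (simp flip: mult.assoc)
  have "a' * x * b' = a * G x * b" for x unfolding G using nz by (simp add: mult.assoc)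
  then have *: "a' * x * b' = a * e * T x * b" for x unfolding GT by (simp add: mult.assoc)
  have "zlat a' b' = (\<lambda>x. a * e * x * b) ` T ` lip" unfolding zlat_def * by (simp add: image_image)
  then show "zlat a' b' = zlat (a * G 1) b" unfolding T e_def zlat_def .
  have "qlat a' b' = (\<lambda>x. a * e * x * b) ` T ` hur" unfolding qlat_def * by (simp add: image_image)
  also have "\<dots> = (\<lambda>x. a * x * b) ` (*) e ` hur" unfolding T by (simp add: image_image mult.assoc)
  also have "(*) e ` hur = hur"
  proof
    show "(*) e ` hur \<subseteq> hur" using eh by (auto simp: hur_mult)
    show "hur \<subseteq> (*) e ` hur"
    proof
      fix x assume "x \<in> hur"
      then have "qconj e * x \<in> hur" using eh by (simp add: hur_mult hur_conj)
      moreover have "x = e * (qconj e * x)" using unit_inverse(1)[OF eh ne] by (simp flip: mult.assoc)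
      ultimately show "x \<in> (*) e ` hur" by blast
    qed
  qed
  finally show "qlat a' b' = qlat a b" unfolding qlat_def .
qed

text \<open>The comparison map preserves \<open>hur\<close> because the lattices coincide, and equal
  indices make its scale 1.\<close>

lemma qlat_eq_zlat:
  assumes "a \<in> hur" "a \<noteq> 0" "b \<in> hur" "b \<noteq> 0" "a' \<in> hur" "a' \<noteq> 0" "b' \<in> hur" "b' \<noteq> 0"
    and eq: "qlat a b = qlat a' b'"
  obtains e where "e \<in> hur" "nnrm e = 1" "zlat a' b' = zlat (a * e) b"
proof -
  define G where "G x = inverse a * a' * x * b' * inverse b" for x
  have hG: "G x \<in> hur" if "x \<in> hur" for x
  proof -
    have "a' * x * b' \<in> qlat a b" unfolding eq using that unfolding qlat_def by blast
    then obtain y where y: "y \<in> hur" "a' * x * b' = a * y * b" unfolding qlat_def by blast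
    have "G x = inverse a * (a' * x * b') * inverse b" unfolding G_def by (simp add: mult.assoc)
    also have "\<dots> = y" unfolding y(2) using assms by (simp add: mult.assoc)
    finally show ?thesis using y(1) by simp
  qed
  have "(nnrm a * nnrm b)\<^sup>2 = (nnrm a' * nnrm b')\<^sup>2"
    using eq qindex_qlat[OF assms(1-4)] qindex_qlat[OF assms(5-8)] by simp
  then have "nnrm a * nnrm b = nnrm a' * nnrm b'" by simp
  then have "real (nnrm a * nnrm b) = real (nnrm a' * nnrm b')" by simp
  then have "nrm a * nrm b = nrm a' * nrm b'" using assms by (simp add: real_nnrm)
  moreover have "nrm (G 1) * (nrm a * nrm b) = nrm a' * nrm b'"
    unfolding G_def nrm_mult nrm_inverse using assms by (simp add: field_simps)
  moreover have "nrm a * nrm b > 0" using assms by simp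
  ultimately have n: "nrm (G 1) = 1" by (metis less_irrefl mult_cancel_right1)
  have "zlat a' b' = zlat (a * G 1) b"
    by (rule qlat_zlat_transport[OF assms(2,4) G_def _ n assms(6,8)]) (use hG lip_hur in blast)
  moreover have "G 1 \<in> hur" using hG by simp
  moreover from this have "nnrm (G 1) = 1" using n by (intro nnrm_eqI) simp_all
  ultimately show ?thesis using that by blast
qed

text \<open>Each copy of the Lipschitz order determines its Hurwitz lattice. The comparison map
  permutes \<open>lip\<close>, so it sends some x to 1; then the norms of \<open>G 1\<close> and of
  x are natural numbers with product 1.\<close>

lemma zlat_eq_qlat:
  assumes "a \<noteq> 0" "b \<noteq> 0" "a' \<noteq> 0" "b' \<noteq> 0" and eq: "zlat a b = zlat a' b'"
  shows "qlat a' b' = qlat a b"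
proof -
  define G where "G x = inverse a * a' * x * b' * inverse b" for x
  have GG: "G x = inverse a * (a' * x * b') * inverse b" for x unfolding G_def by (simp add: mult.assoc)
  have "G ` lip = (\<lambda>y. inverse a * y * inverse b) ` zlat a b"
    unfolding eq unfolding zlat_def GG image_image ..
  also have "\<dots> = lip" unfolding zlat_def image_image using assms by (simp add: mult.assoc)
  finally have G: "G ` lip = lip" .
  have "1 \<in> G ` lip" unfolding G by simp
  then obtain x where x: "x \<in> lip" "G x = 1" by (metis imageE)
  have "nrm (G 1) * nrm x = nrm (G x)" unfolding G_def nrm_mult by simp
  then have "nrm (G 1) * nrm x = 1" unfolding x(2) nrm_simps .
  moreover have "G 1 \<in> hur" using imageI[OF lip_0_1(2), of G] unfolding G by (rule lip_hur)
  moreover have "x \<in> hur" using x(1) by (rule lip_hur)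
  ultimately have "real (nnrm (G 1) * nnrm x) = 1" by (simp add: real_nnrm)
  then have "nnrm (G 1) * nnrm x = 1" by linarith
  then have "nnrm (G 1) = 1" by simp
  then have n: "nrm (G 1) = 1" using \<open>G 1 \<in> hur\<close> by (metis of_nat_1 real_nnrm)
  show ?thesis
    by (rule qlat_zlat_transport[OF assms(1,2) G_def _ n assms(3,4)]) (use G lip_subset_hur in blast)
qed

lemma even_nnrm_lip: "x \<in> hur \<Longrightarrow> even (nnrm x) \<Longrightarrow> x \<in> lip"
proof -
  assume x: "x \<in> hur" and ev: "even (nnrm x)"
  obtain A b c d :: int where xx: "x = Quat (A/2) (A/2+b) (A/2+c) (A/2+d)"
    using x by (rule hurE)
  have "even (A*A + A*(b+c+d) + b*b + c*c + d*d)"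
    using ev nnrm_Quat[OF xx] by (metis even_of_nat)
  then have "even A" by (auto simp: even_add even_mult_iff)
  then obtain k where "A = 2 * k" by blast
  then show "x \<in> lip" by (intro lipI[of _ k "k+b" "k+c" "k+d"]) (simp add: xx)
qed

text \<open>The quotient \<open>hur / \<theta> hur\<close> is the field with four elements, hence commutative, and
  \<open>lip\<close> is the preimage of its prime field.\<close>

lemma even_nnrm_commutator:
  assumes "x \<in> hur" "y \<in> hur"
  shows "even (nnrm (x * y - y * x))"
proof -
  obtain A b c d :: int where x: "x = Quat (A/2) (A/2+b) (A/2+c) (A/2+d)"
    using assms(1) by (rule hurE)
  obtain A' b' c' d' :: int where y: "y = Quat (A'/2) (A'/2+b') (A'/2+c') (A'/2+d')"
    using assms(2) by (rule hurE)
  define k1 where "k1 = A*(d'-c') + A'*(c-d) + 2*(c*d' - d*c')"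
  define k2 where "k2 = A*(b'-d') + A'*(d-b) + 2*(d*b' - b*d')"
  define k3 where "k3 = A*(c'-b') + A'*(b-c) + 2*(b*c' - c*b')"
  \<comment> \<open>The commutator is pure with integral coordinates, so its norm has the parity of
    k1 + k2 + k3, a sum in which the terms with \<open>A\<close> and \<open>A'\<close>
    cancel.\<close>
  have z: "x * y - y * x = Quat (of_int 0/2) (of_int 0/2 + of_int k1) (of_int 0/2 + of_int k2) (of_int 0/2 + of_int k3)"
    by (rule quat_eqI) (simp add: x y k1_def k2_def k3_def field_simps)
  have "k1 + k2 + k3 = 2*(c*d' - d*c') + 2*(d*b' - b*d') + 2*(b*c' - c*b')"
    unfolding k1_def k2_def k3_def by (simp add: algebra_simps)
  then have "even (k1 + k2 + k3)" by simp
  then have "even (int (nnrm (x * y - y * x)))"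
    unfolding nnrm_Quat[OF z] by (simp add: even_add even_mult_iff)
  then show ?thesis by simp
qed

lemma lmult_commutator_lip:
  assumes "a \<in> hur" "x \<in> hur" "y \<in> hur"
  shows "a * (x * y) - a * (y * x) \<in> lip"
proof -
  have "a * (x * y - y * x) \<in> lip"
  proof (rule even_nnrm_lip)
    show "a * (x * y - y * x) \<in> hur" using assms by (simp add: hur_mult hur_diff)
    show "even (nnrm (a * (x * y - y * x)))"
      using even_nnrm_commutator[OF assms(2,3)] assms by (simp add: nnrm_mult hur_mult hur_diff)
  qed
  then show ?thesis by (simp add: right_diff_distrib)
qed

lemma lip_cong:
  assumes "x - y \<in> lip"
  shows "x \<in> lip \<longleftrightarrow> y \<in> lip"
  using lip_diff[OF _ assms, of x] lip_add[OF _ assms, of y] by auto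

text \<open>A primitive cube root of unity. Its powers represent the Hurwitz units modulo right
  multiplication by Lipschitz units (\<open>omega_powers_unique\<close>), and their residues are the
  nonzero elements of the field with four elements.\<close>

definition \<omega> :: quat where "\<omega> = Quat (-1/2) (1/2) (1/2) (1/2)"

definition omega_powers :: "quat set" where "omega_powers = {1, \<omega>, \<omega> * \<omega>}"

lemma omega_sq: "\<omega> * \<omega> = Quat (-1/2) (-1/2) (-1/2) (-1/2)"
  unfolding \<omega>_def by (rule quat_eqI) simp

lemma omega_powers_distinct: "1 \<noteq> \<omega>" "1 \<noteq> \<omega> * \<omega>" "\<omega> \<noteq> \<omega> * \<omega>"
  unfolding omega_sq unfolding \<omega>_def one_quat_def by simp_all

lemma omega_powers_hur: "w \<in> omega_powers \<Longrightarrow> w \<in> hur"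
proof -
  have "\<omega> \<in> hur" unfolding \<omega>_def by (rule hurI[of _ "-1" 1 1 1]) simp
  then show "w \<in> omega_powers \<Longrightarrow> w \<in> hur" unfolding omega_powers_def by (auto simp: hur_mult)
qed

lemma omega_powers_nnrm: "w \<in> omega_powers \<Longrightarrow> nnrm w = 1"
  by (rule nnrm_eqI[OF omega_powers_hur]) (auto simp: omega_powers_def nrm_mult \<omega>_def nrm_def power2_eq_square)

lemma hur_lip_iff:
  assumes "x \<in> hur" "2 * qa x = of_int A"
  shows "x \<in> lip \<longleftrightarrow> even A"
proof
  assume "x \<in> lip"
  then obtain k b c d :: int where "x = Quat k b c d" by (rule lipE)
  then have "real_of_int A = of_int (2 * k)" using assms(2) by simp
  then have "A = 2 * k" by (simp only: of_int_eq_iff)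
  then show "even A" by simp
next
  assume "even A"
  then obtain k where k: "A = 2 * k" by blast
  obtain B b c d :: int where x: "x = Quat (B/2) (B/2+b) (B/2+c) (B/2+d)"
    using assms(1) by (rule hurE)
  then have "B = 2 * k" using assms(2) k by simp
  then show "x \<in> lip" by (intro lipI[of _ k "k+b" "k+c" "k+d"]) (simp add: x)
qed

text \<open>Membership in \<open>lip\<close> is read off the doubled real part. For the three
  products these are congruent to \<open>A\<close>, \<open>s\<close> and \<open>A + s\<close> modulo
  2 and sum to an even number, so all three are even or exactly one is; all are even precisely when
  the norm is.\<close>

lemma omega_powers_card:
  assumes x: "x \<in> hur"
  shows "card {w \<in> omega_powers. x * w \<in> lip} = (if even (nnrm x) then 3 else 1)"
proof -
  obtain A b c d :: int where xx: "x = Quat (A/2) (A/2+b) (A/2+c) (A/2+d)"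
    using x by (rule hurE)
  define s where "s = b + c + d"
  have om: "\<omega> \<in> hur" "\<omega> * \<omega> \<in> hur" using omega_powers_hur unfolding omega_powers_def by auto
  have 1: "x * 1 \<in> lip \<longleftrightarrow> even A"
    using hur_lip_iff[OF x, of A] by (simp add: xx)
  have "2 * qa (x * \<omega>) = of_int (- 2 * A - s)" by (simp add: xx \<omega>_def s_def field_simps)
  then have 2: "x * \<omega> \<in> lip \<longleftrightarrow> even s"
    using hur_lip_iff[OF hur_mult[OF x om(1)], of "- 2 * A - s"] by simp
  have "2 * qa (x * (\<omega> * \<omega>)) = of_int (A + s)" unfolding omega_sq by (simp add: xx s_def field_simps)
  then have 3: "x * (\<omega> * \<omega>) \<in> lip \<longleftrightarrow> even (A + s)"
    using hur_lip_iff[OF hur_mult[OF x om(2)], of "A + s"] by simp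
  have "even (int (nnrm x)) \<longleftrightarrow> even A \<and> even s"
    unfolding nnrm_Quat[OF xx] s_def by (auto simp: even_add even_mult_iff)
  then have n: "even (nnrm x) \<longleftrightarrow> even A \<and> even s" by simp
  have "{w \<in> omega_powers. x * w \<in> lip} = (if even A then {1} else {}) \<union> (if even s then {\<omega>} else {})
      \<union> (if even (A + s) then {\<omega> * \<omega>} else {})"
    unfolding omega_powers_def using 1 2 3 by auto
  then show ?thesis unfolding n using omega_powers_distinct by (cases "even A"; cases "even s"; simp)
qed

text \<open>Modulo \<open>lip\<close> the products a l b and a b l agree, so the inclusion is
  decided by the image of 1.\<close>

lemma zlat_subset_lip_iff:
  assumes "a \<in> hur" "b \<in> hur"
  shows "zlat a b \<subseteq> lip \<longleftrightarrow> a * b \<in> lip"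
proof
  assume "zlat a b \<subseteq> lip"
  then have "a * 1 * b \<in> lip" unfolding zlat_def using lip_0_1(2) by blast
  then show "a * b \<in> lip" by simp
next
  assume ab: "a * b \<in> lip"
  show "zlat a b \<subseteq> lip"
    unfolding zlat_def
  proof clarify
    fix l assume l: "l \<in> lip"
    have "a * (l * b) - a * (b * l) \<in> lip" using assms l by (intro lmult_commutator_lip) (simp_all add: lip_hur)
    moreover have "a * (b * l) \<in> lip" using lip_mult[OF ab l] by (simp add: mult.assoc)
    ultimately show "a * l * b \<in> lip" using lip_cong by (simp add: mult.assoc)
  qed
qed

lemma card_allowed:
  assumes "a \<in> hur" "b \<in> hur"
  shows "card {w \<in> omega_powers. zlat (a * w) b \<subseteq> lip} = (if even (nnrm a * nnrm b) then 3 else 1)"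
proof -
  have "zlat (a * w) b \<subseteq> lip \<longleftrightarrow> (a * b) * w \<in> lip" if "w \<in> omega_powers" for w
  proof -
    have w: "w \<in> hur" using that by (rule omega_powers_hur)
    have "zlat (a * w) b \<subseteq> lip \<longleftrightarrow> a * (w * b) \<in> lip"
      using zlat_subset_lip_iff[of "a * w" b] assms w by (simp add: hur_mult mult.assoc)
    also have "\<dots> \<longleftrightarrow> a * (b * w) \<in> lip"
      by (rule lip_cong) (rule lmult_commutator_lip[OF assms(1) w assms(2)])
    finally show ?thesis by (simp add: mult.assoc)
  qed
  then have "{w \<in> omega_powers. zlat (a * w) b \<subseteq> lip} = {w \<in> omega_powers. (a * b) * w \<in> lip}" by blast
  then show ?thesis using omega_powers_card[of "a * b"] assms by (simp add: hur_mult nnrm_mult)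
qed

lemma omega_powers_unique:
  assumes "e \<in> hur" "nnrm e = 1"
  shows "\<exists>!w. w \<in> omega_powers \<and> qconj e * w \<in> lip"
proof -
  have "card {w \<in> omega_powers. qconj e * w \<in> lip} = 1"
    using omega_powers_card[of "qconj e"] assms by (simp add: hur_conj)
  then obtain w where w: "{w \<in> omega_powers. qconj e * w \<in> lip} = {w}" by (rule card_1_singletonE)
  then have "v \<in> omega_powers \<and> qconj e * v \<in> lip \<longleftrightarrow> v = w" for v by (simp add: set_eq_iff)
  then show ?thesis by auto
qed

lemma zlat_unit:
  assumes "l \<in> lip" "nnrm l = 1"
  shows "zlat (a * l) b = zlat a b"
proof -
  note u = unit_inverse[OF lip_hur[OF assms(1)] assms(2)]
  have "(*) l ` lip = lip"
  proof
    show "(*) l ` lip \<subseteq> lip" using assms by (auto simp: lip_mult)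
    show "lip \<subseteq> (*) l ` lip"
    proof
      fix x assume "x \<in> lip"
      then have "qconj l * x \<in> lip" using assms by (simp add: lip_mult lip_conj)
      moreover have "x = l * (qconj l * x)" using u(1) by (simp flip: mult.assoc)
      ultimately show "x \<in> (*) l ` lip" by blast
    qed
  qed
  then have "zlat a b = (\<lambda>x. a * x * b) ` (*) l ` lip" unfolding zlat_def by simp
  then show ?thesis unfolding zlat_def by (simp add: image_image mult.assoc)
qed

lemma card_lip_ssls:
  assumes n: "n > 0"
  shows "card {M \<in> lip_ssls. qindex lip M = n\<^sup>2} = ssl_number n * (if even n then 3 else 1)"
proof -
  define K where "K = {M \<in> hur_ssls. qindex hur M = n\<^sup>2}"
  define S where "S = {M \<in> lip_ssls. qindex lip M = n\<^sup>2}"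
  \<comment> \<open>One factorisation is fixed for each \<open>M\<close>, and the representatives
    \<open>w\<close> are measured relative to it.\<close>
  have "\<exists>a b. M = qlat a b \<and> a \<in> hur \<and> a \<noteq> 0 \<and> b \<in> hur \<and> b \<noteq> 0" if "M \<in> hur_ssls" for M
    using that unfolding hur_ssls_def by blast
  then obtain fa fb where "\<forall>M\<in>hur_ssls. M = qlat (fa M) (fb M) \<and> fa M \<in> hur \<and> fa M \<noteq> 0 \<and> fb M \<in> hur \<and> fb M \<noteq> 0"
    by metis
  then have ff: "fa M \<in> hur" "fa M \<noteq> 0" "fb M \<in> hur" "fb M \<noteq> 0" "qlat (fa M) (fb M) = M" "nnrm (fa M) * nnrm (fb M) = n"
    if "M \<in> K" for M
    using that qindex_qlat[of "fa M" "fb M"] unfolding K_def by auto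
  define E where "E M = {w \<in> omega_powers. zlat (fa M * w) (fb M) \<subseteq> lip}" for M
  define f where "f = (\<lambda>(M, w). zlat (fa M * w) (fb M))"
  have w0: "w \<noteq> 0" if "w \<in> omega_powers" for w using omega_powers_nnrm[OF that] by auto
  have q: "qlat (fa M * w) (fb M) = M" if "M \<in> K" "w \<in> omega_powers" for M w
  proof -
    have "normalizing w"
      unfolding normalizing_def
    proof (intro conjI ballI)
      note u = unit_inverse[OF omega_powers_hur[OF that(2)] omega_powers_nnrm[OF that(2)]]
      show "w \<in> hur" "w \<noteq> 0" using omega_powers_hur w0 that by auto
      fix x assume x: "x \<in> hur"
      have "w * x = (w * x * qconj w) * w" using u(2) by (simp add: mult.assoc)
      then show "\<exists>y\<in>hur. w * x = y * w" using x omega_powers_hur[OF that(2)] hur_mult hur_conj by blast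
      have "x * w = w * (qconj w * x * w)" using u(1) by (simp flip: mult.assoc)
      then show "\<exists>y\<in>hur. x * w = w * y" using x omega_powers_hur[OF that(2)] hur_mult hur_conj by blast
    qed
    then have "qlat (fa M * w) (fb M) = qlat (fa M) (w * fb M)" by (rule qlat_normalizing[symmetric])
    also have "\<dots> = (\<lambda>x. fa M * x) ` lid (w * fb M)" unfolding qlat_eq_lmult ..
    also have "lid (w * fb M) = lid (fb M)"
      using lid_eq_iff[of "fb M" "w * fb M"] ff[OF that(1)] w0 omega_powers_hur omega_powers_nnrm that(2) by (auto simp: hur_mult)
    finally show ?thesis using ff(5)[OF that(1)] by (simp add: qlat_eq_lmult)
  qed
  have "bij_betw f (Sigma K E) S"
    unfolding bij_betw_def
  proof
    show "inj_on f (Sigma K E)"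
    proof (rule inj_onI)
      fix s t assume s: "s \<in> Sigma K E" and t: "t \<in> Sigma K E" and eq: "f s = f t"
      obtain M w M' w' where st: "s = (M, w)" "t = (M', w')" by fastforce
      have M: "M \<in> K" "w \<in> omega_powers" "M' \<in> K" "w' \<in> omega_powers" using s t unfolding st E_def by auto
      have z: "zlat (fa M * w) (fb M) = zlat (fa M' * w') (fb M')" using eq unfolding st f_def by simp
      then have "qlat (fa M' * w') (fb M') = qlat (fa M * w) (fb M)"
        using ff M w0 by (intro zlat_eq_qlat) simp_all
      then have MM: "M' = M" using q M by simp
      \<comment> \<open>Comparing the image of 1 puts \<open>qconj w' * w\<close> into
        \<open>lip\<close>, so \<open>w\<close> and \<open>w'\<close> represent the same
        class.\<close>
      have "fa M * w * 1 * fb M \<in> zlat (fa M * w) (fb M)" unfolding zlat_def using lip_0_1(2) by blast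
      then have "fa M * w * 1 * fb M \<in> zlat (fa M * w') (fb M)" unfolding z MM .
      then obtain l where l: "l \<in> lip" "fa M * w * 1 * fb M = fa M * w' * l * fb M" unfolding zlat_def by blast
      then have "w = w' * l" using ff[OF M(1)] by (simp add: mult.assoc) (simp flip: mult.assoc)
      then have "qconj w' * w = l" using unit_inverse(2)[OF omega_powers_hur omega_powers_nnrm, OF M(4,4)] by (simp flip: mult.assoc)
      moreover have "qconj w' * w' \<in> lip" using unit_inverse(2)[OF omega_powers_hur omega_powers_nnrm, OF M(4,4)] by simp
      ultimately have "w = w'" using omega_powers_unique[OF omega_powers_hur omega_powers_nnrm, OF M(4,4)] M l(1) by blast
      then show "s = t" unfolding st MM by simp
    qed
    show "f ` Sigma K E = S"
    proof
      show "f ` Sigma K E \<subseteq> S"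
      proof clarify
        fix M w assume M: "M \<in> K" and w: "w \<in> E M"
        then have w: "w \<in> omega_powers" "zlat (fa M * w) (fb M) \<subseteq> lip" unfolding E_def by auto
        have h: "fa M * w \<in> hur" "fa M * w \<noteq> 0" using ff[OF M] w0 omega_powers_hur w by (simp_all add: hur_mult)
        have nn: "nnrm (fa M * w) * nnrm (fb M) = n"
          using ff[OF M] w omega_powers_hur omega_powers_nnrm by (simp add: nnrm_mult)
        have "zlat (fa M * w) (fb M) \<in> lip_ssls" unfolding lip_ssls_def using h ff(3,4)[OF M] w(2) by blast
        moreover have "qindex lip (zlat (fa M * w) (fb M)) = n\<^sup>2"
          using qindex_zlat[OF h ff(3,4)[OF M] w(2)] unfolding nn .
        ultimately show "f (M, w) \<in> S" unfolding S_def f_def by simp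
      qed
      show "S \<subseteq> f ` Sigma K E"
      proof
        fix N assume "N \<in> S"
        then obtain a b where ab: "a \<in> hur" "a \<noteq> 0" "b \<in> hur" "b \<noteq> 0" "zlat a b \<subseteq> lip" "N = zlat a b"
          and idx: "qindex lip N = n\<^sup>2" unfolding S_def lip_ssls_def by blast
        define M where "M = qlat a b"
        have M: "M \<in> K"
          using ab idx qindex_zlat[OF ab(1-5)] qindex_qlat[OF ab(1-4)] unfolding K_def M_def by (simp add: qlat_hur_ssls)
        note F = ff[OF M]
        have "qlat (fa M) (fb M) = qlat a b" using F(5) unfolding M_def .
        then obtain e where e: "e \<in> hur" "nnrm e = 1" "zlat a b = zlat (fa M * e) (fb M)"
          using qlat_eq_zlat[OF F(1-4) ab(1-4)] by blast
        \<comment> \<open>The arbitrary unit \<open>e\<close> is replaced by its representative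
          \<open>w\<close>; the two differ by a Lipschitz unit, which \<open>zlat_unit\<close>
          absorbs.\<close>
        obtain w where w: "w \<in> omega_powers" "qconj e * w \<in> lip" using omega_powers_unique[OF e(1,2)] by blast
        have we: "w = e * (qconj e * w)" using unit_inverse(1)[OF e(1,2)] by (simp flip: mult.assoc)
        have "nnrm (qconj e * w) = 1" using e w omega_powers_hur omega_powers_nnrm by (simp add: nnrm_mult hur_conj)
        then have "zlat (fa M * e * (qconj e * w)) (fb M) = zlat (fa M * e) (fb M)" using w(2) by (rule zlat_unit[rotated])
        then have "N = zlat (fa M * w) (fb M)" using we e(3) ab(6) by (metis mult.assoc)
        then show "N \<in> f ` Sigma K E"
          using M w(1) ab(5,6) unfolding f_def E_def by (intro image_eqI[of _ _ "(M, w)"]) simp_all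
      qed
    qed
  qed
  then have "card S = card (Sigma K E)" by (rule bij_betw_same_card[symmetric])
  also have "\<dots> = (\<Sum>M\<in>K. card (E M))"
    using finite_hur_ssls_norm[OF n] unfolding K_def E_def omega_powers_def by (intro card_SigmaI) auto
  also have "\<dots> = (\<Sum>M\<in>K. if even n then 3 else 1)"
  proof (rule sum.cong[OF refl])
    fix M assume M: "M \<in> K"
    show "card (E M) = (if even n then 3 else 1)"
      unfolding E_def using card_allowed[OF ff(1,3)[OF M]] ff(6)[OF M] by simp
  qed
  finally show ?thesis unfolding S_def K_def ssl_number_def by simp
qed

subsection \<open>Transfer to \<open>real ^ 4\<close>\<close>

definition qvec :: "quat \<Rightarrow> real ^ 4" where
  "qvec x = vector [qa x, qb x, qc x, qd x]"

definition vquat :: "real ^ 4 \<Rightarrow> quat" where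
  "vquat y = Quat (y $ 1) (y $ 2) (y $ 3) (y $ 4)"

lemma qvec_nth [simp]: "qvec x $ 1 = qa x" "qvec x $ 2 = qb x" "qvec x $ 3 = qc x" "qvec x $ 4 = qd x"
  unfolding qvec_def vector_4_nth by simp_all

lemma vquat_qvec [simp]: "vquat (qvec x) = x"
  unfolding vquat_def by simp

lemma qvec_vquat [simp]: "qvec (vquat y) = y"
  unfolding vquat_def by (simp add: vec_eq_iff forall_4)

lemma qvec_simps:
  "qvec (x + y) = qvec x + qvec y" "qvec (x - y) = qvec x - qvec y" "qvec (r *\<^sub>R x) = r *\<^sub>R qvec x" "qvec 0 = 0"
  "qmult (qvec x) (qvec y) = qvec (x * y)"
  by (simp_all add: vec_eq_iff forall_4 qmult_def vector_4_nth)

lemma vquat_simps: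
  "vquat (x + y) = vquat x + vquat y" "vquat (r *\<^sub>R x) = r *\<^sub>R vquat x"
  by (metis qvec_simps qvec_vquat vquat_qvec)+

lemma inj_qvec: "inj qvec"
  by (metis injI vquat_qvec)

lemma norm_qvec: "(norm (qvec x))\<^sup>2 = nrm x"
  unfolding power2_norm_eq_inner by (simp add: inner_vec_def sum_4 nrm_def power2_eq_square)

lemma nrm_vquat: "nrm (vquat y) = (norm y)\<^sup>2"
  using norm_qvec[of "vquat y"] by simp

lemma eq_qvec_image:
  assumes "\<And>x. qvec x \<in> A \<longleftrightarrow> x \<in> B"
  shows "A = qvec ` B"
proof -
  have "y \<in> A \<longleftrightarrow> y \<in> qvec ` B" for y
    using assms[of "vquat y"] inj_image_mem_iff[OF inj_qvec, of "vquat y" B] by simp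
  then show ?thesis by blast
qed

lemma hurwitz_qvec: "hurwitz = qvec ` hur"
proof -
  have "qvec x \<in> hurwitz \<longleftrightarrow> x \<in> hur" for x
  proof
    assume "x \<in> hur"
    then consider "x \<in> lip" | "x - \<h> \<in> lip" using hur_lip_cases by blast
    then show "qvec x \<in> hurwitz"
    proof cases
      case 1
      then show ?thesis by (auto elim!: lipE simp: hurwitz_def forall_4)
    next
      case 2
      then obtain a b c d :: int where "x - \<h> = Quat a b c d" by (rule lipE)
      then have "qa x - 1/2 = a" "qb x - 1/2 = b" "qc x - 1/2 = c" "qd x - 1/2 = d"
        by (auto dest: arg_cong[of _ _ qa] arg_cong[of _ _ qb] arg_cong[of _ _ qc] arg_cong[of _ _ qd])
      then show ?thesis unfolding hurwitz_def by (simp add: forall_4)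
    qed
  next
    assume "qvec x \<in> hurwitz"
    then consider "qa x \<in> \<int>" "qb x \<in> \<int>" "qc x \<in> \<int>" "qd x \<in> \<int>"
      | "qa x - 1/2 \<in> \<int>" "qb x - 1/2 \<in> \<int>" "qc x - 1/2 \<in> \<int>" "qd x - 1/2 \<in> \<int>"
      unfolding hurwitz_def by (auto simp: forall_4)
    then show "x \<in> hur"
    proof cases
      case 1
      then obtain a b c d :: int where "qa x = a" "qb x = b" "qc x = c" "qd x = d" by (auto elim!: Ints_cases)
      then show ?thesis by (intro lip_hur lipI[of _ a b c d] quat_eqI) simp
    next
      case 2
      then obtain a b c d :: int where "qa x - 1/2 = a" "qb x - 1/2 = b" "qc x - 1/2 = c" "qd x - 1/2 = d"
        by (auto elim!: Ints_cases)
      then have "x - \<h> \<in> lip" by (intro lipI[of _ a b c d] quat_eqI) simp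
      then have "(x - \<h>) + \<h> \<in> hur" by (rule hur_add[OF lip_hur hur_h])
      then show ?thesis by simp
    qed
  qed
  then show ?thesis by (rule eq_qvec_image)
qed

lemma qvec_Z4_iff: "qvec x \<in> lattice_Z4 \<longleftrightarrow> x \<in> lip"
proof
  assume "qvec x \<in> lattice_Z4"
  then obtain a b c d :: int where "qa x = a" "qb x = b" "qc x = c" "qd x = d"
    unfolding lattice_Z4_def by (auto simp: forall_4 elim!: Ints_cases)
  then show "x \<in> lip" by (intro lipI[of _ a b c d] quat_eqI) simp
qed (auto elim!: lipE simp: lattice_Z4_def forall_4)

lemma lattice_Z4_qvec: "lattice_Z4 = qvec ` lip"
  using qvec_Z4_iff by (rule eq_qvec_image)

lemma d4_iff: "x \<in> d4 \<longleftrightarrow> x \<in> hur \<and> even (nnrm x)"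
  unfolding d4_def using even_nnrm_lmult[of x] by (auto simp: hur_mult nnrm_mult)

lemma lattice_D4_qvec: "lattice_D4 = qvec ` d4"
proof -
  have "qvec x \<in> lattice_D4 \<longleftrightarrow> x \<in> d4" for x
  proof (cases "x \<in> lip")
    case True
    then obtain a b c d :: int where x: "x = Quat a b c d" by (rule lipE)
    have "qvec x \<in> lattice_D4 \<longleftrightarrow> (\<exists>k::int. real_of_int (a + b + c + d) = of_int (2 * k))"
      unfolding lattice_D4_def using True qvec_Z4_iff by (simp add: sum_4 x)
    also have "\<dots> \<longleftrightarrow> even (a + b + c + d)" by (simp only: of_int_eq_iff dvd_def)
    also have "\<dots> \<longleftrightarrow> even (int (nnrm x))"
    proof -
      have "real_of_int (int (nnrm x)) = of_int (a*a + b*b + c*c + d*d)"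
        using real_nnrm[OF lip_hur[OF True]] by (simp add: x nrm_def power2_eq_square)
      then have "int (nnrm x) = a*a + b*b + c*c + d*d" by (simp only: of_int_eq_iff)
      then show ?thesis by (simp add: even_add even_mult_iff)
    qed
    finally show ?thesis using True lip_hur unfolding d4_iff by auto
  next
    case False
    then show ?thesis
      unfolding d4_iff lattice_D4_def using qvec_Z4_iff even_nnrm_lip by auto
  qed
  then show ?thesis by (rule eq_qvec_image)
qed

lemma lattice_index_qvec: "lattice_index (qvec ` L) (qvec ` M) = qindex L M"
proof -
  have "(\<lambda>x. (+) x ` qvec ` M) ` qvec ` L = (`) qvec ` (coset M ` L)"
    by (simp add: image_image coset_def qvec_simps)
  moreover have "inj_on ((`) qvec) (coset M ` L)"
    using inj_qvec by (meson inj_image_eq_iff inj_onI)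
  ultimately show ?thesis unfolding lattice_index_def qindex_def by (simp add: card_image)
qed

lemma SSL_qvec: "SSL (qvec ` L) (qvec ` M) \<longleftrightarrow> QSSL L M"
proof
  assume "SSL (qvec ` L) (qvec ` M)"
  then obtain \<alpha> R where a: "\<alpha> \<noteq> 0" "orthogonal_transformation R" "qvec ` M = (\<lambda>x. \<alpha> *\<^sub>R R x) ` qvec ` L"
    and sub: "qvec ` M \<subseteq> qvec ` L" unfolding SSL_def by blast
  define F where "F x = vquat (\<alpha> *\<^sub>R R (qvec x))" for x
  have lin: "linear R" and nr: "\<And>v. norm (R v) = norm v"
    using a(2) by (auto simp: orthogonal_transformation)
  have "sim F"
    unfolding sim_def
  proof (intro conjI allI exI[of _ "\<alpha>\<^sup>2"])
    fix x y r
    show "F (x + y) = F x + F y" "F (r *\<^sub>R x) = r *\<^sub>R F x"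
      unfolding F_def by (simp_all add: qvec_simps vquat_simps linear_add[OF lin] linear_scale[OF lin] algebra_simps)
    show "nrm (F x) = \<alpha>\<^sup>2 * nrm x"
      unfolding F_def nrm_vquat using nr norm_qvec[of x] by (simp add: power_mult_distrib)
  qed (use a in simp)
  moreover have "M = F ` L"
  proof -
    have "M = vquat ` qvec ` M" by (simp add: image_image)
    also have "\<dots> = F ` L" unfolding a(3) F_def by (simp add: image_image)
    finally show ?thesis .
  qed
  moreover have "M \<subseteq> L" using sub inj_qvec by (simp add: inj_image_subset_iff)
  ultimately show "QSSL L M" unfolding QSSL_def by blast
next
  assume "QSSL L M"
  then obtain F where sub: "M \<subseteq> L" and F: "sim F" "M = F ` L" unfolding QSSL_def by blast
  from F(1) obtain c where c: "c > 0" "\<And>x. nrm (F x) = c * nrm x"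
    and lin: "\<And>x y. F (x + y) = F x + F y" "\<And>r x. F (r *\<^sub>R x) = r *\<^sub>R F x"
    unfolding sim_def by auto
  define R where "R y = (1 / sqrt c) *\<^sub>R qvec (F (vquat y))" for y
  have "linear R"
    by (rule linearI) (simp_all add: R_def lin qvec_simps vquat_simps algebra_simps)
  moreover have "norm (R y) = norm y" for y
  proof -
    have "(norm (qvec (F (vquat y))))\<^sup>2 = (sqrt c * norm y)\<^sup>2"
      unfolding norm_qvec c(2) nrm_vquat using c(1) by (simp add: power_mult_distrib)
    then have "norm (qvec (F (vquat y))) = sqrt c * norm y"
      by (rule power2_eq_imp_eq) (use c(1) in simp_all)
    then show ?thesis unfolding R_def using c(1) by simp
  qed
  ultimately have "orthogonal_transformation R" unfolding orthogonal_transformation by blast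
  moreover have "qvec ` M = (\<lambda>x. sqrt c *\<^sub>R R x) ` qvec ` L"
    unfolding F(2) R_def using c(1) by (simp add: image_image)
  moreover have "sqrt c \<noteq> 0" using c(1) by simp
  ultimately show "SSL (qvec ` L) (qvec ` M)" unfolding SSL_def using sub by blast
qed

lemma SSL_set_qvec:
  "{M. SSL (qvec ` L) M \<and> lattice_index (qvec ` L) M = m} = (`) qvec ` {M. QSSL L M \<and> qindex L M = m}"
proof -
  have surj: "\<exists>M'. M = qvec ` M'" for M
    by (intro exI[of _ "vquat ` M"]) (simp add: image_image)
  show ?thesis
  proof (intro equalityI subsetI)
    fix M assume "M \<in> {M. SSL (qvec ` L) M \<and> lattice_index (qvec ` L) M = m}"
    moreover obtain M' where "M = qvec ` M'" using surj by blast
    ultimately show "M \<in> (`) qvec ` {M. QSSL L M \<and> qindex L M = m}"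
      by (auto simp: SSL_qvec lattice_index_qvec)
  qed (auto simp: SSL_qvec lattice_index_qvec)
qed

lemma inj_image_qvec: "inj ((`) qvec)"
  using inj_qvec by (intro injI) (metis inj_image_eq_iff)

lemma SSL_count_qvec: "SSL_count (qvec ` L) m = card {M. QSSL L M \<and> qindex L M = m}"
  unfolding SSL_count_def SSL_set_qvec
  by (rule card_image) (rule inj_on_subset[OF inj_image_qvec], simp)

lemma hur_ssls_index_square: "M \<in> hur_ssls \<Longrightarrow> \<exists>n>0. qindex hur M = n\<^sup>2"
  unfolding hur_ssls_def using qindex_qlat nnrm_pos by fastforce

lemma lip_ssls_index_square: "M \<in> lip_ssls \<Longrightarrow> \<exists>n>0. qindex lip M = n\<^sup>2"
  unfolding lip_ssls_def using qindex_zlat nnrm_pos by fastforce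

lemma SSL_count_hurwitz:
  "n > 0 \<Longrightarrow> SSL_count hurwitz (n\<^sup>2) = ssl_number n"
  "\<nexists>n. n > 0 \<and> m = n\<^sup>2 \<Longrightarrow> SSL_count hurwitz m = 0"
proof -
  show "SSL_count hurwitz (n\<^sup>2) = ssl_number n" if "n > 0" for n
    unfolding hurwitz_qvec SSL_count_qvec QSSL_hur_iff ssl_number_def ..
  assume "\<nexists>n. n > 0 \<and> m = n\<^sup>2"
  then have "{M. M \<in> hur_ssls \<and> qindex hur M = m} = {}" using hur_ssls_index_square by blast
  then show "SSL_count hurwitz m = 0"
    unfolding hurwitz_qvec SSL_count_qvec QSSL_hur_iff by (metis card.empty)
qed

lemma SSL_count_D4: "SSL_count lattice_D4 m = SSL_count hurwitz m"
  unfolding hurwitz_qvec lattice_D4_qvec SSL_count_qvec card_QSSL_d4 ..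

lemma SSL_count_Z4:
  "n > 0 \<Longrightarrow> SSL_count lattice_Z4 (n\<^sup>2) = ssl_number n * (if even n then 3 else 1)"
  "\<nexists>n. n > 0 \<and> m = n\<^sup>2 \<Longrightarrow> SSL_count lattice_Z4 m = 0"
proof -
  show "SSL_count lattice_Z4 (n\<^sup>2) = ssl_number n * (if even n then 3 else 1)" if "n > 0" for n
    unfolding lattice_Z4_qvec SSL_count_qvec QSSL_lip_iff by (rule card_lip_ssls[OF that])
  assume "\<nexists>n. n > 0 \<and> m = n\<^sup>2"
  then have "{M. M \<in> lip_ssls \<and> qindex lip M = m} = {}" using lip_ssls_index_square by blast
  then show "SSL_count lattice_Z4 m = 0"
    unfolding lattice_Z4_qvec SSL_count_qvec QSSL_lip_iff by (metis card.empty)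
qed

lemma left_ideal_qvec: "hurwitz_left_ideal (qvec ` I) \<longleftrightarrow> left_ideal I"
proof -
  have m: "qvec a \<in> qvec ` A \<longleftrightarrow> a \<in> A" for a A by (rule inj_image_mem_iff[OF inj_qvec])
  have z: "0 \<in> qvec ` I \<longleftrightarrow> 0 \<in> I" using m[of 0 I] by (simp only: qvec_simps)
  have s: "qvec ` I \<subseteq> qvec ` hur \<longleftrightarrow> I \<subseteq> hur" by (rule inj_image_subset_iff[OF inj_qvec])
  show ?thesis
    unfolding hurwitz_left_ideal_def left_ideal_def hurwitz_qvec z s ball_simps(9)
      qvec_simps(5) qvec_simps(2)[symmetric] m ..
qed

section \<open>Indices and multiplicativity\<close>

lemma finite_hur_ssls_index: "finite {M \<in> hur_ssls. qindex hur M = m}"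
proof (cases "\<exists>n>0. m = n\<^sup>2")
  case True
  then show ?thesis using finite_hur_ssls_norm by blast
next
  case False
  then have "{M \<in> hur_ssls. qindex hur M = m} = {}" using hur_ssls_index_square by blast
  then show ?thesis by (metis finite.emptyI)
qed

lemma finite_SSL_hurwitz: "finite {M. SSL hurwitz M \<and> lattice_index hurwitz M = m}"
  unfolding hurwitz_qvec SSL_set_qvec QSSL_hur_iff using finite_hur_ssls_index by simp

lemma finite_SSL_D4: "finite {M. SSL lattice_D4 M \<and> lattice_index lattice_D4 M = m}"
  unfolding lattice_D4_qvec SSL_set_qvec QSSL_d4_set QSSL_hur_iff using finite_hur_ssls_index by simp

lemma finite_SSL_Z4: "finite {M. SSL lattice_Z4 M \<and> lattice_index lattice_Z4 M = m}"
proof -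
  have "finite {M \<in> lip_ssls. qindex lip M = m}"
  proof (cases "\<exists>n>0. m = n\<^sup>2")
    case True
    then obtain n where n: "n > 0" "m = n\<^sup>2" by blast
    \<comment> \<open>An infinite set has \<open>card\<close> 0, so the positive count already
      implies finiteness.\<close>
    then have "card {M \<in> lip_ssls. qindex lip M = m} > 0" using card_lip_ssls ssl_number_pos by simp
    then show ?thesis by (rule card_ge_0_finite)
  next
    case False
    then have "{M \<in> lip_ssls. qindex lip M = m} = {}" using lip_ssls_index_square by blast
    then show ?thesis by (metis finite.emptyI)
  qed
  then show ?thesis unfolding lattice_Z4_qvec SSL_set_qvec QSSL_lip_iff by simp
qed

text \<open>A count of 0 might also stand for infinitely many sublattices; finiteness makes a
  positive count equivalent to existence.\<close>

lemma SSL_indices: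
  assumes fin: "\<And>m. finite {M. SSL L M \<and> lattice_index L M = m}"
    and sq: "\<And>n. n > 0 \<Longrightarrow> SSL_count L (n\<^sup>2) > 0"
    and nsq: "\<And>m. \<nexists>n. n > 0 \<and> m = n\<^sup>2 \<Longrightarrow> SSL_count L m = 0"
  shows "{lattice_index L M | M. SSL L M} = {m. \<exists>k::int. k \<noteq> 0 \<and> int m = k\<^sup>2}"
proof -
  have "m \<in> {lattice_index L M | M. SSL L M} \<longleftrightarrow> (\<exists>k::int. k \<noteq> 0 \<and> int m = k\<^sup>2)" for m
  proof -
    have "m \<in> {lattice_index L M | M. SSL L M} \<longleftrightarrow> SSL_count L m > 0"
      unfolding SSL_count_def card_gt_0_iff using fin[of m] by auto
    also have "\<dots> \<longleftrightarrow> (\<exists>n>0. m = n\<^sup>2)"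
    proof (cases "\<exists>n>0. m = n\<^sup>2")
      case True
      then show ?thesis using sq by blast
    next
      case False
      then show ?thesis using nsq[OF False] by simp
    qed
    also have "\<dots> \<longleftrightarrow> (\<exists>k::int. k \<noteq> 0 \<and> int m = k\<^sup>2)"
    proof
      assume "\<exists>n>0. m = n\<^sup>2"
      then obtain n where "n > 0" "m = n\<^sup>2" by blast
      then show "\<exists>k::int. k \<noteq> 0 \<and> int m = k\<^sup>2" by (intro exI[of _ "int n"]) simp
    next
      assume "\<exists>k::int. k \<noteq> 0 \<and> int m = k\<^sup>2"
      then obtain k :: int where k: "k \<noteq> 0" "int m = k\<^sup>2" by blast
      then have "int m = int ((nat \<bar>k\<bar>)\<^sup>2)" by simp
      then have "m = (nat \<bar>k\<bar>)\<^sup>2" by (simp only: of_nat_eq_iff)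
      then show "\<exists>n>0. m = n\<^sup>2" using k(1) by (intro exI[of _ "nat \<bar>k\<bar>"]) simp
    qed
    finally show ?thesis .
  qed
  then show ?thesis by (intro set_eqI) (simp only: mem_Collect_eq)
qed

text \<open>A product of coprime numbers is a square only if both factors are, so both sides of the
  product rule vanish when one factor is not a square.\<close>

lemma multiplicative_square_supported:
  assumes sq: "\<And>n. n > 0 \<Longrightarrow> f (n\<^sup>2) = g n" and nsq: "\<And>m. \<nexists>n. n > 0 \<and> m = n\<^sup>2 \<Longrightarrow> f m = 0"
    and g1: "g 1 = 1" and gm: "\<And>m n. coprime m n \<Longrightarrow> m > 0 \<Longrightarrow> n > 0 \<Longrightarrow> g (m * n) = g m * g n"
  shows "multiplicative_fun f"
  unfolding multiplicative_fun_def
proof (intro conjI allI impI)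
  show "f 1 = 1" using sq[of 1] g1 by simp
  fix m n :: nat assume mn: "m > 0" "n > 0" "coprime m n"
  show "f (m * n) = f m * f n"
  proof (cases "(\<exists>a. m = a\<^sup>2) \<and> (\<exists>b. n = b\<^sup>2)")
    case True
    then obtain a b where ab: "m = a\<^sup>2" "n = b\<^sup>2" by blast
    then have pos: "a > 0" "b > 0" using mn by auto
    have "coprime a b" using mn(3) unfolding ab by simp
    then have "f ((a * b)\<^sup>2) = g a * g b" using sq[of "a * b"] gm pos by simp
    then show ?thesis unfolding ab using sq pos by (simp add: power_mult_distrib)
  next
    case False
    then have "\<not> (is_square m \<and> is_square n)" by (simp add: is_nth_power_def)
    then have "\<not> is_square (m * n)"
      using is_nth_power_mult_coprime_nat_iff[OF mn(3), of 2] by blast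
    then have "f (m * n) = 0" using nsq[of "m * n"] by (simp add: is_nth_power_def)
    moreover have "f m = 0 \<or> f n = 0" using nsq[of m] nsq[of n] False by auto
    ultimately show ?thesis by auto
  qed
qed

lemma multiplicative_SSL_count:
  "multiplicative_fun (SSL_count hurwitz)" "multiplicative_fun (SSL_count lattice_Z4)"
proof -
  show "multiplicative_fun (SSL_count hurwitz)"
    using SSL_count_hurwitz ssl_number_1 ssl_number_mult by (intro multiplicative_square_supported[of _ ssl_number]) auto
  show "multiplicative_fun (SSL_count lattice_Z4)"
  proof (rule multiplicative_square_supported[of _ "\<lambda>n. ssl_number n * (if even n then 3 else 1)"])
    show "SSL_count lattice_Z4 (n\<^sup>2) = ssl_number n * (if even n then 3 else 1)" if "n > 0" for n
      by (rule SSL_count_Z4(1)[OF that])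
    show "SSL_count lattice_Z4 m = 0" if "\<nexists>n. n > 0 \<and> m = n\<^sup>2" for m
      by (rule SSL_count_Z4(2)[OF that])
    show "ssl_number 1 * (if even (1::nat) then 3 else 1) = 1" using ssl_number_1 by simp
    fix m n :: nat assume "coprime m n" "m > 0" "n > 0"
    moreover have "\<not> (even m \<and> even n)" using \<open>coprime m n\<close> by (meson coprime_common_divisor_nat coprime_common_divisor odd_one)
    ultimately show "ssl_number (m * n) * (if even (m * n) then 3 else 1) =
        ssl_number m * (if even m then 3 else 1) * (ssl_number n * (if even n then 3 else 1))"
      by (auto simp: ssl_number_mult)
  qed
qed

section \<open>Dirichlet series\<close>

abbreviation (input) norm_summable_on :: "('a \<Rightarrow> 'b::real_normed_vector) \<Rightarrow> 'a set \<Rightarrow> bool" (infixr "norm'_summable'_on" 46) where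
  "f norm_summable_on A \<equiv> (\<lambda>x. norm (f x)) summable_on A"

abbreviation (input) nps :: "complex \<Rightarrow> nat \<Rightarrow> complex" where
  "nps w n \<equiv> of_nat n powr (- w)"

text \<open>Complex powers are multiplicative here because the bases are nonnegative reals.\<close>

lemma nps_mult: "nps w (a * b) = nps w a * nps w b"
  by (simp add: powr_times_real)

lemma nps_add: "nps (w + z) n = nps w n * nps z n"
  by (simp add: powr_add[symmetric] algebra_simps)

lemma nps_square: "nps w (n\<^sup>2) = nps (2 * w) n"
  by (simp only: power2_eq_square nps_mult nps_add[symmetric] mult_2)

lemma nps_power: "nps w (a ^ k) = nps w a ^ k"
  by (induction k) (simp_all add: powr_times_real)

lemma nps_minus_1: "n > 0 \<Longrightarrow> nps (w - 1) n = of_nat n * nps w n"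
  using powr_add[of "of_nat n :: complex" 1 "- w"] by simp

lemma norm_nps: "norm (nps w n) = real n powr (- Re w)"
  by (simp add: norm_powr_real_powr)

lemma abs_summable_nps:
  assumes "Re w > 1"
  shows "nps w norm_summable_on {1..}"
proof -
  have "summable (\<lambda>n. norm (norm (nps w n)))"
    unfolding norm_nps using summable_real_powr_iff[of "- Re w"] assms by simp
  then have "(\<lambda>n. norm (nps w n)) summable_on UNIV" by (rule norm_summable_imp_summable_on)
  then show ?thesis by (rule summable_on_subset_banach) simp
qed

lemma zeta_even_part:
  "(\<Sum>\<^sub>\<infinity>n\<in>{n. n \<ge> 1 \<and> even n}. nps w n) = nps w 2 * zeta w"
proof -
  have "bij_betw ((*) 2) {1..} {n::nat. n \<ge> 1 \<and> even n}"
    by (rule bij_betwI[where g = "\<lambda>n. n div 2"]) auto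
  then have "(\<Sum>\<^sub>\<infinity>n\<in>{n. n \<ge> 1 \<and> even n}. nps w n) = (\<Sum>\<^sub>\<infinity>n\<in>{1..}. nps w (2 * n))"
    by (rule infsum_reindex_bij_betw[symmetric])
  also have "\<dots> = nps w 2 * zeta w" unfolding zeta_def nps_mult by (rule infsum_cmult_right')
  finally show ?thesis .
qed

text \<open>Dropping the even terms removes the Euler factor at 2.\<close>

lemma zeta_odd_part:
  assumes "Re w > 1"
  shows "(\<Sum>\<^sub>\<infinity>n | odd n. nps w n) = (1 - nps w 2) * zeta w"
proof -
  have "nps w summable_on {1..}" using abs_summable_nps[OF assms] by (rule abs_summable_summable)
  then have "nps w summable_on {n. odd n}" "nps w summable_on {n. n \<ge> 1 \<and> even n}"
    by (rule summable_on_subset_banach; auto elim: oddE)+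
  then have "infsum (nps w) ({n. odd n} \<union> {n. n \<ge> 1 \<and> even n}) =
      (\<Sum>\<^sub>\<infinity>n | odd n. nps w n) + (\<Sum>\<^sub>\<infinity>n\<in>{n. n \<ge> 1 \<and> even n}. nps w n)"
    by (rule infsum_Un_disjoint) auto
  moreover have "{n. odd n} \<union> {n. n \<ge> 1 \<and> even n} = {1::nat..}" by (auto elim: oddE)
  ultimately show ?thesis unfolding zeta_even_part zeta_def by (simp add: algebra_simps)
qed

section \<open>Products and regrouping of absolutely convergent sums\<close>

lemma abs_summable_Times:
  fixes f :: "'a \<Rightarrow> complex" and g :: "'b \<Rightarrow> complex"
  assumes "f norm_summable_on A" "g norm_summable_on B"
  shows "(\<lambda>p. f (fst p) * g (snd p)) norm_summable_on A \<times> B"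
    "(\<Sum>\<^sub>\<infinity>p\<in>A \<times> B. f (fst p) * g (snd p)) = infsum f A * infsum g B"
proof -
  show *: "(\<lambda>p. f (fst p) * g (snd p)) norm_summable_on A \<times> B"
  proof (rule Infinite_Sum.abs_summable_on_Sigma_iff[where f = "\<lambda>p. f (fst p) * g (snd p)", THEN iffD2], rule conjI)
    show "\<forall>x\<in>A. (\<lambda>y. f (fst (x, y)) * g (snd (x, y))) norm_summable_on B"
      using assms(2) by (simp add: norm_mult summable_on_cmult_right)
    have "(\<lambda>x. norm (f x) * infsum (\<lambda>y. norm (g y)) B) summable_on A"
      using assms(1) by (rule summable_on_cmult_left)
    then show "(\<lambda>x. \<Sum>\<^sub>\<infinity>y\<in>B. norm (f (fst (x, y)) * g (snd (x, y)))) norm_summable_on A"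
      by (simp add: norm_mult infsum_cmult_right' infsum_nonneg abs_mult)
  qed
  show "(\<Sum>\<^sub>\<infinity>p\<in>A \<times> B. f (fst p) * g (snd p)) = infsum f A * infsum g B"
    using infsum_Sigma_banach[OF abs_summable_summable[OF *]]
    by (simp add: infsum_cmult_right' infsum_cmult_left')
qed

lemma bij_fibers:
  assumes "\<And>x. x \<in> X \<Longrightarrow> \<phi> x \<in> Y"
  shows "bij_betw snd (Sigma Y (\<lambda>n. {x \<in> X. \<phi> x = n})) X"
  by (rule bij_betwI[where g = "\<lambda>x. (\<phi> x, x)"]) (use assms in auto)

text \<open>This turns sums over ideals, lattices or pairs into Dirichlet series:
  \<open>\<phi>\<close> will be the norm, the index or the product of a pair.\<close>

lemma infsum_fibers:
  fixes f :: "'a \<Rightarrow> complex"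
  assumes sub: "\<And>x. x \<in> X \<Longrightarrow> \<phi> x \<in> Y" and f: "f norm_summable_on X"
  shows "(\<lambda>n. infsum f {x \<in> X. \<phi> x = n}) norm_summable_on Y"
    "(\<Sum>\<^sub>\<infinity>n\<in>Y. infsum f {x \<in> X. \<phi> x = n}) = infsum f X"
proof -
  note bij = bij_fibers[of X \<phi> Y, OF sub]
  have *: "(\<lambda>p. f (snd p)) norm_summable_on (Sigma Y (\<lambda>n. {x \<in> X. \<phi> x = n}))"
    using summable_on_reindex_bij_betw[OF bij, of "\<lambda>x. norm (f x)"] f by simp
  then have "(\<lambda>n. infsum (\<lambda>x. norm (f x)) {x \<in> X. \<phi> x = n}) norm_summable_on Y"
    using Infinite_Sum.abs_summable_on_Sigma_iff[where f = "\<lambda>p. f (snd p)" and A = Y] by simp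
  then show "(\<lambda>n. infsum f {x \<in> X. \<phi> x = n}) norm_summable_on Y"
  proof (rule Infinite_Sum.abs_summable_on_comparison_test)
    fix n
    have "f norm_summable_on {x \<in> X. \<phi> x = n}" by (rule summable_on_subset_banach[OF f]) auto
    then have "norm (infsum f {x \<in> X. \<phi> x = n}) \<le> infsum (\<lambda>x. norm (f x)) {x \<in> X. \<phi> x = n}"
      by (rule norm_infsum_bound)
    then show "norm (infsum f {x \<in> X. \<phi> x = n}) \<le> norm (infsum (\<lambda>x. norm (f x)) {x \<in> X. \<phi> x = n})"
      by (simp add: order_trans[OF _ abs_ge_self])
  qed
  show "(\<Sum>\<^sub>\<infinity>n\<in>Y. infsum f {x \<in> X. \<phi> x = n}) = infsum f X"
    using infsum_Sigma_banach[OF abs_summable_summable[OF *]] infsum_reindex_bij_betw[OF bij, of f] by simp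
qed

lemma abs_summable_fibers:
  fixes f :: "'a \<Rightarrow> complex"
  assumes sub: "\<And>x. x \<in> X \<Longrightarrow> \<phi> x \<in> Y" and fin: "\<And>n. finite {x \<in> X. \<phi> x = n}"
    and sum: "(\<lambda>n. \<Sum>x | x \<in> X \<and> \<phi> x = n. norm (f x)) summable_on Y"
  shows "f norm_summable_on X"
proof -
  have "(\<lambda>p. f (snd p)) norm_summable_on (Sigma Y (\<lambda>n. {x \<in> X. \<phi> x = n}))"
  proof (rule Infinite_Sum.abs_summable_on_Sigma_iff[where f = "\<lambda>p. f (snd p)", THEN iffD2], rule conjI)
    show "\<forall>n\<in>Y. (\<lambda>x. f (snd (n, x))) norm_summable_on {x \<in> X. \<phi> x = n}" using fin by simp
    show "(\<lambda>n. \<Sum>\<^sub>\<infinity>x\<in>{x \<in> X. \<phi> x = n}. norm (f (snd (n, x)))) norm_summable_on Y"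
      using sum fin by (simp add: sum_nonneg)
  qed
  then show ?thesis using summable_on_reindex_bij_betw[OF bij_fibers[of X \<phi> Y, OF sub], of "\<lambda>x. norm (f x)"] by simp
qed

lemma sum_left_ideals_norm:
  fixes g :: "nat \<Rightarrow> 'b::comm_semiring_1"
  assumes "n \<ge> 1"
  shows "(\<Sum>B | B \<in> left_ideals \<and> lnorm B = n. g (lnorm B)) = of_nat (odd_divisor_sum n) * g n"
proof -
  have "(\<Sum>B | B \<in> left_ideals \<and> lnorm B = n. g (lnorm B)) = (\<Sum>B | B \<in> left_ideals \<and> lnorm B = n. g n)"
    by (rule sum.cong) auto
  then show ?thesis using left_ideal_number_eq_odd_divisor_sum[of n] assms by (simp add: left_ideal_number_def)
qed

section \<open>Series over ideals and sublattices\<close>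

context
  fixes s :: complex
  assumes s: "Re s > 1"
begin

text \<open>The odd divisor sum is the convolution of the identity on odd numbers with the constant
  1. The first factor yields zeta(2s - 1) without its Euler factor at 2, and it converges absolutely
  exactly for \<open>Re s > 1\<close>. The argument 2s reflects that an index is the square of a
  norm.\<close>

lemma odd_divisor_sum_series:
  "(\<lambda>n. of_nat (odd_divisor_sum n) * nps (2 * s) n) norm_summable_on {1..}"
  "(\<Sum>\<^sub>\<infinity>n\<in>{1..}. of_nat (odd_divisor_sum n) * nps (2 * s) n) =
     (1 - 2 powr (1 - 2 * s)) * (zeta (2 * s - 1) * zeta (2 * s))"
proof -
  define f where "f p = nps (2 * s - 1) (fst p) * nps (2 * s) (snd p)" for p
  have odd: "nps (2 * s - 1) norm_summable_on {n. odd n}"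
    by (rule summable_on_subset_banach[OF abs_summable_nps]) (use s in \<open>auto elim: oddE\<close>)
  have all: "nps (2 * s) norm_summable_on {1..}" by (rule abs_summable_nps) (use s in simp)
  note P = abs_summable_Times[OF odd all, folded f_def]
  have fib: "infsum f {p \<in> {n. odd n} \<times> {1..}. fst p * snd p = n} = of_nat (odd_divisor_sum n) * nps (2 * s) n" if "n \<in> {1..}" for n
  proof -
    have n: "n > 0" using that by simp
    have "bij_betw (\<lambda>d. (d, n div d)) {d. d dvd n \<and> odd d} {p \<in> {n. odd n} \<times> {1..}. fst p * snd p = n}"
      by (rule bij_betwI[where g = fst]) (use n in \<open>auto simp: Suc_le_eq dvd_div_pos\<close>)
    then have "infsum f {p \<in> {n. odd n} \<times> {1..}. fst p * snd p = n} = infsum (\<lambda>d. f (d, n div d)) {d. d dvd n \<and> odd d}"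
      by (rule infsum_reindex_bij_betw[symmetric])
    also have "\<dots> = (\<Sum>d | d dvd n \<and> odd d. f (d, n div d))" using n by simp
    also have "\<dots> = (\<Sum>d | d dvd n \<and> odd d. of_nat d * nps (2 * s) n)"
    proof (rule sum.cong[OF refl])
      fix d assume "d \<in> {d. d dvd n \<and> odd d}"
      then have d: "d > 0" "n = d * (n div d)" by (auto elim: oddE)
      have "f (d, n div d) = of_nat d * (nps (2 * s) d * nps (2 * s) (n div d))"
        unfolding f_def using nps_minus_1[OF d(1), of "2 * s"] by simp
      also have "nps (2 * s) d * nps (2 * s) (n div d) = nps (2 * s) (d * (n div d))"
        by (rule nps_mult[symmetric])
      finally show "f (d, n div d) = of_nat d * nps (2 * s) n" using d(2) by simp
    qed
    finally show ?thesis by (simp add: odd_divisor_sum_def sum_distrib_right)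
  qed
  have sub: "fst p * snd p \<in> {1..}" if "p \<in> {n. odd n} \<times> {1..}" for p :: "nat \<times> nat"
    using that by (auto elim: oddE simp: Suc_le_eq)
  have F: "(\<lambda>n. infsum f {p \<in> {n. odd n} \<times> {1..}. fst p * snd p = n}) norm_summable_on {1..}"
    "(\<Sum>\<^sub>\<infinity>n\<in>{1..}. infsum f {p \<in> {n. odd n} \<times> {1..}. fst p * snd p = n}) = infsum f ({n. odd n} \<times> {1..})"
    by (rule infsum_fibers[OF _ P(1)], rule sub, assumption)+
  show "(\<lambda>n. of_nat (odd_divisor_sum n) * nps (2 * s) n) norm_summable_on {1..}"
    using F(1) by (rule summable_on_cong[THEN iffD1, rotated]) (rule arg_cong[where f = norm], rule fib)
  have "(\<Sum>\<^sub>\<infinity>n\<in>{1..}. of_nat (odd_divisor_sum n) * nps (2 * s) n) = infsum f ({n. odd n} \<times> {1..})"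
    unfolding F(2)[symmetric] by (rule infsum_cong) (rule fib[symmetric])
  also have "\<dots> = (1 - nps (2 * s - 1) 2) * zeta (2 * s - 1) * zeta (2 * s)"
    unfolding P(2) zeta_def[of "2 * s", symmetric] using zeta_odd_part[of "2 * s - 1"] s by simp
  finally show "(\<Sum>\<^sub>\<infinity>n\<in>{1..}. of_nat (odd_divisor_sum n) * nps (2 * s) n) =
     (1 - 2 powr (1 - 2 * s)) * (zeta (2 * s - 1) * zeta (2 * s))" by simp
qed

lemma left_ideals_series:
  "(\<lambda>B. nps (2 * s) (lnorm B)) norm_summable_on left_ideals"
  "(\<Sum>\<^sub>\<infinity>B\<in>left_ideals. nps (2 * s) (lnorm B)) = (1 - 2 powr (1 - 2 * s)) * (zeta (2 * s - 1) * zeta (2 * s))"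
proof -
  have sub: "lnorm B \<in> {1..}" if "B \<in> left_ideals" for B using lnorm_pos[OF that] by simp
  show abs: "(\<lambda>B. nps (2 * s) (lnorm B)) norm_summable_on left_ideals"
  proof (rule abs_summable_fibers[where \<phi> = lnorm, OF sub finite_left_ideals_norm])
    show "(\<lambda>n. \<Sum>B | B \<in> left_ideals \<and> lnorm B = n. norm (nps (2 * s) (lnorm B))) summable_on {1..}"
      using odd_divisor_sum_series(1)
    proof (rule summable_on_cong[THEN iffD1, rotated])
      fix n :: nat assume "n \<in> {1..}"
      then have n: "n \<ge> 1" by simp
      show "norm (of_nat (odd_divisor_sum n) * nps (2 * s) n) = (\<Sum>B | B \<in> left_ideals \<and> lnorm B = n. norm (nps (2 * s) (lnorm B)))"
        unfolding sum_left_ideals_norm[OF n, of "\<lambda>n. norm (nps (2 * s) n)"] norm_mult norm_of_nat ..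
    qed
  qed
  have "(\<Sum>\<^sub>\<infinity>B\<in>left_ideals. nps (2 * s) (lnorm B)) =
      (\<Sum>\<^sub>\<infinity>n\<in>{1..}. \<Sum>\<^sub>\<infinity>B\<in>{B \<in> left_ideals. lnorm B = n}. nps (2 * s) (lnorm B))"
    by (rule infsum_fibers(2)[where \<phi> = lnorm, OF sub abs, symmetric])
  also have "\<dots> = (\<Sum>\<^sub>\<infinity>n\<in>{1..}. of_nat (odd_divisor_sum n) * nps (2 * s) n)"
  proof (rule infsum_cong)
    fix n :: nat assume "n \<in> {1..}"
    then show "infsum (\<lambda>B. nps (2 * s) (lnorm B)) {B \<in> left_ideals. lnorm B = n} = of_nat (odd_divisor_sum n) * nps (2 * s) n"
      using sum_left_ideals_norm[of n "nps (2 * s)"] by (simp add: infsum_finite[OF finite_left_ideals_norm])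
  qed
  finally show "(\<Sum>\<^sub>\<infinity>B\<in>left_ideals. nps (2 * s) (lnorm B)) = (1 - 2 powr (1 - 2 * s)) * (zeta (2 * s - 1) * zeta (2 * s))"
    unfolding odd_divisor_sum_series(2) .
qed

lemma norm_nps_4: "norm (nps s 4) < 1"
  using s by (simp add: norm_powr_real_powr powr_less_one)

text \<open>With x = 4^(-s) the sum over powers of \<open>\<theta>\<close> is 1 / (1 - x), and the
  sum over odd m is (1 - x^2) zeta(4s); the factor 1 - x cancels.\<close>

lemma two_sided_series:
  "(\<Sum>\<^sub>\<infinity>p\<in>UNIV \<times> {m. odd m}. nps (2 * s) (2 ^ fst p * (snd p)\<^sup>2)) = (1 + nps s 4) * zeta (4 * s)"
proof -
  define x where "x = nps s 4"
  have x2: "nps (2 * s) 2 = x" unfolding x_def nps_square[symmetric] by simp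
  have x4: "nps (4 * s) 2 = x\<^sup>2" using nps_add[of 2 "2 * s" "2 * s"] unfolding x2 by (simp add: power2_eq_square)
  have x1: "norm x < 1" unfolding x_def by (rule norm_nps_4)
  have "summable (\<lambda>k. norm (x ^ k))" using x1 by (simp add: norm_power summable_geometric)
  then have "((\<lambda>k. x ^ k) has_sum (1 / (1 - x))) UNIV" "(\<lambda>k. norm (x ^ k)) summable_on UNIV"
    using geometric_sums[OF x1] norm_summable_imp_has_sum norm_summable_imp_summable_on[of "\<lambda>k. norm (x ^ k)"] by auto
  then have geo: "(\<Sum>\<^sub>\<infinity>k. x ^ k) = 1 / (1 - x)" "(\<lambda>k. x ^ k) norm_summable_on UNIV"
    by (simp_all add: infsumI)
  have odd: "nps (4 * s) norm_summable_on {n. odd n}"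
    by (rule summable_on_subset_banach[OF abs_summable_nps]) (use s in \<open>auto elim: oddE\<close>)
  have "nps (2 * s) (2 ^ fst p * (snd p)\<^sup>2) = x ^ fst p * nps (4 * s) (snd p)" for p
    unfolding nps_mult nps_square unfolding nps_power x2 by simp
  then have "(\<Sum>\<^sub>\<infinity>p\<in>UNIV \<times> {m. odd m}. nps (2 * s) (2 ^ fst p * (snd p)\<^sup>2)) =
      1 / (1 - x) * ((1 - x\<^sup>2) * zeta (4 * s))" (is "?T = _")
    using abs_summable_Times(2)[OF geo(2) odd] zeta_odd_part[of "4 * s"] s unfolding geo(1) x4 by simp
  also have "1 - x\<^sup>2 = (1 - x) * (1 + x)" by (simp add: power2_eq_square algebra_simps)
  also have "1 / (1 - x) * ((1 - x) * (1 + x) * zeta (4 * s)) = (1 + x) * zeta (4 * s)"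
    using x1 by auto
  finally show ?thesis unfolding x_def .
qed

lemma left_ideals_series_factor:
  "(\<Sum>\<^sub>\<infinity>B\<in>left_ideals. nps (2 * s) (lnorm B)) =
    (1 + nps s 4) * zeta (4 * s) * (\<Sum>\<^sub>\<infinity>B\<in>prim_ideals. nps (2 * s) (lnorm B))"
proof -
  define f where "f p = nps (2 * s) (2 ^ fst (fst p) * (snd (fst p))\<^sup>2) * nps (2 * s) (lnorm (snd p))" for p
  let ?D = "(UNIV \<times> {m::nat. odd m}) \<times> prim_ideals"
  have f: "nps (2 * s) (lnorm (ts_ideal p)) = f p" if "p \<in> ?D" for p
    using that unfolding f_def nps_mult[symmetric] by (auto simp: lnorm_ts_ideal simp del: of_nat_mult)
  have "(\<lambda>p. nps (2 * s) (lnorm (ts_ideal p))) summable_on ?D"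
    using summable_on_reindex_bij_betw[OF bij_ts_ideal, of "\<lambda>B. nps (2 * s) (lnorm B)"]
      abs_summable_summable[OF left_ideals_series(1)] by simp
  then have sm: "f summable_on ?D" by (rule summable_on_cong[THEN iffD1, rotated]) (rule f)
  have "(\<Sum>\<^sub>\<infinity>B\<in>left_ideals. nps (2 * s) (lnorm B)) = infsum f ?D"
    unfolding infsum_reindex_bij_betw[OF bij_ts_ideal, symmetric] by (rule infsum_cong) (rule f)
  also have "\<dots> = (\<Sum>\<^sub>\<infinity>p\<in>UNIV \<times> {m. odd m}. nps (2 * s) (2 ^ fst p * (snd p)\<^sup>2)) * (\<Sum>\<^sub>\<infinity>B\<in>prim_ideals. nps (2 * s) (lnorm B))"
    unfolding infsum_Sigma_banach[OF sm, symmetric] f_def fst_conv snd_conv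
    by (simp only: infsum_cmult_right' infsum_cmult_left')
  finally show ?thesis unfolding two_sided_series .
qed

lemma hur_ssls_series:
  "(\<lambda>M. nps s (qindex hur M)) norm_summable_on hur_ssls"
  "(\<Sum>\<^sub>\<infinity>M\<in>hur_ssls. nps s (qindex hur M)) =
    (\<Sum>\<^sub>\<infinity>B\<in>left_ideals. nps (2 * s) (lnorm B)) * (\<Sum>\<^sub>\<infinity>B\<in>prim_ideals. nps (2 * s) (lnorm B))"
proof -
  define f where "f p = nps (2 * s) (lnorm (fst p)) * nps (2 * s) (lnorm (snd p))" for p
  have f: "nps s (qindex hur (pair_lat p)) = f p" if "p \<in> left_ideals \<times> prim_ideals" for p
    using that unfolding f_def nps_mult[symmetric] nps_square[symmetric]
    by (auto simp: qindex_pair_lat power_mult_distrib simp del: of_nat_mult of_nat_power)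
  have prim_ideals: "(\<lambda>B. nps (2 * s) (lnorm B)) norm_summable_on prim_ideals"
    by (rule summable_on_subset_banach[OF left_ideals_series(1) prim_ideals_subset_left_ideals])
  note P = abs_summable_Times[OF left_ideals_series(1) prim_ideals, folded f_def]
  have "(\<lambda>p. norm (nps s (qindex hur (pair_lat p)))) summable_on left_ideals \<times> prim_ideals"
    using P(1) by (rule summable_on_cong[THEN iffD1, rotated]) (simp only: f)
  then show "(\<lambda>M. nps s (qindex hur M)) norm_summable_on hur_ssls"
    unfolding summable_on_reindex_bij_betw[OF bij_pair_lat, of "\<lambda>M. norm (nps s (qindex hur M))"] .
  show "(\<Sum>\<^sub>\<infinity>M\<in>hur_ssls. nps s (qindex hur M)) =
    (\<Sum>\<^sub>\<infinity>B\<in>left_ideals. nps (2 * s) (lnorm B)) * (\<Sum>\<^sub>\<infinity>B\<in>prim_ideals. nps (2 * s) (lnorm B))"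
    unfolding infsum_reindex_bij_betw[OF bij_pair_lat, symmetric] P(2)[symmetric]
    by (rule infsum_cong) (rule f)
qed

lemma SSL_series_hurwitz:
  "(\<lambda>m. of_nat (SSL_count hurwitz m) * nps s m) norm_summable_on {1..}"
  "SSL_series hurwitz s = (\<Sum>\<^sub>\<infinity>M\<in>hur_ssls. nps s (qindex hur M))"
proof -
  have sub: "qindex hur M \<in> {1..}" if "M \<in> hur_ssls" for M
    using hur_ssls_index_square[OF that] by (auto simp: Suc_le_eq)
  have fib: "infsum (\<lambda>M. nps s (qindex hur M)) {M \<in> hur_ssls. qindex hur M = m} = of_nat (SSL_count hurwitz m) * nps s m" for m
  proof -
    have "infsum (\<lambda>M. nps s (qindex hur M)) {M \<in> hur_ssls. qindex hur M = m} = (\<Sum>M\<in>{M \<in> hur_ssls. qindex hur M = m}. nps s m)"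
      unfolding infsum_finite[OF finite_hur_ssls_index] by (rule sum.cong) auto
    then show ?thesis unfolding hurwitz_qvec SSL_count_qvec QSSL_hur_iff by simp
  qed
  note F = infsum_fibers[where \<phi> = "qindex hur", OF sub hur_ssls_series(1)]
  show "(\<lambda>m. of_nat (SSL_count hurwitz m) * nps s m) norm_summable_on {1..}"
    using F(1) unfolding fib .
  show "SSL_series hurwitz s = (\<Sum>\<^sub>\<infinity>M\<in>hur_ssls. nps s (qindex hur M))"
    using F(2) unfolding fib SSL_series_def .
qed

lemma hurwitz_ideals: "{I. hurwitz_left_ideal I \<and> I \<noteq> {0}} = (`) qvec ` left_ideals"
proof -
  have left_ideals: "I \<in> left_ideals \<longleftrightarrow> left_ideal I \<and> I \<noteq> {0}" for I
  proof
    assume "I \<in> left_ideals"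
    then obtain b where "b \<in> hur" "b \<noteq> 0" "I = lid b" unfolding left_ideals_def by blast
    moreover from this have "b \<in> I" by simp
    ultimately show "left_ideal I \<and> I \<noteq> {0}" using left_ideal_lid by blast
  next
    assume "left_ideal I \<and> I \<noteq> {0}"
    then show "I \<in> left_ideals" using left_ideal_principal lid_left_ideals by metis
  qed
  have "qvec ` I = {0} \<longleftrightarrow> I = {0}" for I
    using inj_image_eq_iff[OF inj_qvec, of I "{0}"] by (simp add: qvec_simps)
  then have iff: "hurwitz_left_ideal (qvec ` I) \<and> qvec ` I \<noteq> {0} \<longleftrightarrow> I \<in> left_ideals" for I
    unfolding left_ideal_qvec left_ideals by simp
  have "I \<in> (`) qvec ` left_ideals" if "hurwitz_left_ideal I" "I \<noteq> {0}" for I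
  proof -
    have "I = qvec ` vquat ` I" by (simp add: image_image)
    then show ?thesis using iff that by (metis imageI)
  qed
  then show ?thesis using iff by auto
qed

lemma zeta_J_series:
  "(\<lambda>I. of_nat (lattice_index hurwitz I) powr (- s)) norm_summable_on {I. hurwitz_left_ideal I \<and> I \<noteq> {0}}"
  "zeta_J s = (\<Sum>\<^sub>\<infinity>B\<in>left_ideals. nps (2 * s) (lnorm B))"
proof -
  have bij: "bij_betw ((`) qvec) left_ideals {I. hurwitz_left_ideal I \<and> I \<noteq> {0}}"
    unfolding hurwitz_ideals by (rule inj_on_imp_bij_betw) (rule inj_on_subset[OF inj_image_qvec], simp)
  have f: "nps s (lattice_index hurwitz (qvec ` B)) = nps (2 * s) (lnorm B)" if "B \<in> left_ideals" for B
  proof -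
    have "qindex hur B = (lnorm B)\<^sup>2" using qindex_lid[OF lgen(1,2)[OF that]] lgen(3)[OF that] by (simp add: lnorm_def)
    then show ?thesis unfolding hurwitz_qvec lattice_index_qvec by (simp only: nps_square)
  qed
  have "(\<lambda>B. norm (nps s (lattice_index hurwitz (qvec ` B)))) summable_on left_ideals"
    using left_ideals_series(1) by (rule summable_on_cong[THEN iffD1, rotated]) (simp only: f)
  then show "(\<lambda>I. of_nat (lattice_index hurwitz I) powr (- s)) norm_summable_on {I. hurwitz_left_ideal I \<and> I \<noteq> {0}}"
    unfolding summable_on_reindex_bij_betw[OF bij, of "\<lambda>I. norm (nps s (lattice_index hurwitz I))"] .
  show "zeta_J s = (\<Sum>\<^sub>\<infinity>B\<in>left_ideals. nps (2 * s) (lnorm B))"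
    unfolding zeta_J_def infsum_reindex_bij_betw[OF bij, symmetric] by (rule infsum_cong) (rule f)
qed

text \<open>For m = n^2 with n even, the factor 3 splits as 1 + 2, and by
  \<open>ssl_number_double\<close> the part with 2 may be read off at n / 2, that is at index m / 4.
  This is the coefficient form of the factor 1 + 2/4^s.\<close>

lemma SSL_count_Z4_rec:
  assumes "m \<ge> 1"
  shows "SSL_count lattice_Z4 m = SSL_count hurwitz m + (if 4 dvd m then 2 * SSL_count hurwitz (m div 4) else 0)"
proof (cases "\<exists>n>0. m = n\<^sup>2")
  case True
  then obtain n where n: "n > 0" "m = n\<^sup>2" by blast
  show ?thesis
  proof (cases "even n")
    case True
    then obtain k where k: "n = 2 * k" by blast
    then have "m = 4 * k\<^sup>2" "k > 0" using n by (simp_all add: power_mult_distrib)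
    then show ?thesis
      using SSL_count_Z4(1)[OF n(1)] SSL_count_hurwitz(1)[OF n(1)] SSL_count_hurwitz(1)[of k] ssl_number_double[of k]
      unfolding n(2)[symmetric] by (simp add: k)
  next
    case False
    then have "\<not> 4 dvd m" unfolding n(2) by (metis dvd_trans even_numeral even_power numeral_Bit0 dvd_add_right_iff dvd_refl)
    then show ?thesis using SSL_count_Z4(1)[OF n(1)] SSL_count_hurwitz(1)[OF n(1)] False by (simp add: n(2))
  qed
next
  case False
  have "SSL_count hurwitz (m div 4) = 0" if "4 dvd m"
  proof (rule SSL_count_hurwitz(2), rule notI)
    assume "\<exists>k>0. m div 4 = k\<^sup>2"
    then obtain k where "k > 0" "m div 4 = k\<^sup>2" by blast
    then have "m = (2 * k)\<^sup>2" "2 * k > 0" using that by (auto simp: power_mult_distrib)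
    then show False using False by blast
  qed
  then show ?thesis using SSL_count_Z4(2) SSL_count_hurwitz(2) False by simp
qed

lemma SSL_series_Z4:
  "(\<lambda>m. of_nat (SSL_count lattice_Z4 m) * nps s m) summable_on {1..}"
  "SSL_series lattice_Z4 s = (1 + 2 * nps s 4) * SSL_series hurwitz s"
proof -
  define f where "f m = of_nat (SSL_count hurwitz m) * nps s m" for m
  \<comment> \<open>Supported on multiples of 4, so that the substitution m = 4k extracts the factor
    2/4^s.\<close>
  define g where "g m = (if 4 dvd m then 2 * of_nat (SSL_count hurwitz (m div 4)) * nps s m else 0)" for m
  have f: "(f has_sum SSL_series hurwitz s) {1..}"
    unfolding SSL_series_def f_def by (rule has_sum_infsum, rule abs_summable_summable, rule SSL_series_hurwitz(1))
  have bij: "bij_betw ((*) 4) {1..} {m::nat. m \<ge> 1 \<and> 4 dvd m}"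
    by (rule bij_betwI[where g = "\<lambda>n. n div 4"]) auto
  have "g (4 * k) = 2 * nps s 4 * f k" for k
    unfolding g_def f_def nps_mult by simp
  then have "((\<lambda>k. g (4 * k)) has_sum (2 * nps s 4 * SSL_series hurwitz s)) {1..}"
    using has_sum_cmult_right[OF f, of "2 * nps s 4"] by simp
  then have "(g has_sum (2 * nps s 4 * SSL_series hurwitz s)) {m. m \<ge> 1 \<and> 4 dvd m}"
    using has_sum_reindex_bij_betw[OF bij, of g] by simp
  moreover have "(g has_sum x) {m. m \<ge> 1 \<and> 4 dvd m} \<longleftrightarrow> (g has_sum x) {1..}" for x
    by (rule has_sum_cong_neutral) (auto simp: g_def)
  ultimately have fg: "((\<lambda>m. f m + g m) has_sum (SSL_series hurwitz s + 2 * nps s 4 * SSL_series hurwitz s)) {1..}"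
    using f by (intro has_sum_add) auto
  have cong: "f m + g m = of_nat (SSL_count lattice_Z4 m) * nps s m" if "m \<in> {1..}" for m
    using SSL_count_Z4_rec[of m] that unfolding f_def g_def by (simp add: algebra_simps)
  have *: "((\<lambda>m. of_nat (SSL_count lattice_Z4 m) * nps s m) has_sum
      (SSL_series hurwitz s + 2 * nps s 4 * SSL_series hurwitz s)) {1..}"
    using fg by (rule has_sum_cong[THEN iffD1, rotated]) (rule cong)
  then show "(\<lambda>m. of_nat (SSL_count lattice_Z4 m) * nps s m) summable_on {1..}" by (rule has_sum_imp_summable)
  show "SSL_series lattice_Z4 s = (1 + 2 * nps s 4) * SSL_series hurwitz s"
    using infsumI[OF *] unfolding SSL_series_def[of lattice_Z4] by (simp add: algebra_simps)
qed

text \<open>The terms from n = 2 on contribute at most 1/2 in absolute value, less than the leading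
  1. This follows from N^(-4) <= 1 / (2 N (N - 1)) for N >= 2, half of a telescoping
  difference.\<close>

lemma zeta_4s_nonzero: "zeta (4 * s) \<noteq> 0"
proof -
  have bound: "norm (nps (4 * s) (Suc n)) \<le> 1 / 2 * (inverse (real n) - inverse (real (Suc n)))" if "n \<in> {1..}" for n
  proof -
    define N where "N = real (Suc n)"
    have N: "N \<ge> 2" "real n = N - 1" using that by (simp_all add: N_def)
    have "norm (nps (4 * s) (Suc n)) = N powr (- (4 * Re s))" unfolding norm_nps N_def by simp
    also have "\<dots> \<le> N powr (- 4)" using N s by (intro powr_mono) simp_all
    also have "\<dots> = inverse (N ^ 4)" using N by (simp add: powr_minus powr_numeral)
    also have "\<dots> \<le> inverse (2 * (N * (N - 1)))"
    proof (rule le_imp_inverse_le)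
      have "2 \<le> N\<^sup>2" using power_mono[of 2 N 2] N by simp
      moreover have "N * (N - 1) \<le> N\<^sup>2" using N by (simp add: power2_eq_square algebra_simps)
      ultimately have "2 * (N * (N - 1)) \<le> N\<^sup>2 * N\<^sup>2" using N by (intro mult_mono) simp_all
      then show "2 * (N * (N - 1)) \<le> N ^ 4" by (simp add: power2_eq_square power4_eq_xxxx)
    qed (use N in simp)
    also have "\<dots> = 1 / 2 * (inverse (N - 1) - inverse N)" using N by (simp add: field_simps)
    finally show ?thesis unfolding N(2) N_def .
  qed
  have tele: "((\<lambda>n. 1 / 2 * (inverse (real n) - inverse (real (Suc n)))) has_sum (1 / 2)) {1..}"
  proof -
    have "(\<lambda>n. inverse (real (Suc n)) - inverse (real (Suc (Suc n)))) sums (inverse (real (Suc 0)) - 0)"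
      by (rule telescope_sums') (rule LIMSEQ_inverse_real_of_nat)
    then have "(\<lambda>n. 1 / 2 * (inverse (real (Suc n)) - inverse (real (Suc (Suc n))))) sums (1 / 2 * 1)"
      by (intro sums_mult) simp
    then have "((\<lambda>n. 1 / 2 * (inverse (real (Suc n)) - inverse (real (Suc (Suc n))))) has_sum (1 / 2)) UNIV"
      by (intro sums_nonneg_imp_has_sum) (simp_all add: field_simps)
    moreover have "bij_betw Suc UNIV {1..}"
      by (rule bij_betwI[where g = "\<lambda>n. n - 1"]) auto
    ultimately show ?thesis
      using has_sum_reindex_bij_betw[of Suc UNIV "{1..}" "\<lambda>n. 1 / 2 * (inverse (real n) - inverse (real (Suc n)))"] by simp
  qed
  have abs: "nps (4 * s) norm_summable_on {1..}" by (rule abs_summable_nps) (use s in simp)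
  have bij: "bij_betw Suc {1..} {2..}" by (rule bij_betwI[where g = "\<lambda>n. n - 1"]) auto
  have abs2: "nps (4 * s) norm_summable_on {2..}" by (rule summable_on_subset_banach[OF abs]) auto
  have "norm (infsum (nps (4 * s)) {2..}) \<le> (\<Sum>\<^sub>\<infinity>n\<in>{2..}. norm (nps (4 * s) n))"
    by (rule norm_infsum_bound[OF abs2])
  also have "\<dots> = (\<Sum>\<^sub>\<infinity>n\<in>{1..}. norm (nps (4 * s) (Suc n)))"
    by (rule infsum_reindex_bij_betw[OF bij, symmetric])
  also have "\<dots> \<le> (\<Sum>\<^sub>\<infinity>n\<in>{1..}. 1 / 2 * (inverse (real n) - inverse (real (Suc n))))"
  proof (rule infsum_mono)
    show "(\<lambda>n. norm (nps (4 * s) (Suc n))) summable_on {1..}"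
      using abs2 summable_on_reindex_bij_betw[OF bij, of "\<lambda>n. norm (nps (4 * s) n)"] by simp
    show "(\<lambda>n. 1 / 2 * (inverse (real n) - inverse (real (Suc n)))) summable_on {1..}"
      using tele by (rule has_sum_imp_summable)
  qed (rule bound)
  also have "\<dots> = 1 / 2" using tele by (rule infsumI)
  finally have small: "norm (infsum (nps (4 * s)) {2..}) \<le> 1 / 2" .
  have "zeta (4 * s) = infsum (nps (4 * s)) ({1} \<union> {2..})"
    unfolding zeta_def by (rule arg_cong[where f = "infsum _"]) auto
  also have "\<dots> = infsum (nps (4 * s)) {1} + infsum (nps (4 * s)) {2..}"
    by (rule infsum_Un_disjoint) (use abs_summable_summable[OF abs2] in auto)
  finally have eq: "zeta (4 * s) = 1 + infsum (nps (4 * s)) {2..}" by simp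
  show ?thesis
  proof
    assume "zeta (4 * s) = 0"
    then have "infsum (nps (4 * s)) {2..} = - 1" using eq by (simp add: eq_neg_iff_add_eq_0 add.commute)
    then show False using small by simp
  qed
qed

lemma SSL_series_hurwitz_formula:
  "SSL_series hurwitz s = (zeta_J s)\<^sup>2 / ((1 + 4 powr (- s)) * zeta (4 * s))"
  "SSL_series hurwitz s = (1 - 2 powr (1 - 2 * s))\<^sup>2 / (1 + 4 powr (- s)) *
     ((zeta (2 * s) * zeta (2 * s - 1))\<^sup>2 / zeta (4 * s))"
proof -
  define T where "T = (1 + nps s 4) * zeta (4 * s)"
  \<comment> \<open>Together with \<open>zeta_4s_nonzero\<close> this permits division by
    \<open>T\<close>; it holds because 4^(-s) has absolute value below 1.\<close>
  have "1 + nps s 4 \<noteq> 0"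
  proof
    assume "1 + nps s 4 = 0"
    then have "nps s 4 = - 1" by (simp add: eq_neg_iff_add_eq_0 add.commute)
    then show False using norm_nps_4 by simp
  qed
  then have T: "T \<noteq> 0" unfolding T_def using zeta_4s_nonzero by simp
  define A where "A = (\<Sum>\<^sub>\<infinity>B\<in>prim_ideals. nps (2 * s) (lnorm B))"
  have zJ: "zeta_J s = T * A" unfolding zeta_J_series(2) left_ideals_series_factor T_def A_def ..
  have "SSL_series hurwitz s = zeta_J s * A"
    unfolding SSL_series_hurwitz(2) hur_ssls_series(2) zeta_J_series(2) A_def ..
  then have "SSL_series hurwitz s = (zeta_J s)\<^sup>2 / T"
    using T by (simp add: zJ power2_eq_square)
  then show *: "SSL_series hurwitz s = (zeta_J s)\<^sup>2 / ((1 + 4 powr (- s)) * zeta (4 * s))"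
    unfolding T_def by simp
  have "zeta_J s = (1 - 2 powr (1 - 2 * s)) * (zeta (2 * s) * zeta (2 * s - 1))"
    unfolding zeta_J_series(2) left_ideals_series(2) by (simp add: mult.commute)
  then show "SSL_series hurwitz s = (1 - 2 powr (1 - 2 * s))\<^sup>2 / (1 + 4 powr (- s)) *
     ((zeta (2 * s) * zeta (2 * s - 1))\<^sup>2 / zeta (4 * s))"
    unfolding * by (simp add: power_mult_distrib)
qed

end

theorem theorem2:
  shows
    "(\<forall>L\<in>{hurwitz, lattice_D4, lattice_Z4}.
        {lattice_index L M | M. SSL L M} = {m. \<exists>k::int. k \<noteq> 0 \<and> int m = k\<^sup>2}) \<and>
     (\<forall>L\<in>{hurwitz, lattice_D4, lattice_Z4}.
        (\<forall>m\<ge>1. finite {M. SSL L M \<and> lattice_index L M = m}) \<and>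
        multiplicative_fun (SSL_count L)) \<and>
     (\<forall>s. Re s > 1 \<longrightarrow>
        (\<forall>L\<in>{hurwitz, lattice_D4, lattice_Z4}.
           (\<lambda>m. of_nat (SSL_count L m) * of_nat m powr (- s) :: complex) summable_on {1..}) \<and>
        (\<lambda>I. of_nat (lattice_index hurwitz I) powr (- s) :: complex)
           summable_on {I. hurwitz_left_ideal I \<and> I \<noteq> {0}} \<and>
        SSL_series hurwitz s = (zeta_J s)\<^sup>2 / ((1 + 4 powr (- s)) * zeta (4 * s)) \<and>
        SSL_series hurwitz s =
          (1 - 2 powr (1 - 2 * s))\<^sup>2 / (1 + 4 powr (- s)) *
          ((zeta (2 * s) * zeta (2 * s - 1))\<^sup>2 / zeta (4 * s)) \<and>
        SSL_series lattice_D4 s = SSL_series hurwitz s \<and>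
        SSL_series lattice_Z4 s = (1 + 2 / 4 powr s) * SSL_series hurwitz s)"
proof -
  have D4: "SSL_count lattice_D4 = SSL_count hurwitz" using SSL_count_D4 by blast
  have D4s: "SSL_series lattice_D4 s = SSL_series hurwitz s" for s unfolding SSL_series_def D4 ..
  have ih: "{lattice_index hurwitz M | M. SSL hurwitz M} = {m. \<exists>k::int. k \<noteq> 0 \<and> int m = k\<^sup>2}"
    by (rule SSL_indices[OF finite_SSL_hurwitz _ SSL_count_hurwitz(2)]) (simp_all add: SSL_count_hurwitz ssl_number_pos)
  have id: "{lattice_index lattice_D4 M | M. SSL lattice_D4 M} = {m. \<exists>k::int. k \<noteq> 0 \<and> int m = k\<^sup>2}"
  proof (rule SSL_indices[OF finite_SSL_D4])
    show "SSL_count lattice_D4 (n\<^sup>2) > 0" if "n > 0" for n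
      unfolding D4 SSL_count_hurwitz(1)[OF that] by (rule ssl_number_pos[OF that])
    show "SSL_count lattice_D4 m = 0" if "\<nexists>n. n > 0 \<and> m = n\<^sup>2" for m
      unfolding D4 by (rule SSL_count_hurwitz(2)[OF that])
  qed
  have iz: "{lattice_index lattice_Z4 M | M. SSL lattice_Z4 M} = {m. \<exists>k::int. k \<noteq> 0 \<and> int m = k\<^sup>2}"
    by (rule SSL_indices[OF finite_SSL_Z4 _ SSL_count_Z4(2)]) (simp_all add: SSL_count_Z4 ssl_number_pos)
  have sh: "(\<lambda>m. of_nat (SSL_count hurwitz m) * nps s m) summable_on {1..}" if "Re s > 1" for s
    using SSL_series_hurwitz(1)[OF that] by (rule abs_summable_summable)
  have four: "1 + 2 / 4 powr s = 1 + 2 * nps s 4" for s :: complex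
    by (simp add: powr_minus divide_inverse)
  have sJ: "(\<lambda>I. of_nat (lattice_index hurwitz I) powr (- s) :: complex)
      summable_on {I. hurwitz_left_ideal I \<and> I \<noteq> {0}}" if "Re s > 1" for s
    using zeta_J_series(1)[OF that] by (rule abs_summable_summable)
  show ?thesis
  proof (intro conjI allI impI ballI)
    fix L assume L: "L \<in> {hurwitz, lattice_D4, lattice_Z4}"
    then show "{lattice_index L M | M. SSL L M} = {m. \<exists>k::int. k \<noteq> 0 \<and> int m = k\<^sup>2}"
      by (elim insertE emptyE) (simp_all only: ih id iz)
    from L show "finite {M. SSL L M \<and> lattice_index L M = m}" for m
      by (elim insertE emptyE) (simp_all only: finite_SSL_hurwitz finite_SSL_D4 finite_SSL_Z4)
    from L show "multiplicative_fun (SSL_count L)"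
      by (elim insertE emptyE) (simp_all only: D4 multiplicative_SSL_count)
    fix s :: complex assume s: "Re s > 1"
    from L show "(\<lambda>m. of_nat (SSL_count L m) * of_nat m powr (- s) :: complex) summable_on {1..}"
      by (elim insertE emptyE) (simp_all only: D4 sh[OF s] SSL_series_Z4(1)[OF s])
  next
    fix s :: complex assume s: "Re s > 1"
    show "(\<lambda>I. of_nat (lattice_index hurwitz I) powr (- s) :: complex)
        summable_on {I. hurwitz_left_ideal I \<and> I \<noteq> {0}}" by (rule sJ[OF s])
    show "SSL_series hurwitz s = (zeta_J s)\<^sup>2 / ((1 + 4 powr (- s)) * zeta (4 * s))"
      "SSL_series hurwitz s = (1 - 2 powr (1 - 2 * s))\<^sup>2 / (1 + 4 powr (- s)) *
          ((zeta (2 * s) * zeta (2 * s - 1))\<^sup>2 / zeta (4 * s))"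
      by (rule SSL_series_hurwitz_formula[OF s])+
    show "SSL_series lattice_D4 s = SSL_series hurwitz s" by (rule D4s)
    show "SSL_series lattice_Z4 s = (1 + 2 / 4 powr s) * SSL_series hurwitz s"
      unfolding four by (rule SSL_series_Z4(2)[OF s])
  qed
qed

end
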